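(* Let $r\ge 2$ and let $T\in \mathrm{ITM}(r)$ be an interval translation map. Let $J_0,J_1,\dots,J_n$ ($n\ge 0$) be intervals contained in the attractor $X$ with pairwise disjoint orbits, where $J_0$ is an interval component of $X$ and $J_1,\dots,J_n$ are maximal periodic intervals. Assume that both boundary points of $J_0$ land on discontinuities of $T$ before returning to $J_0$, and that the boundary points of $J_1,\dots,J_n$ land on discontinuities of $T$. Let $\mathcal{C}_{\neg X}$ be the set of all signed discontinuities that eventually land on a discontinuity and that are not contained in $X$. Suppose there are real coefficients - $\alpha^0_j$ ($0\le j\le N_0$), $\alpha^{0,+}_j$ ($0\le j\le N_0-1$), $\alpha^{0,-}_j$ ($1\le j\le N_0$), - $\alpha^{0,+}(j,k)$ ($0\le j\le N_0-1$, $1\le k\le m^{0,+}_j-1$), $\alpha^{0,-}(j,k)$ ($1\le j\le N_0$, $1\le k\le m_j^{0,-}-1$), - $\alpha^{i,+}(0,k)$ ($1\le i\le n$, $1\le k\le m_0^{i,+}$), $\alpha^{i,-}(1,k)$ ($1\le i\le n$, $1\le k\le m_1^{i,-}$), - $\alpha_\beta$ ($\beta\in\mathcal{C}_{\neg X}$) such that $$\sum_{i=1}^n\sum_{k=1}^{m_0^{i,+}}\alpha^{i,+}(0,k)\,C^{i,+}(0,k)+\sum_{i=1}^n\sum_{k=1}^{m_1^{i,-}}\alpha^{i,-}(1,k)\,C^{i,-}(1,k)$$ $$+\sum_{j=0}^{N_0-1}\Big(\sum_{k=1}^{m_j^{0,+}-1}\alpha^{0,+}(j,k)\,C^{0,+}(j,k)+\alpha_j^{0,+}R_j^{0,+}\Big)+\sum_{j=1}^{N_0}\Big(\sum_{k=1}^{m_j^{0,-}-1}\alpha^{0,-}(j,k)\,C^{0,-}(j,k)+\alpha_j^{0,-}R_j^{0,-}\Big)$$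 $$+\sum_{j=0}^{N_0}\alpha_j^0L_j^0+\sum_{\beta\in\mathcal{C}_{\neg X}}\alpha_\beta C_\beta=0 .$$ Then, for all $1\le i\le n$, $$\alpha^{i,+}(0,1)=\dots=\alpha^{i,+}(0,m_0^{i,+})=-\alpha^{i,-}(1,1)=\dots=-\alpha^{i,-}(1,m_1^{i,-}),$$ and, for all $0\le j\le N_0-1$, $$\alpha^{0,+}(j,1)=\dots=\alpha^{0,+}(j,m_j^{0,+}-1)=\alpha_j^{0,+}=-\alpha^{0,-}(j+1,1)=\dots=-\alpha^{0,-}(j+1,m_{j+1}^{0,-}-1)=-\alpha^{0,-}_{j+1}.$$ Moreover, with the convention $\alpha^{0,\pm}(j,m_j^{0,\pm}):=\alpha_j^{0,\pm}$ (relevant when $m_j^{0,\pm}=1$), $$\alpha_0^0=\alpha^{0,+}(0,1),\qquad \alpha_{N_0}^0=\alpha^{0,-}(N_0,1),\qquad \alpha_j^0=\alpha^{0,+}(j,1)+\alpha^{0,-}(j,1)\ \ (1\le j\le N_0-1),\qquad \alpha_\beta=0\ \ (\beta\in\mathcal{C}_{\neg X}).$$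
   Context: **ITMs.** $I=[0,1)$. An interval translation map on $r\ge2$ intervals is given by $0=\beta_0<\beta_1<\dots<\beta_{r-1}<\beta_r=1$ and $\gamma_1,\dots,\gamma_r$ with $\gamma_s\in[-\beta_{s-1},1-\beta_s]$, via $T(x)=x+\gamma_s$ for $x\in I_s:=[\beta_{s-1},\beta_s)$; $\mathrm{ITM}(r)\subset\mathbb{R}^{2r-1}$ is the space of such parameters $(\gamma\,\beta)$. $\beta_1,\dots,\beta_{r-1}$ are called the discontinuities of $T$. Set $X_n=T^n(I)$ and $X=\bigcap_{n\ge0}X_n$ (the attractor). Intervals are half-open $[a,b)$ with $a<b$. **Signed points.** For $x\in[0,1]$ let $x^+$ (for $x<1$) and $x^-$ (for $x>0$) denote the right and left germs at $x$; $x^+$ is immediately to the right of $x$ and $x^-$ immediately to its left, so $[a,b)$ contains $x^+$ iff $a\le x<b$ and contains $x^-$ iff $a<x\le b$. The map acts on signed points by $T^m(x^+):=(\lim_{y\downarrow x}T^m(y))^+$ and $T^m(x^-):=(\lim_{y\uparrow x}T^m(y))^-$. The sets $X_n$ are finite unions of half-open intervals, and a signed point is in $X$ if it is in every $X_n$. The set of signed discontinuities is $\mathcal{C}=\{\beta_1^\pm,\dots,\beta_{r-1}^\pm\}$, and $\mathrm{ind}(\beta_s^\pm)=\mathrm{ind}(\beta_s)=s$. A signed (resp. geometric) point lands on a discontinuity at time $t\ge0$ if its $t$-th iterate is a signed (resp. geometric) discontinuity. The orbit of a set $S$ is $\bigcup_{t\ge0}T^t(S)$. The itinerary of $x$ is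 the sequence of indices $s$ with $T^t(x)\in I_s$, $t\ge 0$. **Intervals in $X$.** An interval component of $X$ is a connected component of $X$ that is an interval of positive length (regarded as half-open, $[x,y)$). A maximal periodic interval is a maximal interval consisting of periodic points with the same itinerary. For an interval $J=[x,y)\subset X$ of one of these kinds, the first return map $R_J$ is defined on all of $J$, and $J$ is partitioned into finitely many maximal half-open intervals $J_1,\dots,J_N$ (from left to right), $J_j=[a_{j-1},a_j)$, $a_0=x$, $a_N=y$, such that no point in the interior of $J_j$ lands on a discontinuity of $T$ before returning to $J$ (time $0$ counts). If $J$ is a maximal periodic interval then $N=1$ and $R_J$ is the identity. **Vectors.** $W(r)=\mathbb{R}^r\oplus\mathbb{R}^{r-1}$ with canonical bases $\mathbf e_1,\dots,\mathbf e_r$ and $\mathbf f_1,\dots,\mathbf f_{r-1}$. For a (signed or geometric) point $z$ and $t\ge 0$, $k_s(z,t):=\#\{0\le i<t: T^i(z)\in I_s\}$. For $0\le j\le N-1$ let $\beta^{+}(j,1),\dots,\beta^{+}(j,m_j^{+})$ be the successive signed discontinuities in the orbit of $a_j^+$ from time $0$ up to, but not including, its return to $J$; for $1\le j\le N$ let $\beta^-(j,1),\dots,\beta^-(j,m_j^-)$ be those of $a_j^-$. For $1\le j\le N-1$, $\beta^+(j,1)$ and $\beta^-(j,1)$ are the two sides of a single discontinuity $\beta(j)$; $\beta(0)$ and $\beta(N)$ are the geometric discontinuities underlying $\beta^+(0,1)$ and $\beta^-(N,1)$. - First landing vectors, $0\le j\le N$: $L_j=\big(\sum_s k_s(a_j,l_j)\mathbf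 e_s,\,-\mathbf f_{\mathrm{ind}(\beta(j))}\big)$, where $l_j\ge0$ is the first landing time of $a_j$ on $\beta(j)$ (for $j=0$, $j=N$ one uses $a_0^+$, $a_N^-$). - Critical connection vectors, $1\le k<m_j^{\pm}$: $C^{\pm}(j,k)=\big(\sum_s k_s(\beta^{\pm}(j,k),q^{\pm}(j,k))\mathbf e_s,\ \mathbf f_{\mathrm{ind}(\beta^{\pm}(j,k))}-\mathbf f_{\mathrm{ind}(\beta^{\pm}(j,k+1))}\big)$, where $q^\pm(j,k)$ is the landing time of $\beta^\pm(j,k)$ on $\beta^\pm(j,k+1)$. - Return vectors: $R_j^{\pm}=\big(\sum_s k_s(\beta^{\pm}(j,m_j^\pm),r_j^\pm)\mathbf e_s,\ \mathbf f_{\mathrm{ind}(\beta^\pm(j,m_j^\pm))}\big)$, where $r_j^\pm$ is the time at which $\beta^\pm(j,m_j^\pm)$ lands in $J$. A superscript $i$ on $N,m,L,C,R$ means the object is taken for $J=J_i$ (with $N_i$ the number of intervals in the partition). For $i\ge1$ (maximal periodic $J_i$, $N_i=1$) one additionally sets $C^{i,+}(0,m_0^{i,+}):=R_0^{i,+}+L_0^i$ and $C^{i,-}(1,m_1^{i,-}):=R_1^{i,-}+L_1^i$. For a signed discontinuity $\beta$ that eventually lands (at a time $\geq 1$) on a discontinuity, let $\beta'$ be the first such discontinuity, $q(\beta)$ the landing time, and $C_\beta=\big(\sum_s k_s(\beta,q(\beta))\mathbf e_s,\ \mathbf f_{\mathrm{ind}(\beta)}-\mathbf f_{\mathrm{ind}(\beta')}\big)$.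 *)

theory Defs
  imports "HOL-Analysis.Analysis" "HOL-Analysis.Finite_Function_Topology"
begin

(* bet T s is beta_s (0 <= s <= r) and gam T s is gamma_s (1 <= s <= r); values at other
   indices are never used. *)
record itm =
  nint :: nat
  bet :: "nat \<Rightarrow> real"
  gam :: "nat \<Rightarrow> real"

definition ITM :: "nat \<Rightarrow> itm set" where
  "ITM r = {T. nint T = r \<and> bet T 0 = 0 \<and> bet T r = 1 \<and>
     (\<forall>s<r. bet T s < bet T (Suc s)) \<and>
     (\<forall>s\<in>{1..r}. - bet T (s - 1) \<le> gam T s \<and> gam T s \<le> 1 - bet T s)}"

(* The pair (a, b) stands for the half-open interval [a,b). *)
type_synonym interval = "real \<times> real"

definition ivl :: "interval \<Rightarrow> real set" where
  "ivl J = {fst J..<snd J}"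

definition cell :: "itm \<Rightarrow> nat \<Rightarrow> interval" where
  "cell T s = (bet T (s - 1), bet T s)"

definition idx :: "itm \<Rightarrow> real \<Rightarrow> nat" where
  "idx T x = (THE s. s \<in> {1..nint T} \<and> x \<in> ivl (cell T s))"

definition itm_map :: "itm \<Rightarrow> real \<Rightarrow> real" where
  "itm_map T x = x + gam T (idx T x)"

definition discs :: "itm \<Rightarrow> real set" where
  "discs T = bet T ` {1..nint T - 1}"

definition disc_ind :: "itm \<Rightarrow> real \<Rightarrow> nat" where
  "disc_ind T b = (THE s. s \<in> {1..nint T - 1} \<and> bet T s = b)"

definition Xn :: "itm \<Rightarrow> nat \<Rightarrow> real set" where
  "Xn T n = (itm_map T ^^ n) ` {0..<1}"

definition attractor :: "itm \<Rightarrow> real set" where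
  "attractor T = (\<Inter>n. Xn T n)"

definition orbit :: "itm \<Rightarrow> real set \<Rightarrow> real set" where
  "orbit T S = (\<Union>t. (itm_map T ^^ t) ` S)"

definition itinerary :: "itm \<Rightarrow> real \<Rightarrow> nat \<Rightarrow> nat" where
  "itinerary T x t = idx T ((itm_map T ^^ t) x)"

datatype side = Plus | Minus

type_synonym spoint = "real \<times> side"

fun sp_in :: "spoint \<Rightarrow> interval \<Rightarrow> bool" where
  "sp_in (x, Plus) J \<longleftrightarrow> fst J \<le> x \<and> x < snd J"
| "sp_in (x, Minus) J \<longleftrightarrow> fst J < x \<and> x \<le> snd J"

fun siter :: "itm \<Rightarrow> nat \<Rightarrow> spoint \<Rightarrow> spoint" where
  "siter T m (x, Plus) = (Lim (at_right x) (itm_map T ^^ m), Plus)"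
| "siter T m (x, Minus) = (Lim (at_left x) (itm_map T ^^ m), Minus)"

(* Membership in a finite union of half-open intervals, stated so that it does not depend on
   how the set is decomposed. It is only used for the sets Xn T n. *)
definition sp_in_set :: "spoint \<Rightarrow> real set \<Rightarrow> bool" where
  "sp_in_set z S \<longleftrightarrow> (\<exists>J. ivl J \<subseteq> S \<and> sp_in z J)"

(* This does not say that a one-sided neighbourhood of the point lies in the attractor: the
   neighbourhoods contained in Xn T n may shrink with n. *)
definition sp_in_attractor :: "itm \<Rightarrow> spoint \<Rightarrow> bool" where
  "sp_in_attractor T z \<longleftrightarrow> (\<forall>n. sp_in_set z (Xn T n))"

definition sdiscs :: "itm \<Rightarrow> spoint set" where
  "sdiscs T = discs T \<times> UNIV"

(* A connected component of positive length of the attractor may or may not contain its right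
   endpoint; in both cases it is regarded as the half-open interval. *)
definition interval_component :: "itm \<Rightarrow> interval \<Rightarrow> bool" where
  "interval_component T J \<longleftrightarrow> fst J < snd J \<and>
     ({fst J..<snd J} \<in> components (attractor T) \<or> {fst J..snd J} \<in> components (attractor T))"

definition periodic_ivl :: "itm \<Rightarrow> interval \<Rightarrow> bool" where
  "periodic_ivl T J \<longleftrightarrow> fst J < snd J \<and> ivl J \<subseteq> {0..<1} \<and>
     (\<forall>z\<in>ivl J. \<exists>p>0. (itm_map T ^^ p) z = z) \<and>
     (\<forall>z\<in>ivl J. \<forall>w\<in>ivl J. itinerary T z = itinerary T w)"

definition maximal_periodic_ivl :: "itm \<Rightarrow> interval \<Rightarrow> bool" where
  "maximal_periodic_ivl T J \<longleftrightarrow> periodic_ivl T J \<and>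
     (\<forall>K. periodic_ivl T K \<and> ivl J \<subseteq> ivl K \<longrightarrow> K = J)"

definition lands_before_return :: "itm \<Rightarrow> interval \<Rightarrow> real \<Rightarrow> bool" where
  "lands_before_return T J z \<longleftrightarrow>
     (\<exists>t. (itm_map T ^^ t) z \<in> discs T \<and> (\<forall>i\<in>{1..t}. (itm_map T ^^ i) z \<notin> ivl J))"

definition unbroken :: "itm \<Rightarrow> interval \<Rightarrow> interval \<Rightarrow> bool" where
  "unbroken T J K \<longleftrightarrow> fst K < snd K \<and> ivl K \<subseteq> ivl J \<and>
     (\<forall>z\<in>{fst K<..<snd K}. \<not> lands_before_return T J z)"

(* The points a 0 < ... < a N are the endpoints of the partition J_1, ..., J_N of J,
   with J_j = [a (j-1), a j). *)
definition return_partition :: "itm \<Rightarrow> interval \<Rightarrow> nat \<Rightarrow> (nat \<Rightarrow> real) \<Rightarrow> bool" where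
  "return_partition T J N a \<longleftrightarrow> a 0 = fst J \<and> a N = snd J \<and> (\<forall>j<N. a j < a (Suc j)) \<and>
     (\<forall>j\<in>{1..N}. unbroken T J (a (j - 1), a j) \<and>
        (\<forall>K. unbroken T J K \<and> ivl (a (j - 1), a j) \<subseteq> ivl K \<longrightarrow> K = (a (j - 1), a j)))"

(* Times at which a signed point lands on a discontinuity before its return to J (time 0 counts
   as a landing time, but not as a return). *)
definition land_times :: "itm \<Rightarrow> interval \<Rightarrow> spoint \<Rightarrow> nat set" where
  "land_times T J z =
     {t. siter T t z \<in> sdiscs T \<and> (\<forall>i\<in>{1..t}. \<not> sp_in (siter T i z) J)}"

(* W(r) is the span of e_1, ..., e_r, f_1, ..., f_(r-1) in the following space, which does not
   depend on r. *)
type_synonym wvec = "(nat \<Rightarrow>\<^sub>0 real) \<times> (nat \<Rightarrow>\<^sub>0 real)"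

definition evec :: "nat \<Rightarrow> wvec" where
  "evec s = (Poly_Mapping.single s 1, 0)"

definition fvec :: "nat \<Rightarrow> wvec" where
  "fvec s = (0, Poly_Mapping.single s 1)"

definition kgeo :: "itm \<Rightarrow> real \<Rightarrow> nat \<Rightarrow> nat \<Rightarrow> nat" where
  "kgeo T x t s = card {i. i < t \<and> (itm_map T ^^ i) x \<in> ivl (cell T s)}"

definition ksgn :: "itm \<Rightarrow> spoint \<Rightarrow> nat \<Rightarrow> nat \<Rightarrow> nat" where
  "ksgn T z t s = card {i. i < t \<and> sp_in (siter T i z) (cell T s)}"

definition ksum :: "itm \<Rightarrow> (nat \<Rightarrow> nat) \<Rightarrow> wvec" where
  "ksum T k = (\<Sum>s=1..nint T. real (k s) *\<^sub>R evec s)"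

(* In the following, J is an interval with partition points a 0, ..., a N, and the signed points
   (a j, Plus) and (a j, Minus) are the starting points of the orbits. *)

definition mnum :: "itm \<Rightarrow> interval \<Rightarrow> (nat \<Rightarrow> real) \<Rightarrow> side \<Rightarrow> nat \<Rightarrow> nat" where
  "mnum T J a \<sigma> j = card (land_times T J (a j, \<sigma>))"

(* The k-th signed discontinuity met before the return to J, 1 <= k <= mnum T J a \<sigma> j. *)
definition sdisc_at ::
  "itm \<Rightarrow> interval \<Rightarrow> (nat \<Rightarrow> real) \<Rightarrow> side \<Rightarrow> nat \<Rightarrow> nat \<Rightarrow> spoint" where
  "sdisc_at T J a \<sigma> j k =
     siter T (sorted_list_of_set (land_times T J (a j, \<sigma>)) ! (k - 1)) (a j, \<sigma>)"

definition disc_at :: "itm \<Rightarrow> interval \<Rightarrow> nat \<Rightarrow> (nat \<Rightarrow> real) \<Rightarrow> nat \<Rightarrow> real" where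
  "disc_at T J N a j = fst (sdisc_at T J a (if j = N then Minus else Plus) j 1)"

definition Lvec :: "itm \<Rightarrow> interval \<Rightarrow> nat \<Rightarrow> (nat \<Rightarrow> real) \<Rightarrow> nat \<Rightarrow> wvec" where
  "Lvec T J N a j =
     ksum T
       (if j = 0 then
          ksgn T (a j, Plus) (LEAST t. fst (siter T t (a j, Plus)) = disc_at T J N a j)
        else if j = N then
          ksgn T (a j, Minus) (LEAST t. fst (siter T t (a j, Minus)) = disc_at T J N a j)
        else
          kgeo T (a j) (LEAST t. (itm_map T ^^ t) (a j) = disc_at T J N a j))
     - fvec (disc_ind T (disc_at T J N a j))"

definition Cvec ::
  "itm \<Rightarrow> interval \<Rightarrow> (nat \<Rightarrow> real) \<Rightarrow> side \<Rightarrow> nat \<Rightarrow> nat \<Rightarrow> wvec" where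
  "Cvec T J a \<sigma> j k =
     (let b = sdisc_at T J a \<sigma> j k; b' = sdisc_at T J a \<sigma> j (Suc k);
          q = (LEAST q. 0 < q \<and> siter T q b = b')
      in ksum T (ksgn T b q) + fvec (disc_ind T (fst b)) - fvec (disc_ind T (fst b')))"

definition Rvec :: "itm \<Rightarrow> interval \<Rightarrow> (nat \<Rightarrow> real) \<Rightarrow> side \<Rightarrow> nat \<Rightarrow> wvec" where
  "Rvec T J a \<sigma> j =
     (let b = sdisc_at T J a \<sigma> j (mnum T J a \<sigma> j);
          q = (LEAST q. 0 < q \<and> sp_in (siter T q b) J)
      in ksum T (ksgn T b q) + fvec (disc_ind T (fst b)))"

(* The vectors C for a maximal periodic interval: the last one closes up the cycle. *)
definition Cper ::
  "itm \<Rightarrow> interval \<Rightarrow> nat \<Rightarrow> (nat \<Rightarrow> real) \<Rightarrow> side \<Rightarrow> nat \<Rightarrow> nat \<Rightarrow> wvec" where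
  "Cper T J N a \<sigma> j k =
     (if k = mnum T J a \<sigma> j then Rvec T J a \<sigma> j + Lvec T J N a j else Cvec T J a \<sigma> j k)"

definition sdiscs_notX :: "itm \<Rightarrow> spoint set" where
  "sdiscs_notX T =
     {b \<in> sdiscs T. (\<exists>t\<ge>1. siter T t b \<in> sdiscs T) \<and> \<not> sp_in_attractor T b}"

definition Cdisc :: "itm \<Rightarrow> spoint \<Rightarrow> wvec" where
  "Cdisc T b =
     (let q = (LEAST q. 1 \<le> q \<and> siter T q b \<in> sdiscs T); b' = siter T q b
      in ksum T (ksgn T b q) + fvec (disc_ind T (fst b)) - fvec (disc_ind T (fst b')))"

end

theory Submission
  imports Defs
begin

text \<open>
Each of the vectors describes a piece of the orbit of one signed point: the coordinates
\<open>e\<close> count the visits to the intervals of continuity, and the coordinates \<open>f\<close> record the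
discontinuities at which the piece begins and ends. A linear relation is therefore read as a
signed charge on signed points, obtained by putting the coefficient of a vector on every point
that its piece of orbit visits. The \<^emph>\<open>tail\<close> of this charge at \<open>y\<close> is the total charge to the
right of \<open>y\<close>; it is a step function.

That the coordinates \<open>e\<close> vanish means that the total charge on every interval of continuity is
zero. The tail in such an interval then depends only on the charge inside it, and the transfer
operator, which sums the tail over the preimages of a point, just moves every charge one step along
its orbit (\<open>transfer\<close>). The change telescopes along every piece of orbit to the difference of its
end and its start. That the coordinates \<open>f\<close> vanish makes all these contributions cancel at the
discontinuities; the cycles over the periodic intervals close up, and what remains lies in the
component \<open>J 0\<close> (\<open>boundary_flux\<close>). So the tail is a fixed point of the transfer operator
outside \<open>J 0\<close>. This has three consequences.

\<^item> The tail lives on the attractor: a point where it does not vanish is in \<open>J 0\<close> or has a preimage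
of the same kind (\<open>tail_support\<close>).

\<^item> The tail is constant along the orbits of the pieces of the intervals \<open>J i\<close>. Indeed the map is
injective on intervals in the attractor, since otherwise it would lose a fixed amount of volume in
every step (\<open>attractor_injective\<close>). Hence these orbits form disjoint towers, all charges sit at
the ends of the floors, and a point of a floor is the only preimage that matters for its image.

\<^item> The tail vanishes in the gap between the two sides of a discontinuity, because only full
intervals of continuity lie beyond it. The charge on a side of a discontinuity is therefore, up to
sign, the value of the tail next to it (\<open>mass_disc\<close>).

A signed discontinuity outside the attractor has no tail next to it and is met by no other piece of
orbit, so its coefficient is zero. The discontinuities at the two ends of a tower all see the one value
of the tail on this tower, with opposite signs at left and right ends, so that all coefficients along
the two ends agree up to sign. The coefficients of the first landing vectors follow by comparing
the coordinate \<open>f\<close> at the discontinuity on which a division point first lands. These discontinuities are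
distinct, except that the two ends of \<open>J 0\<close> may land on the same one; in that case the jump of
the tail at the left end of \<open>J 0\<close> supplies the missing equation.
\<close>

section \<open>Germs of signed points\<close>

declare siter.simps [simp del]

lemma spoint_cases:
  obtains (Plus) x where "z = (x, Plus)" | (Minus) x where "z = (x, Minus)"
  by (metis side.exhaust surj_pair)

lemma ivl_iff_sp_in: "x \<in> ivl J \<longleftrightarrow> sp_in (x, Plus) J"
  by (simp add: ivl_def)

text \<open>One-sided neighbourhoods. A germ contained in an interval turns membership of a signed point
  into an inclusion of sets, in the same way for both sides.\<close>

fun germ :: "spoint \<Rightarrow> real \<Rightarrow> real set" where
  "germ (x, Plus) e = {x..<x + e}"
| "germ (x, Minus) e = {x - e..<x}"

lemma germ_mono: "d \<le> e \<Longrightarrow> germ z d \<subseteq> germ z e"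
  by (cases z rule: spoint_cases) auto

lemma sp_in_iff_germ: "sp_in z J \<longleftrightarrow> (\<exists>e>0. germ z e \<subseteq> ivl J)"
proof (cases z rule: spoint_cases)
  case (Plus x)
  show ?thesis
  proof
    assume "sp_in z J"
    with Plus show "\<exists>e>0. germ z e \<subseteq> ivl J"
      by (intro exI[of _ "snd J - x"]) (auto simp: ivl_def)
  next
    assume "\<exists>e>0. germ z e \<subseteq> ivl J"
    then obtain e where "e > 0" "germ z e \<subseteq> ivl J" by auto
    moreover have "x \<in> germ z e" using Plus \<open>e > 0\<close> by simp
    ultimately show "sp_in z J" using Plus by (auto simp: ivl_def)
  qed
next
  case (Minus x)
  show ?thesis
  proof
    assume "sp_in z J"
    with Minus show "\<exists>e>0. germ z e \<subseteq> ivl J"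
      by (intro exI[of _ "x - fst J"]) (auto simp: ivl_def)
  next
    assume "\<exists>e>0. germ z e \<subseteq> ivl J"
    then obtain e where e: "e > 0" "{x - e..<x} \<subseteq> {fst J..<snd J}"
      using Minus by (auto simp: ivl_def)
    then have "fst J \<le> x - e \<and> x \<le> snd J" by (subst (asm) ivl_subset) auto
    then show "sp_in z J" using Minus e by auto
  qed
qed

lemma germ_shift: "y \<in> germ (x, \<sigma>) e \<Longrightarrow> y - x + w \<in> germ (w, \<sigma>) e"
  by (cases \<sigma>) auto

lemma germ_nonempty: "e > 0 \<Longrightarrow> \<exists>y. y \<in> germ z e"
  by (cases z rule: spoint_cases) (auto intro: exI[of _ "fst z"] exI[of _ "fst z - e"])

lemma germ_is_ivl: "e > 0 \<Longrightarrow> \<exists>K. germ z e = ivl K \<and> sp_in z K"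
proof (cases z rule: spoint_cases)
  case (Plus x)
  assume "e > 0"
  with Plus show ?thesis by (intro exI[of _ "(x, x + e)"]) (auto simp: ivl_def)
next
  case (Minus x)
  assume "e > 0"
  with Minus show ?thesis by (intro exI[of _ "(x - e, x)"]) (auto simp: ivl_def)
qed

section \<open>Interval translation maps on signed points and on the attractor\<close>

lemma atLeastLessThan_lmeasurable: "{a..<b::real} \<in> lmeasurable"
  by (intro bounded_set_imp_lmeasurable) auto

locale translation_map =
  fixes T :: itm and r :: nat
  assumes T_in: "T \<in> ITM r"
begin

lemma nint_eq: "nint T = r" and bet_0: "bet T 0 = 0" and bet_r: "bet T r = 1"
  using T_in by (auto simp: ITM_def)

lemma bet_less: "s < s' \<Longrightarrow> s' \<le> r \<Longrightarrow> bet T s < bet T s'"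
proof (induction s')
  case (Suc s')
  have "bet T s' < bet T (Suc s')" using Suc.prems T_in by (auto simp: ITM_def)
  then show ?case using Suc by (cases "s = s'") auto
qed simp

lemma bet_le: "s \<le> s' \<Longrightarrow> s' \<le> r \<Longrightarrow> bet T s \<le> bet T s'"
  using bet_less[of s s'] by (cases "s = s'") auto

lemma bet_inj: "s \<le> r \<Longrightarrow> s' \<le> r \<Longrightarrow> bet T s = bet T s' \<Longrightarrow> s = s'"
  using bet_less[of s s'] bet_less[of s' s] by (cases s s' rule: linorder_cases) auto

lemma gam_bounds: "s \<in> {1..r} \<Longrightarrow> - bet T (s - 1) \<le> gam T s \<and> gam T s \<le> 1 - bet T s"
  using T_in by (auto simp: ITM_def)

lemma cell_unique:
  assumes "s \<in> {1..r}" "s' \<in> {1..r}" "sp_in z (cell T s)" "sp_in z (cell T s')"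
  shows "s = s'"
proof -
  have *: False if "s < s'" "s \<in> {1..r}" "s' \<in> {1..r}" "sp_in z (cell T s)" "sp_in z (cell T s')"
    for s s'
  proof -
    have "bet T s \<le> bet T (s' - 1)" using that by (intro bet_le) auto
    then show False using that by (cases z rule: spoint_cases) (auto simp: cell_def)
  qed
  show ?thesis using *[of s s'] *[of s' s] assms by (cases s s' rule: linorder_cases) auto
qed

lemma cell_exists:
  assumes "sp_in z (0, 1)"
  shows "\<exists>s\<in>{1..r}. sp_in z (cell T s)"
proof (cases z rule: spoint_cases)
  case (Plus x)
  define s where "s = (LEAST s. x < bet T s)"
  have "x < bet T r" using assms Plus bet_r by auto
  then have s: "x < bet T s" "s \<le> r" unfolding s_def by (auto intro: LeastI Least_le)
  have "s \<noteq> 0" using s assms Plus bet_0 by (cases s) auto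
  moreover from this have "\<not> x < bet T (s - 1)"
    unfolding s_def by (intro not_less_Least) auto
  ultimately show ?thesis using s Plus by (intro bexI[of _ s]) (auto simp: cell_def)
next
  case (Minus x)
  define s where "s = (LEAST s. x \<le> bet T s)"
  have "x \<le> bet T r" using assms Minus bet_r by auto
  then have s: "x \<le> bet T s" "s \<le> r" unfolding s_def by (auto intro: LeastI Least_le)
  have "s \<noteq> 0" using s assms Minus bet_0 by (cases s) auto
  moreover from this have "\<not> x \<le> bet T (s - 1)"
    unfolding s_def by (intro not_less_Least) auto
  ultimately show ?thesis using s Minus by (intro bexI[of _ s]) (auto simp: cell_def)
qed

definition sidx :: "spoint \<Rightarrow> nat" where
  "sidx z = (THE s. s \<in> {1..r} \<and> sp_in z (cell T s))"

lemma sidx_eq: "s \<in> {1..r} \<Longrightarrow> sp_in z (cell T s) \<Longrightarrow> sidx z = s"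
  unfolding sidx_def using cell_unique by blast

lemma sidx: assumes "sp_in z (0, 1)"
  shows "sidx z \<in> {1..r}" "sp_in z (cell T (sidx z))"
  using cell_exists[OF assms] sidx_eq by metis+

text \<open>The action of the map on signed points, given by the cell that contains the germ instead of by
  a limit.\<close>

definition sstep :: "spoint \<Rightarrow> spoint" where
  "sstep z = (fst z + gam T (sidx z), snd z)"

lemma itm_map_cell:
  assumes "s \<in> {1..r}" "x \<in> ivl (cell T s)"
  shows "itm_map T x = x + gam T s"
proof -
  have "s' = s" if "s' \<in> {1..r} \<and> x \<in> ivl (cell T s')" for s'
    using that assms by (intro cell_unique[of s' s "(x, Plus)"]) (simp_all add: ivl_def)
  then have "idx T x = s"
    unfolding idx_def nint_eq using assms by (intro the_equality) auto
  then show ?thesis by (simp add: itm_map_def)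
qed

lemma cell_bounds: assumes "s \<in> {1..r}" shows "0 \<le> bet T (s - 1)" "bet T s \<le> 1"
  "bet T (s - 1) < bet T s"
  using bet_le[of 0 "s - 1"] bet_le[of s r] bet_less[of "s - 1" s] assms bet_0 bet_r by auto

lemma sstep_valid: assumes "sp_in z (0, 1)" shows "sp_in (sstep z) (0, 1)"
proof -
  define s where "s = sidx z"
  have "s \<in> {1..r}" "sp_in z (cell T s)" using sidx[OF assms] by (auto simp: s_def)
  then have "sp_in (fst z + gam T s, snd z) (0, 1)"
    using gam_bounds[of s] by (cases z rule: spoint_cases) (auto simp: cell_def)
  then show ?thesis by (simp add: sstep_def s_def)
qed

lemma itm_map_eq_sstep: assumes "0 \<le> x" "x < 1" shows "(itm_map T x, Plus) = sstep (x, Plus)"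
  using itm_map_cell[of "sidx (x, Plus)" x] sidx[of "(x, Plus)"] assms
  by (auto simp: ivl_iff_sp_in sstep_def)

lemma itm_map_in: assumes "x \<in> {0..<1}" shows "itm_map T x \<in> {0..<1}"
  using itm_map_eq_sstep[of x] sstep_valid[of "(x, Plus)"] assms by (metis atLeastLessThan_iff
    fst_conv snd_conv sp_in.simps(1))

lemma iter_in: "x \<in> {0..<1} \<Longrightarrow> (itm_map T ^^ m) x \<in> {0..<1}"
  by (induction m) (use itm_map_in in auto)

lemma sstep_iter_valid: "sp_in z (0, 1) \<Longrightarrow> sp_in ((sstep ^^ m) z) (0, 1)"
  by (induction m) (auto intro: sstep_valid)

lemma snd_sstep_iter: "snd ((sstep ^^ m) z) = snd z"
  by (induction m) (auto simp: sstep_def)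

text \<open>A small enough germ stays inside one cell at each of the first \<open>m\<close> steps and is
  therefore only translated. This evaluates the limits in the definition of
  \<open>siter\<close>.\<close>

lemma iter_germ:
  assumes "sp_in z (0, 1)"
  shows "\<exists>e>0. \<forall>y\<in>germ z e. (itm_map T ^^ m) y = y - fst z + fst ((sstep ^^ m) z)"
proof (induction m)
  case 0
  show ?case by (rule exI[of _ 1]) auto
next
  case (Suc m)
  then obtain e where e: "e > 0"
    "\<And>y. y \<in> germ z e \<Longrightarrow> (itm_map T ^^ m) y = y - fst z + fst ((sstep ^^ m) z)" by auto
  define w where "w = (sstep ^^ m) z"
  have w: "w = (fst w, snd z)" unfolding w_def by (simp add: prod_eq_iff snd_sstep_iter)
  have v: "sp_in w (0, 1)" unfolding w_def by (rule sstep_iter_valid[OF assms])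
  obtain d where d: "d > 0" "germ w d \<subseteq> ivl (cell T (sidx w))"
    using sidx(2)[OF v] sp_in_iff_germ by blast
  show ?case
  proof (intro exI[of _ "min d e"] conjI ballI)
    show "min d e > 0" using d e by simp
    fix y assume y: "y \<in> germ z (min d e)"
    then have 1: "(itm_map T ^^ m) y = y - fst z + fst w"
      using e(2)[of y] germ_mono[of "min d e" e z] by (auto simp: w_def)
    have "y - fst z + fst w \<in> germ (fst w, snd z) (min d e)"
      using y by (intro germ_shift) auto
    then have "y - fst z + fst w \<in> germ w d"
      using w germ_mono[of "min d e" d w] by auto
    then have "itm_map T (y - fst z + fst w) = y - fst z + fst w + gam T (sidx w)"
      using d(2) sidx(1)[OF v] by (intro itm_map_cell) auto
    then show "(itm_map T ^^ Suc m) y = y - fst z + fst ((sstep ^^ Suc m) z)"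
      using 1 by (simp add: sstep_def w_def)
  qed
qed

lemma siter_eqI:
  assumes "e > 0" "\<And>y. y \<in> germ (x, \<sigma>) e \<Longrightarrow> (itm_map T ^^ m) y = y - x + w"
  shows "siter T m (x, \<sigma>) = (w, \<sigma>)"
proof (cases \<sigma>)
  case Plus
  have "((\<lambda>y. y - x + w) \<longlongrightarrow> x - x + w) (at_right x)" by (intro tendsto_intros)
  then have "((itm_map T ^^ m) \<longlongrightarrow> x - x + w) (at_right x)"
    by (rule Lim_transform_eventually)
      (use assms Plus in \<open>auto simp: eventually_at_right[of x "x + 1"] intro!: exI[of _ "x + e"]\<close>)
  then show ?thesis using Plus by (auto simp: siter.simps intro!: tendsto_Lim)
next
  case Minus
  have "((\<lambda>y. y - x + w) \<longlongrightarrow> x - x + w) (at_left x)" by (intro tendsto_intros)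
  then have "((itm_map T ^^ m) \<longlongrightarrow> x - x + w) (at_left x)"
    by (rule Lim_transform_eventually)
      (use assms Minus in \<open>auto simp: eventually_at_left[of "x - 1" x] intro!: exI[of _ "x - e"]\<close>)
  then show ?thesis using Minus by (auto simp: siter.simps intro!: tendsto_Lim)
qed

lemma siter_eq_sstep: assumes "sp_in z (0, 1)" shows "siter T m z = (sstep ^^ m) z"
proof -
  obtain e where "e > 0"
    "\<And>y. y \<in> germ z e \<Longrightarrow> (itm_map T ^^ m) y = y - fst z + fst ((sstep ^^ m) z)"
    using iter_germ[OF assms] by blast
  then have "siter T m (fst z, snd z) = (fst ((sstep ^^ m) z), snd z)"
    by (intro siter_eqI) auto
  then show ?thesis using snd_sstep_iter[of m z] by (metis prod.collapse)
qed

lemma siter_valid: "sp_in z (0, 1) \<Longrightarrow> sp_in (siter T m z) (0, 1)"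
  by (simp add: siter_eq_sstep sstep_iter_valid)

lemma siter_Suc: "sp_in z (0, 1) \<Longrightarrow> siter T (Suc m) z = sstep (siter T m z)"
  by (simp add: siter_eq_sstep)

lemma siter_0: "sp_in z (0, 1) \<Longrightarrow> siter T 0 z = z"
  by (simp add: siter_eq_sstep)

lemma siter_add: "sp_in z (0, 1) \<Longrightarrow> siter T m (siter T k z) = siter T (k + m) z"
  by (simp add: siter_eq_sstep sstep_iter_valid funpow_add add.commute[of k])

lemma siter_Plus: assumes "x \<in> {0..<1}" shows "siter T m (x, Plus) = ((itm_map T ^^ m) x, Plus)"
proof -
  have v: "sp_in (x, Plus) (0, 1)" using assms by simp
  show ?thesis
  proof (induction m)
    case 0
    show ?case using siter_0[OF v] by simp
  next
    case (Suc m)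
    have "(itm_map T ^^ m) x \<in> {0..<1}" using iter_in[OF assms] by simp
    then show ?case using siter_Suc[OF v] Suc itm_map_eq_sstep[of "(itm_map T ^^ m) x"] by simp
  qed
qed

lemma discs_eq: "discs T = bet T ` {1..r - 1}"
  by (simp add: discs_def nint_eq)

lemma finite_sdiscs: "finite (sdiscs T)"
proof -
  have "UNIV = {Plus, Minus}" using side.exhaust by auto
  then have "finite (UNIV :: side set)" by (metis finite.emptyI finite.insertI)
  then show ?thesis by (simp add: sdiscs_def discs_eq)
qed

lemma disc_ind_bet: "s \<in> {1..r - 1} \<Longrightarrow> disc_ind T (bet T s) = s"
  unfolding disc_ind_def nint_eq by (rule the_equality) (auto intro: bet_inj)

lemma disc_ind: assumes "b \<in> discs T"
  shows "disc_ind T b \<in> {1..r - 1}" "bet T (disc_ind T b) = b"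
  using assms disc_ind_bet by (auto simp: discs_eq)

lemma discs_pos: assumes "b \<in> discs T" shows "0 < b" "b < 1"
  using disc_ind[OF assms] bet_less[of 0 "disc_ind T b"] bet_less[of "disc_ind T b" r] bet_0 bet_r
  by auto

lemma sdisc_valid: "z \<in> sdiscs T \<Longrightarrow> sp_in z (0, 1)"
  using discs_pos[of "fst z"] by (cases z rule: spoint_cases) (auto simp: sdiscs_def)

lemma ivl_in_cell:
  assumes "c < d" "{c..<d} \<subseteq> {0..<1}" "\<And>x. x \<in> {c<..<d} \<Longrightarrow> x \<notin> discs T"
  shows "\<exists>s\<in>{1..r}. {c..<d} \<subseteq> ivl (cell T s)"
proof -
  have c: "0 \<le> c" "d \<le> 1" using assms(1,2) by auto
  then have v: "sp_in (c, Plus) (0, 1)" using assms(1) by auto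
  define s where "s = sidx (c, Plus)"
  have s: "s \<in> {1..r}" "bet T (s - 1) \<le> c" "c < bet T s"
    using sidx[OF v] by (auto simp: s_def cell_def)
  have "d \<le> bet T s"
  proof (rule ccontr)
    assume *: "\<not> d \<le> bet T s"
    then have "s \<noteq> r" using c bet_r by auto
    then have "bet T s \<in> discs T" using s(1) by (auto simp: discs_eq)
    then show False using assms(3)[of "bet T s"] * s by auto
  qed
  then show ?thesis using s by (intro bexI[of _ s]) (auto simp: ivl_def cell_def)
qed

lemma Xn_Suc: "Xn T (Suc n) = itm_map T ` Xn T n"
  by (auto simp: Xn_def image_image)

lemma Xn_0: "Xn T 0 = {0..<1}"
  by (simp add: Xn_def)

lemma Xn_decreasing: "Xn T (Suc n) \<subseteq> Xn T n"
proof (induction n)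
  case 0
  show ?case using itm_map_in by (auto simp: Xn_Suc Xn_0)
next
  case (Suc n)
  then show ?case by (auto simp: Xn_Suc)
qed

lemma attractor_subset: "attractor T \<subseteq> {0..<1}"
  using Xn_0 by (auto simp: attractor_def)

lemma attractor_invariant: "x \<in> attractor T \<Longrightarrow> itm_map T x \<in> attractor T"
proof -
  assume x: "x \<in> attractor T"
  have "itm_map T x \<in> Xn T n" for n
    using x Xn_decreasing[of n] unfolding Xn_Suc by (auto simp: attractor_def)
  then show ?thesis by (auto simp: attractor_def)
qed

lemma iter_attractor: "x \<in> attractor T \<Longrightarrow> (itm_map T ^^ t) x \<in> attractor T"
  by (induction t) (auto intro: attractor_invariant)

lemma sp_in_attractorI:
  assumes "e > 0" "germ z e \<subseteq> attractor T"
  shows "sp_in_attractor T z"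
proof -
  obtain K where "germ z e = ivl K" "sp_in z K" using germ_is_ivl[OF assms(1)] by blast
  then have "ivl K \<subseteq> Xn T n" for n using assms(2) by (auto simp: attractor_def)
  then show ?thesis using \<open>sp_in z K\<close> unfolding sp_in_attractor_def sp_in_set_def by blast
qed

text \<open>The map cuts a set into finitely many pieces and translates them, so volume cannot grow.\<close>

lemma Xn_measurable: "Xn T n \<in> lmeasurable"
  and image_measure: "A \<in> lmeasurable \<Longrightarrow> A \<subseteq> {0..<1} \<Longrightarrow>
    itm_map T ` A \<in> lmeasurable \<and> measure lebesgue (itm_map T ` A) \<le> measure lebesgue A"
proof -
  have cells: "{0..<1} = (\<Union>s\<in>{1..r}. ivl (cell T s))"
  proof
    show "{0..<1} \<subseteq> (\<Union>s\<in>{1..r}. ivl (cell T s))"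
    proof
      fix x :: real assume "x \<in> {0..<1}"
      then have "sp_in (x, Plus) (0, 1)" by simp
      then show "x \<in> (\<Union>s\<in>{1..r}. ivl (cell T s))"
        using cell_exists ivl_iff_sp_in by blast
    qed
    have "ivl (cell T s) \<subseteq> {0..<1}" if "s \<in> {1..r}" for s
      using cell_bounds[OF that] by (auto simp: ivl_def cell_def)
    then show "(\<Union>s\<in>{1..r}. ivl (cell T s)) \<subseteq> {0..<1}" by blast
  qed
  have cm: "ivl (cell T s) \<in> lmeasurable" for s
    unfolding ivl_def by (rule atLeastLessThan_lmeasurable)
  have disj: "pairwise (\<lambda>s s'. disjnt (ivl (cell T s)) (ivl (cell T s'))) {1..r}"
    unfolding pairwise_def disjnt_def using cell_unique ivl_iff_sp_in by blast
  have main: "itm_map T ` A \<in> lmeasurable \<and> measure lebesgue (itm_map T ` A) \<le> measure lebesgue A"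
    if A: "A \<in> lmeasurable" "A \<subseteq> {0..<1}" for A
  proof -
    have pm: "A \<inter> ivl (cell T s) \<in> lmeasurable" for s using A cm by (intro fmeasurable.Int)
    have im: "itm_map T ` A = (\<Union>s\<in>{1..r}. (+) (gam T s) ` (A \<inter> ivl (cell T s)))" (is "_ = ?U")
    proof
      show "itm_map T ` A \<subseteq> ?U"
      proof
        fix y assume "y \<in> itm_map T ` A"
        then obtain x where x: "x \<in> A" "y = itm_map T x" by auto
        then obtain s where s: "s \<in> {1..r}" "x \<in> ivl (cell T s)" using A cells by auto
        then have "y = gam T s + x" using x itm_map_cell by simp
        then show "y \<in> ?U" using s x by auto
      qed
      show "?U \<subseteq> itm_map T ` A"
        using itm_map_cell by (auto simp: add.commute intro!: rev_image_eqI)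
    qed
    have m1: "(+) (gam T s) ` (A \<inter> ivl (cell T s)) \<in> lmeasurable" for s
      using pm by (rule measurable_translation)
    have "measure lebesgue (itm_map T ` A)
        \<le> (\<Sum>s\<in>{1..r}. measure lebesgue ((+) (gam T s) ` (A \<inter> ivl (cell T s))))"
      unfolding im using m1 by (intro measure_UNION_le) auto
    also have "\<dots> = (\<Sum>s\<in>{1..r}. measure lebesgue (A \<inter> ivl (cell T s)))"
      by (simp add: measure_translation)
    also have "\<dots> = measure lebesgue (\<Union>s\<in>{1..r}. A \<inter> ivl (cell T s))"
      using pm disj
      by (intro measure_UNION'[symmetric]) (auto simp: pairwise_def disjnt_def)
    also have "(\<Union>s\<in>{1..r}. A \<inter> ivl (cell T s)) = A" using A cells by auto
    finally show ?thesis using m1 im by (auto intro!: fmeasurable.finite_UN)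
  qed
  show "Xn T n \<in> lmeasurable"
  proof (induction n)
    case (Suc n)
    have "Xn T n \<subseteq> {0..<1}" using iter_in by (auto simp: Xn_def)
    with Suc main show ?case by (simp add: Xn_Suc)
  qed (simp add: Xn_0 atLeastLessThan_lmeasurable)
  show "A \<in> lmeasurable \<Longrightarrow> A \<subseteq> {0..<1} \<Longrightarrow>
    itm_map T ` A \<in> lmeasurable \<and> measure lebesgue (itm_map T ` A) \<le> measure lebesgue A"
    by (rule main)
qed

text \<open>If two disjoint intervals of the attractor had the same image, then the image of \<open>Xn T
  n\<close> would not change when one of them is removed. So \<open>Xn T (Suc n)\<close> would
  have less volume than \<open>Xn T n\<close>, by the same positive amount for all
  \<open>n\<close>.\<close>

lemma attractor_injective:
  assumes e: "e > 0" and sub: "{x..<x + e} \<subseteq> attractor T" "{x'..<x' + e} \<subseteq> attractor T"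
    and eq: "itm_map T x = itm_map T x'"
  shows "x = x'"
proof (rule ccontr)
  assume "x \<noteq> x'"
  have v: "sp_in (x, Plus) (0, 1)" "sp_in (x', Plus) (0, 1)"
    using e sub attractor_subset by force+
  define s s' where "s = sidx (x, Plus)" and "s' = sidx (x', Plus)"
  obtain d where d: "d > 0" "{x..<x + d} \<subseteq> ivl (cell T s)"
    using sidx[OF v(1)] sp_in_iff_germ by (auto simp: s_def)
  obtain d' where d': "d' > 0" "{x'..<x' + d'} \<subseteq> ivl (cell T s')"
    using sidx[OF v(2)] sp_in_iff_germ by (auto simp: s'_def)
  \<comment> \<open>Short enough for both intervals to lie in one cell each and to be disjoint.\<close>
  define \<delta> where "\<delta> = Min {d, d', e, \<bar>x - x'\<bar>}"
  have \<delta>: "\<delta> > 0" "\<delta> \<le> d" "\<delta> \<le> d'" "\<delta> \<le> e" "\<delta> \<le> \<bar>x - x'\<bar>"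
    using d d' e \<open>x \<noteq> x'\<close> by (auto simp: \<delta>_def)
  let ?U = "{x..<x + \<delta>}" and ?V = "{x'..<x' + \<delta>}"
  have UX: "?U \<subseteq> attractor T" "?V \<subseteq> attractor T" using sub \<delta> by force+
  have disj: "?U \<inter> ?V = {}" using \<delta> by auto
  have TU: "itm_map T y = y + gam T s" if "y \<in> ?U" for y
    using that d \<delta> sidx(1)[OF v(1)] by (intro itm_map_cell) (auto simp: s_def)
  have TV: "itm_map T y = y + gam T s'" if "y \<in> ?V" for y
    using that d' \<delta> sidx(1)[OF v(2)] by (intro itm_map_cell) (auto simp: s'_def)
  have g: "x + gam T s = x' + gam T s'" using TU[of x] TV[of x'] eq \<delta> by simp
  have same: "itm_map T ` ?U \<subseteq> itm_map T ` ?V"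
  proof
    fix y assume "y \<in> itm_map T ` ?U"
    then obtain z where "z \<in> ?U" "y = itm_map T z" by blast
    then have z: "z \<in> ?U" "y = z + gam T s" using TU by auto
    then have "z - x + x' \<in> ?V" by auto
    moreover from this have "itm_map T (z - x + x') = y" using TV z g by (simp add: algebra_simps)
    ultimately show "y \<in> itm_map T ` ?V" by blast
  qed
  have dec: "measure lebesgue (Xn T (Suc n)) \<le> measure lebesgue (Xn T n) - \<delta>" for n
  proof -
    have XU: "?U \<subseteq> Xn T n" "?V \<subseteq> Xn T n" using UX by (auto simp: attractor_def)
    have "Xn T (Suc n) = itm_map T ` (Xn T n - ?U)"
      unfolding Xn_Suc using same XU disj by blast
    moreover have "Xn T n - ?U \<subseteq> {0..<1}" using iter_in by (auto simp: Xn_def)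
    moreover have "Xn T n - ?U \<in> lmeasurable" using Xn_measurable atLeastLessThan_lmeasurable
      by (intro fmeasurable.Diff) auto
    ultimately have "measure lebesgue (Xn T (Suc n)) \<le> measure lebesgue (Xn T n - ?U)"
      using image_measure by simp
    also have "\<dots> = measure lebesgue (Xn T n) - measure lebesgue ?U"
      using XU Xn_measurable atLeastLessThan_lmeasurable
      by (intro measurable_measure_Diff) auto
    finally show ?thesis using \<delta> by simp
  qed
  have "measure lebesgue (Xn T n) \<le> 1 - n * \<delta>" for n :: nat
  proof (induction n)
    case (Suc n)
    then show ?case using dec[of n] by (simp add: algebra_simps)
  qed (simp add: Xn_0)
  moreover obtain n :: nat where "1 < n * \<delta>" using reals_Archimedean3[OF \<delta>(1)] by blast
  ultimately show False by (metis diff_gt_0_iff_gt le_diff_iff' less_le_not_le linorder_not_less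
      measure_nonneg order_trans diff_less_eq add_0)
qed

end

section \<open>Balanced charges and their tails\<close>

text \<open>The visit \<open>p\<close> puts the charge \<open>wt p\<close> on the signed point \<open>loc
  p\<close>; several visits may be at the same point. Balance of the cells is what the
  coordinates \<open>e\<close> of a linear relation express.\<close>

locale charge = translation_map T r for T r +
  fixes P :: "'p set" and loc :: "'p \<Rightarrow> spoint" and wt :: "'p \<Rightarrow> real"
  assumes finite_P: "finite P"
    and valid_loc: "p \<in> P \<Longrightarrow> sp_in (loc p) (0, 1)"
    and cell_balance: "s \<in> {1..r} \<Longrightarrow> (\<Sum>p\<in>P. of_bool (sp_in (loc p) (cell T s)) * wt p) = 0"
begin

definition tail :: "real \<Rightarrow> real" where
  "tail y = (\<Sum>p\<in>P. of_bool (y < fst (loc p)) * wt p)"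

definition mass :: "spoint \<Rightarrow> real" where
  "mass z = (\<Sum>p\<in>P. of_bool (loc p = z) * wt p)"

lemma sidx_balance:
  assumes "s \<in> {1..r}"
  shows "(\<Sum>p\<in>P. of_bool (sidx (loc p) = s) * wt p) = 0"
proof -
  have "(\<Sum>p\<in>P. of_bool (sidx (loc p) = s) * wt p)
      = (\<Sum>p\<in>P. of_bool (sp_in (loc p) (cell T s)) * wt p)"
  proof (rule sum.cong[OF refl])
    fix p assume "p \<in> P"
    then have "sidx (loc p) = s \<longleftrightarrow> sp_in (loc p) (cell T s)"
      using sidx[OF valid_loc[of p]] sidx_eq[OF assms] by metis
    then show "of_bool (sidx (loc p) = s) * wt p = of_bool (sp_in (loc p) (cell T s)) * wt p"
      by simp
  qed
  then show ?thesis using cell_balance[OF assms] by simp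
qed

text \<open>Beyond the gap between the two sides of a discontinuity there are only full cells.\<close>

lemma above_balance:
  "(\<Sum>p\<in>P. of_bool (s < sidx (loc p)) * wt p) = 0"
proof -
  have "(\<Sum>p\<in>P. of_bool (s < sidx (loc p)) * wt p)
      = (\<Sum>p\<in>P. \<Sum>s'\<in>{s<..r}. of_bool (sidx (loc p) = s') * wt p)"
  proof (rule sum.cong[OF refl])
    fix p assume "p \<in> P"
    then have "sidx (loc p) \<in> {1..r}" using sidx valid_loc by blast
    have "(\<Sum>s'\<in>{s<..r}. of_bool (sidx (loc p) = s') * wt p)
        = (\<Sum>s'\<in>{s<..r}. if sidx (loc p) = s' then wt p else 0)"
      by (intro sum.cong) auto
    then show "of_bool (s < sidx (loc p)) * wt p
        = (\<Sum>s'\<in>{s<..r}. of_bool (sidx (loc p) = s') * wt p)"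
      using \<open>sidx (loc p) \<in> {1..r}\<close> by simp
  qed
  also have "\<dots> = (\<Sum>s'\<in>{s<..r}. \<Sum>p\<in>P. of_bool (sidx (loc p) = s') * wt p)"
    by (rule sum.swap)
  also have "\<dots> = 0" by (intro sum.neutral ballI sidx_balance) auto
  finally show ?thesis .
qed

lemma loc_bounds:
  assumes "p \<in> P"
  shows "bet T (sidx (loc p) - 1) \<le> fst (loc p)" "fst (loc p) \<le> bet T (sidx (loc p))"
    "sidx (loc p) \<in> {1..r}"
  using sidx[OF valid_loc[OF assms]]
  by (cases "loc p" rule: spoint_cases; auto simp: cell_def)+

text \<open>The cells to the right of the cell of \<open>y\<close> contribute zero.\<close>

lemma tail_in_cell:
  assumes s: "s \<in> {1..r}" and y: "y \<in> ivl (cell T s)"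
  shows "tail y = (\<Sum>p\<in>P. of_bool (sidx (loc p) = s \<and> y < fst (loc p)) * wt p)"
proof -
  have *: "of_bool (y < fst (loc p)) * wt p = of_bool (sidx (loc p) = s \<and> y < fst (loc p)) * wt p
      + of_bool (s < sidx (loc p)) * wt p" if p: "p \<in> P" for p
  proof (cases "sidx (loc p)" s rule: linorder_cases)
    case less
    then have "bet T (sidx (loc p)) \<le> bet T (s - 1)" using s by (intro bet_le) auto
    then have "\<not> y < fst (loc p)" using loc_bounds[OF p] y by (auto simp: ivl_def cell_def)
    with less show ?thesis by simp
  next
    case greater
    then have "bet T s \<le> bet T (sidx (loc p) - 1)" using loc_bounds[OF p] by (intro bet_le) auto
    then have "y < fst (loc p)" using loc_bounds[OF p] y by (auto simp: ivl_def cell_def)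
    with greater show ?thesis by simp
  qed simp
  show ?thesis
    unfolding tail_def using * above_balance[of s] by (simp add: sum.distrib cong: sum.cong)
qed

text \<open>The left-hand side is the transfer operator applied to the tail. Each branch sees only the
  charge of its own cell and carries it along. At a point outside the image of the cell all of
  this charge or none of it lies to the right, which gives zero in both cases.\<close>

lemma transfer:
  "(\<Sum>s=1..r. of_bool (y - gam T s \<in> ivl (cell T s)) * tail (y - gam T s))
    = (\<Sum>p\<in>P. of_bool (y < fst (sstep (loc p))) * wt p)"
proof -
  have "of_bool (y - gam T s \<in> ivl (cell T s)) * tail (y - gam T s)
      = (\<Sum>p\<in>P. of_bool (sidx (loc p) = s \<and> y - gam T s < fst (loc p)) * wt p)"
    if s: "s \<in> {1..r}" for s
  proof -
    consider "y - gam T s \<in> ivl (cell T s)" | "y - gam T s < bet T (s - 1)" | "bet T s \<le> y - gam T s"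
      by (fastforce simp: ivl_def cell_def)
    then show ?thesis
    proof cases
      case 1
      then show ?thesis using tail_in_cell[OF s] by simp
    next
      case 2
      have "(\<Sum>p\<in>P. of_bool (sidx (loc p) = s \<and> y - gam T s < fst (loc p)) * wt p)
          = (\<Sum>p\<in>P. of_bool (sidx (loc p) = s) * wt p)"
        using 2 loc_bounds by (intro sum.cong) fastforce+
      then show ?thesis using 2 sidx_balance[OF s] by (simp add: ivl_def cell_def)
    next
      case 3
      have "(\<Sum>p\<in>P. of_bool (sidx (loc p) = s \<and> y - gam T s < fst (loc p)) * wt p) = 0"
        using 3 loc_bounds by (intro sum.neutral) fastforce+
      then show ?thesis using 3 by (simp add: ivl_def cell_def)
    qed
  qed
  then have "(\<Sum>s=1..r. of_bool (y - gam T s \<in> ivl (cell T s)) * tail (y - gam T s))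
      = (\<Sum>s=1..r. \<Sum>p\<in>P. of_bool (sidx (loc p) = s \<and> y - gam T s < fst (loc p)) * wt p)"
    by simp
  also have "\<dots> = (\<Sum>p\<in>P. \<Sum>s=1..r. of_bool (sidx (loc p) = s \<and> y - gam T s < fst (loc p)) * wt p)"
    by (rule sum.swap)
  also have "\<dots> = (\<Sum>p\<in>P. of_bool (y < fst (sstep (loc p))) * wt p)"
  proof (rule sum.cong[OF refl])
    fix p assume p: "p \<in> P"
    have "(\<Sum>s=1..r. of_bool (sidx (loc p) = s \<and> y - gam T s < fst (loc p)) * wt p)
        = (\<Sum>s=1..r. if sidx (loc p) = s then of_bool (y < fst (sstep (loc p))) * wt p else 0)"
      by (intro sum.cong) (auto simp: sstep_def)
    then show "(\<Sum>s=1..r. of_bool (sidx (loc p) = s \<and> y - gam T s < fst (loc p)) * wt p)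
        = of_bool (y < fst (sstep (loc p))) * wt p"
      using loc_bounds(3)[OF p] by simp
  qed
  finally show ?thesis .
qed

lemma tail_outside: assumes "y \<notin> {0..<1}" shows "tail y = 0"
proof (cases "y < 0")
  case True
  have "tail y = (\<Sum>p\<in>P. of_bool (0 < sidx (loc p)) * wt p)"
    unfolding tail_def
  proof (rule sum.cong[OF refl])
    fix p assume "p \<in> P"
    then have "y < fst (loc p)" "0 < sidx (loc p)"
      using loc_bounds[of p] cell_bounds(1)[of "sidx (loc p)"] True by force+
    then show "of_bool (y < fst (loc p)) * wt p = of_bool (0 < sidx (loc p)) * wt p" by simp
  qed
  then show ?thesis using above_balance by simp
next
  case False
  have "\<not> y < fst (loc p)" if "p \<in> P" for p
    using loc_bounds[OF that] cell_bounds(2)[of "sidx (loc p)"] False assms by force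
  then show ?thesis unfolding tail_def by (intro sum.neutral) auto
qed

lemma tail_right: "\<exists>e>0. \<forall>x\<in>{y..<y + e}. tail x = tail y"
proof -
  obtain d where d: "d > 0" "\<And>a. a \<in> (fst \<circ> loc) ` P \<Longrightarrow> a \<noteq> y \<Longrightarrow> d \<le> dist y a"
    using finite_set_avoid[of "(fst \<circ> loc) ` P" y] finite_P by auto
  have "tail x = tail y" if "x \<in> {y..<y + d}" for x
  proof -
    have "x < fst (loc p) \<longleftrightarrow> y < fst (loc p)" if "p \<in> P" for p
      using d(2)[of "fst (loc p)"] \<open>x \<in> _\<close> that by (auto simp: dist_real_def)
    then show ?thesis unfolding tail_def by (intro sum.cong) auto
  qed
  then show ?thesis using d(1) by blast
qed

lemma tail_left: "\<exists>e>0. \<forall>x\<in>{y - e..<y}. tail x = (\<Sum>p\<in>P. of_bool (y \<le> fst (loc p)) * wt p)"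
proof -
  obtain d where d: "d > 0" "\<And>a. a \<in> (fst \<circ> loc) ` P \<Longrightarrow> a \<noteq> y \<Longrightarrow> d \<le> dist y a"
    using finite_set_avoid[of "(fst \<circ> loc) ` P" y] finite_P by auto
  have "tail x = (\<Sum>p\<in>P. of_bool (y \<le> fst (loc p)) * wt p)" if "x \<in> {y - d..<y}" for x
  proof -
    have "x < fst (loc p) \<longleftrightarrow> y \<le> fst (loc p)" if "p \<in> P" for p
      using d(2)[of "fst (loc p)"] \<open>x \<in> _\<close> that
      by (cases "fst (loc p) = y") (auto simp: dist_real_def)
    then show ?thesis unfolding tail_def by (intro sum.cong) auto
  qed
  then show ?thesis using d(1) by blast
qed

lemma mass_jump:
  "(\<Sum>p\<in>P. of_bool (y \<le> fst (loc p)) * wt p) = tail y + mass (y, Plus) + mass (y, Minus)"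
proof -
  have "of_bool (y \<le> fst z) * w = of_bool (y < fst z) * w + of_bool (z = (y, Plus)) * w
     + of_bool (z = (y, Minus)) * w" for z :: spoint and w :: real
    by (cases z rule: spoint_cases) auto
  then show ?thesis by (simp add: tail_def mass_def sum.distrib)
qed

text \<open>The tail is zero in the gap between the two sides of a discontinuity, so the charge on a side
  is the jump between zero and the tail on that side.\<close>

lemma mass_disc:
  assumes b: "b \<in> discs T"
  shows "mass (b, Plus) = - tail b"
    "mass (b, Minus) = (\<Sum>p\<in>P. of_bool (b \<le> fst (loc p)) * wt p)"
proof -
  define s where "s = disc_ind T b"
  have s: "s \<in> {1..r - 1}" "bet T s = b" using disc_ind[OF b] by (auto simp: s_def)
  have *: "s < sidx (loc p) \<longleftrightarrow> b < fst (loc p) \<or> loc p = (b, Plus)" if p: "p \<in> P" for p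
  proof (cases "s < sidx (loc p)")
    case True
    then have "b \<le> bet T (sidx (loc p) - 1)" using s loc_bounds[OF p] bet_le[of s] by auto
    then show ?thesis using True sidx(2)[OF valid_loc[OF p]]
      by (cases "loc p" rule: spoint_cases) (auto simp: cell_def)
  next
    case False
    then have "bet T (sidx (loc p)) \<le> b" using s bet_le[of "sidx (loc p)" s] by auto
    then show ?thesis using False sidx(2)[OF valid_loc[OF p]]
      by (cases "loc p" rule: spoint_cases) (auto simp: cell_def)
  qed
  have "(\<Sum>p\<in>P. of_bool (b < fst (loc p)) * wt p) + (\<Sum>p\<in>P. of_bool (loc p = (b, Plus)) * wt p)
      = (\<Sum>p\<in>P. of_bool (s < sidx (loc p)) * wt p)"
    unfolding sum.distrib[symmetric] using * by (intro sum.cong) auto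
  then show "mass (b, Plus) = - tail b"
    using above_balance[of s] by (simp add: tail_def mass_def)
  then show "mass (b, Minus) = (\<Sum>p\<in>P. of_bool (b \<le> fst (loc p)) * wt p)"
    using mass_jump[of b] by simp
qed

end

locale invariant_charge = charge +
  fixes A :: "real set"
  assumes A_attractor: "A \<subseteq> attractor T"
    and invariant: "y \<notin> A \<Longrightarrow> (\<Sum>p\<in>P. of_bool (y < fst (sstep (loc p))) * wt p) = tail y"
begin

text \<open>By invariance a point outside \<open>A\<close> where the tail does not vanish has a preimage
  where it does not vanish either; repeating this shows that the point is in every \<open>Xn T
  n\<close>.\<close>

lemma tail_support: assumes "tail y \<noteq> 0" shows "y \<in> attractor T"
proof -
  have "tail y \<noteq> 0 \<Longrightarrow> y \<in> Xn T n" for n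
  proof (induction n arbitrary: y)
    case 0
    then show ?case using tail_outside[of y] by (auto simp: Xn_0)
  next
    case (Suc n)
    show ?case
    proof (cases "y \<in> A")
      case True
      then show ?thesis using A_attractor by (auto simp: attractor_def)
    next
      case False
      have "(\<Sum>s=1..r. of_bool (y - gam T s \<in> ivl (cell T s)) * tail (y - gam T s)) \<noteq> 0"
        using transfer[of y] invariant[OF False] Suc.prems by simp
      then obtain s where s: "s \<in> {1..r}"
          "of_bool (y - gam T s \<in> ivl (cell T s)) * tail (y - gam T s) \<noteq> 0"
        by (rule sum.not_neutral_contains_not_neutral)
      then have m: "y - gam T s \<in> ivl (cell T s)" "tail (y - gam T s) \<noteq> 0" by auto
      then have "itm_map T (y - gam T s) = y" using itm_map_cell[OF s(1)] by simp
      then show ?thesis using Suc.IH[OF m(2)] unfolding Xn_Suc by (metis image_eqI)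
    qed
  qed
  then show ?thesis using assms by (auto simp: attractor_def)
qed

lemma tail_right_attractor: assumes "tail y \<noteq> 0" shows "\<exists>e>0. {y..<y + e} \<subseteq> attractor T"
  using tail_right[of y] tail_support assms by (metis subsetI)

lemma tail_left_attractor:
  assumes "(\<Sum>p\<in>P. of_bool (y \<le> fst (loc p)) * wt p) \<noteq> 0"
  shows "\<exists>e>0. {y - e..<y} \<subseteq> attractor T"
  using tail_left[of y] tail_support assms by (metis subsetI)

lemma mass_off_attractor:
  assumes "z \<in> sdiscs T" "\<not> sp_in_attractor T z"
  shows "mass z = 0"
proof (rule ccontr)
  assume *: "mass z \<noteq> 0"
  have "\<exists>e>0. germ z e \<subseteq> attractor T"
  proof (cases z rule: spoint_cases)
    case (Plus x)
    then show ?thesis using mass_disc(1)[of x] tail_right_attractor[of x] * assms(1)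
      by (auto simp: sdiscs_def)
  next
    case (Minus x)
    then show ?thesis using mass_disc(2)[of x] tail_left_attractor[of x] * assms(1)
      by (auto simp: sdiscs_def)
  qed
  then show False using assms(2) sp_in_attractorI by blast
qed

text \<open>Another preimage of the image of \<open>x\<close> with nonzero tail would have its right germ
  in the attractor, as \<open>x\<close> has, which contradicts injectivity. So the transfer sum
  reduces to its term at \<open>x\<close>.\<close>

lemma tail_step:
  assumes e: "e > 0" "{x..<x + e} \<subseteq> attractor T" and nA: "itm_map T x \<notin> A"
  shows "tail (itm_map T x) = tail x"
proof -
  let ?y = "itm_map T x"
  have v: "sp_in (x, Plus) (0, 1)" using e attractor_subset by force
  define s0 where "s0 = sidx (x, Plus)"
  have s0: "s0 \<in> {1..r}" "x \<in> ivl (cell T s0)" using sidx[OF v] by (auto simp: s0_def ivl_iff_sp_in)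
  have y: "?y = x + gam T s0" by (rule itm_map_cell[OF s0])
  have "of_bool (?y - gam T s \<in> ivl (cell T s)) * tail (?y - gam T s) = (if s = s0 then tail x else 0)"
    if s: "s \<in> {1..r}" for s
  proof (cases "s = s0")
    case True
    then show ?thesis using y s0 by simp
  next
    case False
    have "\<not> (?y - gam T s \<in> ivl (cell T s) \<and> tail (?y - gam T s) \<noteq> 0)"
    proof
      assume *: "?y - gam T s \<in> ivl (cell T s) \<and> tail (?y - gam T s) \<noteq> 0"
      then obtain d where d: "d > 0" "{?y - gam T s..<?y - gam T s + d} \<subseteq> attractor T"
        using tail_right_attractor by blast
      have "itm_map T (?y - gam T s) = ?y" using itm_map_cell[OF s] * by simp
      moreover have "{x..<x + min d e} \<subseteq> attractor T"
        "{?y - gam T s..<?y - gam T s + min d e} \<subseteq> attractor T" using d e by force+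
      ultimately have "x = ?y - gam T s"
        using attractor_injective[of "min d e" x "?y - gam T s"] d(1) e(1) by simp
      then have "x \<in> ivl (cell T s)" using * by simp
      then show False using cell_unique[OF s s0(1), of "(x, Plus)"] s0(2) False
        by (simp add: ivl_iff_sp_in)
    qed
    with False show ?thesis by auto
  qed
  then have "(\<Sum>s=1..r. of_bool (?y - gam T s \<in> ivl (cell T s)) * tail (?y - gam T s)) = tail x"
    using s0(1) by simp
  then show ?thesis using transfer[of ?y] invariant[OF nA] by simp
qed

end

section \<open>Charges on towers\<close>

lemma sum_by_parts:
  fixes w g :: "nat \<Rightarrow> real"
  shows "(\<Sum>t<n. w (Suc t) * (g (Suc t) - g t))
    = w n * g n - w 0 * g 0 - (\<Sum>t<n. (w (Suc t) - w t) * g t)"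
  by (induction n) (simp_all add: algebra_simps)

fun corner :: "interval \<Rightarrow> side \<Rightarrow> spoint" where
  "corner J Plus = (fst J, Plus)"
| "corner J Minus = (snd J, Minus)"

definition landing_time :: "itm \<Rightarrow> spoint \<Rightarrow> nat" where
  "landing_time T b = (LEAST q. 1 \<le> q \<and> siter T q b \<in> sdiscs T)"

definition rigid :: "itm \<Rightarrow> interval \<Rightarrow> nat \<Rightarrow> bool" where
  "rigid T K t \<longleftrightarrow> (\<forall>x\<in>ivl K. (itm_map T ^^ t) x = x - fst K + (itm_map T ^^ t) (fst K))"

lemma rigidD:
  "rigid T K t \<Longrightarrow> x \<in> ivl K \<Longrightarrow> (itm_map T ^^ t) x = x - fst K + (itm_map T ^^ t) (fst K)"
  unfolding rigid_def by blast

context translation_map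
begin

lemma siter_corner:
  assumes "fst K < snd K" "rigid T K t"
  shows "siter T t (corner K Plus) = ((itm_map T ^^ t) (fst K), Plus)"
    "siter T t (corner K Minus) = (snd K - fst K + (itm_map T ^^ t) (fst K), Minus)"
proof -
  have pos: "snd K - fst K > 0" using assms(1) by simp
  have "siter T t (fst K, Plus) = ((itm_map T ^^ t) (fst K), Plus)"
  proof (rule siter_eqI[OF pos])
    fix y assume "y \<in> germ (fst K, Plus) (snd K - fst K)"
    then show "(itm_map T ^^ t) y = y - fst K + (itm_map T ^^ t) (fst K)"
      by (intro rigidD[OF assms(2)]) (simp add: ivl_def)
  qed
  then show "siter T t (corner K Plus) = ((itm_map T ^^ t) (fst K), Plus)" by simp
  have "siter T t (snd K, Minus) = (snd K - fst K + (itm_map T ^^ t) (fst K), Minus)"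
  proof (rule siter_eqI[OF pos])
    fix y assume "y \<in> germ (snd K, Minus) (snd K - fst K)"
    then have "y \<in> ivl K" by (simp add: ivl_def)
    then show "(itm_map T ^^ t) y = y - snd K + (snd K - fst K + (itm_map T ^^ t) (fst K))"
      using rigidD[OF assms(2), of y] by linarith
  qed
  then show "siter T t (corner K Minus) = (snd K - fst K + (itm_map T ^^ t) (fst K), Minus)" by simp
qed

lemma rigid_image:
  assumes "rigid T K t"
  shows "(itm_map T ^^ t) ` ivl K
    = {(itm_map T ^^ t) (fst K)..<snd K - fst K + (itm_map T ^^ t) (fst K)}" (is "?L = ?R")
proof
  show "?L \<subseteq> ?R"
  proof
    fix y assume "y \<in> ?L"
    then obtain x where "x \<in> ivl K" "y = x - fst K + (itm_map T ^^ t) (fst K)"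
      using rigidD[OF assms] by blast
    then show "y \<in> ?R" by (simp add: ivl_def)
  qed
  show "?R \<subseteq> ?L"
  proof
    fix y assume "y \<in> ?R"
    then have *: "y - (itm_map T ^^ t) (fst K) + fst K \<in> ivl K" by (auto simp: ivl_def)
    then have "(itm_map T ^^ t) (y - (itm_map T ^^ t) (fst K) + fst K) = y"
      using rigidD[OF assms *] by linarith
    then show "y \<in> ?L" using * by (metis image_eqI)
  qed
qed

lemma germ_corner:
  assumes "fst K < snd K" "rigid T K t"
  shows "germ (siter T t (corner K \<sigma>)) (snd K - fst K) = (itm_map T ^^ t) ` ivl K"
  using siter_corner[OF assms] by (cases \<sigma>) (simp_all add: rigid_image[OF assms(2)] algebra_simps)

lemma landing_time: assumes "b \<in> sdiscs_notX T"
  shows "1 \<le> landing_time T b" "siter T (landing_time T b) b \<in> sdiscs T"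
    "t < landing_time T b \<Longrightarrow> 0 < t \<Longrightarrow> siter T t b \<notin> sdiscs T"
proof -
  have "\<exists>q. 1 \<le> q \<and> siter T q b \<in> sdiscs T" using assms by (auto simp: sdiscs_notX_def)
  then have "1 \<le> landing_time T b \<and> siter T (landing_time T b) b \<in> sdiscs T"
    unfolding landing_time_def by (rule LeastI_ex)
  then show "1 \<le> landing_time T b" "siter T (landing_time T b) b \<in> sdiscs T" by auto
  assume "t < landing_time T b" "0 < t"
  then show "siter T t b \<notin> sdiscs T"
    using not_less_Least[of t "\<lambda>q. 1 \<le> q \<and> siter T q b \<in> sdiscs T"]
    unfolding landing_time_def by auto
qed

lemma sdiscs_notX_valid: "b \<in> sdiscs_notX T \<Longrightarrow> sp_in b (0, 1)"
  by (auto simp: sdiscs_notX_def intro: sdisc_valid)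

lemma finite_sdiscs_notX: "finite (sdiscs_notX T)"
  using finite_sdiscs by (rule rev_finite_subset) (auto simp: sdiscs_notX_def)

end

text \<open>A tower consists of the images of its base under the first \<open>height\<close> iterates, and
  the charge follows the two corners of the base. The charge of the visit at time
  \<open>t\<close> is \<open>W q \<sigma> (Suc t)\<close>. The value \<open>W q \<sigma>
  t\<close> belongs to the orbit piece on which the corner arrives at time \<open>t\<close>, so
  that \<open>W q \<sigma> (Suc t) - W q \<sigma> t\<close> is the coefficient of
  \<open>f\<close> at the discontinuity visited at time \<open>t\<close>. The function
  \<open>\<xi>\<close> gives the charges on the orbits of signed discontinuities outside the
  attractor.\<close>

locale weighted_towers = translation_map T r for T r +
  fixes Q :: "'q set" and base :: "'q \<Rightarrow> interval" and height :: "'q \<Rightarrow> nat"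
    and W :: "'q \<Rightarrow> side \<Rightarrow> nat \<Rightarrow> real" and J :: interval and \<xi> :: "spoint \<Rightarrow> real"
  assumes finite_Q: "finite Q"
    and base_nonempty: "q \<in> Q \<Longrightarrow> fst (base q) < snd (base q)"
    and base_attractor: "q \<in> Q \<Longrightarrow> ivl (base q) \<subseteq> attractor T"
    and height_pos: "q \<in> Q \<Longrightarrow> 0 < height q"
    and rigid: "q \<in> Q \<Longrightarrow> t \<le> height q \<Longrightarrow> rigid T (base q) t"
    and floors_disjoint: "q \<in> Q \<Longrightarrow> q' \<in> Q \<Longrightarrow> t < height q \<Longrightarrow> t' < height q' \<Longrightarrow>
      x \<in> ivl (base q) \<Longrightarrow> x' \<in> ivl (base q') \<Longrightarrow>
      (itm_map T ^^ t) x = (itm_map T ^^ t') x' \<Longrightarrow> q = q' \<and> t = t'"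
    and J_attractor: "ivl J \<subseteq> attractor T"
    and upper_floors: "q \<in> Q \<Longrightarrow> 0 < t \<Longrightarrow> t < height q \<Longrightarrow> x \<in> ivl (base q) \<Longrightarrow>
      (itm_map T ^^ t) x \<notin> ivl J"
    and closing: "q \<in> Q \<Longrightarrow>
      (\<forall>\<sigma>. siter T (height q) (corner (base q) \<sigma>) = corner (base q) \<sigma>
          \<and> W q \<sigma> (height q) = W q \<sigma> 0)
      \<or> (ivl (base q) \<subseteq> ivl J \<and> (itm_map T ^^ height q) ` ivl (base q) \<subseteq> ivl J)"
    and W_constant: "q \<in> Q \<Longrightarrow> t < height q \<Longrightarrow> siter T t (corner (base q) \<sigma>) \<notin> sdiscs T \<Longrightarrow>
      W q \<sigma> (Suc t) = W q \<sigma> t"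
    and e_balance: "s \<in> {1..r} \<Longrightarrow>
      (\<Sum>q\<in>Q. \<Sum>\<sigma>\<in>{Plus, Minus}. \<Sum>t<height q.
          W q \<sigma> (Suc t) * of_bool (sp_in (siter T t (corner (base q) \<sigma>)) (cell T s)))
      + (\<Sum>b\<in>sdiscs_notX T. \<Sum>t<landing_time T b.
          \<xi> b * of_bool (sp_in (siter T t b) (cell T s))) = 0"
    and f_balance: "\<And>\<psi> :: real \<Rightarrow> real.
      (\<Sum>q\<in>Q. \<Sum>\<sigma>\<in>{Plus, Minus}. \<Sum>t<height q.
          (W q \<sigma> (Suc t) - W q \<sigma> t) * \<psi> (fst (siter T t (corner (base q) \<sigma>))))
      + (\<Sum>b\<in>sdiscs_notX T. \<xi> b * (\<psi> (fst b) - \<psi> (fst (siter T (landing_time T b) b)))) = 0"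
begin

text \<open>Visits are indexed by trajectory and time rather than by the point, since different
  trajectories may meet the same point.\<close>

definition visits :: "(('q \<times> side + spoint) \<times> nat) set" where
  "visits = (SIGMA u:(Q \<times> {Plus, Minus}) <+> sdiscs_notX T.
     {..<(case u of Inl (q, \<sigma>) \<Rightarrow> height q | Inr b \<Rightarrow> landing_time T b)})"

definition place :: "('q \<times> side + spoint) \<times> nat \<Rightarrow> spoint" where
  "place = (\<lambda>(u, t). siter T t (case u of Inl (q, \<sigma>) \<Rightarrow> corner (base q) \<sigma> | Inr b \<Rightarrow> b))"

definition weight :: "('q \<times> side + spoint) \<times> nat \<Rightarrow> real" where
  "weight = (\<lambda>(u, t). case u of Inl (q, \<sigma>) \<Rightarrow> W q \<sigma> (Suc t) | Inr b \<Rightarrow> \<xi> b)"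

lemma finite_visits: "finite visits"
  using finite_Q finite_sdiscs_notX by (auto simp: visits_def)

lemma sum_visits:
  "(\<Sum>p\<in>visits. g (place p) * weight p)
    = (\<Sum>q\<in>Q. \<Sum>\<sigma>\<in>{Plus, Minus}. \<Sum>t<height q. W q \<sigma> (Suc t) * g (siter T t (corner (base q) \<sigma>)))
    + (\<Sum>b\<in>sdiscs_notX T. \<Sum>t<landing_time T b. \<xi> b * g (siter T t b))"
proof -
  have "(\<Sum>p\<in>visits. g (place p) * weight p)
    = (\<Sum>u\<in>(Q \<times> {Plus, Minus}) <+> sdiscs_notX T.
        \<Sum>t<(case u of Inl (q, \<sigma>) \<Rightarrow> height q | Inr b \<Rightarrow> landing_time T b).
          g (place (u, t)) * weight (u, t))"
    unfolding visits_def using finite_Q finite_sdiscs_notX by (subst sum.Sigma) auto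
  also have "\<dots> = (\<Sum>u\<in>Q \<times> {Plus, Minus}. \<Sum>t<height (fst u).
          W (fst u) (snd u) (Suc t) * g (siter T t (corner (base (fst u)) (snd u))))
     + (\<Sum>b\<in>sdiscs_notX T. \<Sum>t<landing_time T b. \<xi> b * g (siter T t b))"
    using finite_Q finite_sdiscs_notX
    by (subst sum.Plus) (auto simp: place_def weight_def mult.commute intro!: sum.cong)
  also have "(\<Sum>u\<in>Q \<times> {Plus, Minus}. \<Sum>t<height (fst u).
          W (fst u) (snd u) (Suc t) * g (siter T t (corner (base (fst u)) (snd u))))
    = (\<Sum>q\<in>Q. \<Sum>\<sigma>\<in>{Plus, Minus}. \<Sum>t<height q. W q \<sigma> (Suc t) * g (siter T t (corner (base q) \<sigma>)))"
    by (subst sum.cartesian_product) (simp add: case_prod_beta)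
  finally show ?thesis .
qed

lemma corner_valid: assumes "q \<in> Q" shows "sp_in (corner (base q) \<sigma>) (0, 1)"
proof -
  have "ivl (base q) \<subseteq> {0..<1}" using base_attractor[OF assms] attractor_subset by blast
  then have "0 \<le> fst (base q)" "snd (base q) \<le> 1"
    using base_nonempty[OF assms] by (auto simp: ivl_def)
  then show ?thesis using base_nonempty[OF assms] by (cases \<sigma>) auto
qed

lemma place_valid: assumes "p \<in> visits" shows "sp_in (place p) (0, 1)"
  using assms corner_valid sdiscs_notX_valid
  by (auto simp: visits_def place_def simp del: corner.simps intro!: siter_valid)

lemma floor_attractor: "q \<in> Q \<Longrightarrow> (itm_map T ^^ t) ` ivl (base q) \<subseteq> attractor T"
  using base_attractor iter_attractor by blast

sublocale charge T r visits place weight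
proof
  show "finite visits" by (rule finite_visits)
  show "p \<in> visits \<Longrightarrow> sp_in (place p) (0, 1)" for p by (rule place_valid)
  show "s \<in> {1..r} \<Longrightarrow> (\<Sum>p\<in>visits. of_bool (sp_in (place p) (cell T s)) * weight p) = 0" for s
    unfolding sum_visits[of "\<lambda>z. of_bool (sp_in z (cell T s))"] by (rule e_balance)
qed

text \<open>Summation by parts along every trajectory: the inner differences are the balance of the
  coordinates \<open>f\<close>, so only the two ends of every tower are left.\<close>

lemma boundary_flux:
  "(\<Sum>p\<in>visits. (\<psi> (fst (sstep (place p))) - \<psi> (fst (place p))) * weight p)
    = (\<Sum>q\<in>Q. \<Sum>\<sigma>\<in>{Plus, Minus}. W q \<sigma> (height q) * \<psi> (fst (siter T (height q) (corner (base q) \<sigma>)))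
        - W q \<sigma> 0 * \<psi> (fst (corner (base q) \<sigma>)))"
proof -
  let ?g = "\<lambda>q \<sigma> t. \<psi> (fst (siter T t (corner (base q) \<sigma>)))"
  have 1: "(\<Sum>t<height q. W q \<sigma> (Suc t) *
        (\<psi> (fst (sstep (siter T t (corner (base q) \<sigma>)))) - ?g q \<sigma> t))
     = W q \<sigma> (height q) * ?g q \<sigma> (height q) - W q \<sigma> 0 * \<psi> (fst (corner (base q) \<sigma>))
       - (\<Sum>t<height q. (W q \<sigma> (Suc t) - W q \<sigma> t) * ?g q \<sigma> t)" if q: "q \<in> Q" for q \<sigma>
    using sum_by_parts[of "W q \<sigma>" "?g q \<sigma>" "height q"] corner_valid[OF q]
    by (simp add: siter_Suc siter_0)
  have 2: "(\<Sum>t<landing_time T b. \<xi> b * (\<psi> (fst (sstep (siter T t b))) - \<psi> (fst (siter T t b))))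
      = - (\<xi> b * (\<psi> (fst b) - \<psi> (fst (siter T (landing_time T b) b))))"
    if b: "b \<in> sdiscs_notX T" for b
  proof -
    have "(\<Sum>t<landing_time T b. \<xi> b * (\<psi> (fst (sstep (siter T t b))) - \<psi> (fst (siter T t b))))
        = \<xi> b * (\<Sum>t<landing_time T b. \<psi> (fst (siter T (Suc t) b)) - \<psi> (fst (siter T t b)))"
      using sdiscs_notX_valid[OF b] by (simp add: siter_Suc sum_distrib_left)
    also have "\<dots> = \<xi> b * (\<psi> (fst (siter T (landing_time T b) b)) - \<psi> (fst b))"
      using sum_lessThan_telescope[of "\<lambda>t. \<psi> (fst (siter T t b))" "landing_time T b"]
        sdiscs_notX_valid[OF b] by (simp only: siter_0)
    finally show ?thesis by (simp add: algebra_simps)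
  qed
  show ?thesis
    unfolding sum_visits[of "\<lambda>z. \<psi> (fst (sstep z)) - \<psi> (fst z)"]
    using 1 2 f_balance[of \<psi>]
    by (simp add: sum_subtractf sum.distrib sum_negf cong: sum.cong)
qed

lemma J_bounds:
  assumes "q \<in> Q" "t \<le> height q" "(itm_map T ^^ t) ` ivl (base q) \<subseteq> ivl J"
  shows "fst J \<le> fst (siter T t (corner (base q) \<sigma>))"
    "fst (siter T t (corner (base q) \<sigma>)) \<le> snd J"
proof -
  note K = base_nonempty[OF assms(1)] rigid[OF assms(1,2)]
  have "fst J \<le> (itm_map T ^^ t) (fst (base q))
      \<and> snd (base q) - fst (base q) + (itm_map T ^^ t) (fst (base q)) \<le> snd J"
    using assms(3) K(1) unfolding rigid_image[OF K(2)] unfolding ivl_def atLeastLessThan_subset_iff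
    by auto
  then show "fst J \<le> fst (siter T t (corner (base q) \<sigma>))"
    "fst (siter T t (corner (base q) \<sigma>)) \<le> snd J"
    using siter_corner[OF K] K(1) by (cases \<sigma>; simp)+
qed

text \<open>A closed tower has no flux through its ends. The other towers start and end in
  \<open>J\<close>. Seen from a point to the left of \<open>J\<close> all these ends count, and
  their fluxes add up to zero; seen from the right none does.\<close>

sublocale invariant_charge T r visits place weight "ivl J"
proof
  show "ivl J \<subseteq> attractor T" by (rule J_attractor)
  fix y assume y: "y \<notin> ivl J"
  have step: "W q \<sigma> (height q) * of_bool (y < fst (siter T (height q) (corner (base q) \<sigma>)))
        - W q \<sigma> 0 * of_bool (y < fst (corner (base q) \<sigma>))
      = (W q \<sigma> (height q) - W q \<sigma> 0) * of_bool (y < fst J)" if q: "q \<in> Q" for q \<sigma>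
    using closing[OF q]
  proof
    assume "\<forall>\<sigma>. siter T (height q) (corner (base q) \<sigma>) = corner (base q) \<sigma>
          \<and> W q \<sigma> (height q) = W q \<sigma> 0"
    then show ?thesis by simp
  next
    assume *: "ivl (base q) \<subseteq> ivl J \<and> (itm_map T ^^ height q) ` ivl (base q) \<subseteq> ivl J"
    have "fst J \<le> fst (siter T (height q) (corner (base q) \<sigma>))"
      "fst (siter T (height q) (corner (base q) \<sigma>)) \<le> snd J"
      "fst J \<le> fst (corner (base q) \<sigma>)" "fst (corner (base q) \<sigma>) \<le> snd J"
      using J_bounds[OF q, of "height q" \<sigma>] J_bounds[OF q, of 0 \<sigma>] * corner_valid[OF q]
      by (simp_all add: siter_0)
    moreover have "y < fst J \<or> snd J \<le> y" using y by (auto simp: ivl_def)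
    ultimately show ?thesis by (auto simp: algebra_simps)
  qed
  \<comment> \<open>The flux of a constant function.\<close>
  have total: "(\<Sum>q\<in>Q. \<Sum>\<sigma>\<in>{Plus, Minus}. W q \<sigma> (height q) - W q \<sigma> 0) = 0"
    using boundary_flux[of "\<lambda>_. 1"] by simp
  have "(\<Sum>p\<in>visits. (of_bool (y < fst (sstep (place p))) - of_bool (y < fst (place p))) * weight p)
      = (\<Sum>q\<in>Q. \<Sum>\<sigma>\<in>{Plus, Minus}. (W q \<sigma> (height q) - W q \<sigma> 0) * of_bool (y < fst J))"
    unfolding boundary_flux[of "\<lambda>x. of_bool (y < x)"] using step by (intro sum.cong) auto
  also have "\<dots> = (\<Sum>q\<in>Q. \<Sum>\<sigma>\<in>{Plus, Minus}. W q \<sigma> (height q) - W q \<sigma> 0) * of_bool (y < fst J)"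
    by (simp only: sum_distrib_right)
  also have "\<dots> = 0" unfolding total by simp
  finally show "(\<Sum>p\<in>visits. of_bool (y < fst (sstep (place p))) * weight p) = tail y"
    by (simp add: tail_def left_diff_distrib sum_subtractf)
qed

lemma corner_germ_attractor:
  assumes "q \<in> Q" "t \<le> height q"
  shows "\<exists>e>0. germ (siter T t (corner (base q) \<sigma>)) e \<subseteq> attractor T"
  using germ_corner[OF base_nonempty rigid] floor_attractor[of q t] base_nonempty[of q] assms
  by (intro exI[of _ "snd (base q) - fst (base q)"]) simp

text \<open>No trajectory of a corner meets \<open>b\<close>, because corners have germs in the attractor.
  The trajectory of another discontinuity stops as soon as it lands. So the charge on
  \<open>b\<close> is \<open>\<xi> b\<close>, and there is no charge on a discontinuity outside
  the attractor.\<close>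

lemma wandering_weight_zero:
  assumes b: "b \<in> sdiscs_notX T"
  shows "\<xi> b = 0"
proof -
  have nA: "\<not> sp_in_attractor T b" and d: "b \<in> sdiscs T" using b by (auto simp: sdiscs_notX_def)
  have "siter T t (corner (base q) \<sigma>) \<noteq> b" if "q \<in> Q" "t < height q" for q t \<sigma>
    using corner_germ_attractor[of q t \<sigma>] that sp_in_attractorI nA by fastforce
  then have 1: "(\<Sum>q\<in>Q. \<Sum>\<sigma>\<in>{Plus, Minus}. \<Sum>t<height q.
      W q \<sigma> (Suc t) * of_bool (siter T t (corner (base q) \<sigma>) = b)) = 0"
    by (intro sum.neutral ballI) auto
  have 2: "(\<Sum>t<landing_time T b'. \<xi> b' * of_bool (siter T t b' = b)) = (if b' = b then \<xi> b else 0)"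
    if b': "b' \<in> sdiscs_notX T" for b'
  proof -
    have "siter T t b' = b \<longleftrightarrow> t = 0 \<and> b' = b" if "t < landing_time T b'" for t
      using landing_time(3)[OF b' that] d siter_0[OF sdiscs_notX_valid[OF b']]
      by (cases "t = 0") auto
    then have "(\<Sum>t<landing_time T b'. \<xi> b' * of_bool (siter T t b' = b))
        = (\<Sum>t<landing_time T b'. if t = 0 then \<xi> b' * of_bool (b' = b) else 0)"
      by (intro sum.cong) auto
    also have "\<dots> = (if b' = b then \<xi> b else 0)" using landing_time(1)[OF b'] by simp
    finally show ?thesis .
  qed
  have "mass b = \<xi> b"
    unfolding mass_def sum_visits[of "\<lambda>z. of_bool (z = b)"] 1
    using 2 finite_sdiscs_notX b by simp
  then show ?thesis using mass_off_attractor[OF d nA] by simp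
qed

text \<open>With the charges outside the attractor gone, every charge is at an end of a floor, and its
  germ of the right length fills this floor.\<close>

lemma floor_visit:
  assumes p: "p \<in> visits" "weight p \<noteq> 0"
  obtains q \<sigma> t where "p = (Inl (q, \<sigma>), t)" "q \<in> Q" "t < height q"
    "place p = siter T t (corner (base q) \<sigma>)" "weight p = W q \<sigma> (Suc t)"
    "germ (place p) (snd (base q) - fst (base q)) = (itm_map T ^^ t) ` ivl (base q)"
proof -
  obtain u t where ut: "p = (u, t)" by (cases p)
  show ?thesis
  proof (cases u)
    case (Inl v)
    then obtain q \<sigma> where v: "v = (q, \<sigma>)" by (cases v)
    then have *: "q \<in> Q" "t < height q" using p(1) ut Inl by (auto simp: visits_def)
    show ?thesis
      using that[of q \<sigma> t] germ_corner[OF base_nonempty[OF *(1)] rigid[OF *(1)], of t \<sigma>] * ut Inl v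
      by (simp add: place_def weight_def)
  next
    case (Inr b)
    then have "weight p = 0"
      using p(1) ut wandering_weight_zero by (auto simp: visits_def weight_def)
    then show ?thesis using p(2) by simp
  qed
qed

text \<open>A charge in the interior of the base would be at an end of a floor that overlaps the base
  without being equal to it.\<close>

lemma tail_base:
  assumes q: "q \<in> Q" and x: "x \<in> ivl (base q)"
  shows "tail x = tail (fst (base q))"
  unfolding tail_def
proof (rule sum.cong[OF refl])
  fix p assume p: "p \<in> visits"
  show "of_bool (x < fst (place p)) * weight p = of_bool (fst (base q) < fst (place p)) * weight p"
  proof (rule ccontr)
    assume neq: "\<not> ?thesis"
    then have wn: "weight p \<noteq> 0" by auto
    have pos: "fst (base q) < fst (place p)" "fst (place p) \<le> x"
      using neq x by (auto simp: ivl_def of_bool_def split: if_splits)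
    obtain q' \<sigma> t' where v: "p = (Inl (q', \<sigma>), t')" "q' \<in> Q" "t' < height q'"
      "place p = siter T t' (corner (base q') \<sigma>)"
      "germ (place p) (snd (base q') - fst (base q')) = (itm_map T ^^ t') ` ivl (base q')"
      using floor_visit[OF p wn] by metis
    define l where "l = snd (base q') - fst (base q')"
    have l: "l > 0" using base_nonempty[OF v(2)] by (simp add: l_def)
    have same: "q' = q \<and> t' = 0" if y: "y \<in> ivl (base q)" "y \<in> germ (place p) l" for y
    proof -
      obtain x' where "x' \<in> ivl (base q')" "(itm_map T ^^ t') x' = y"
        using y(2) v(5) by (auto simp: l_def)
      then show ?thesis
        using floors_disjoint[OF q v(2) height_pos[OF q] v(3) y(1), of x'] by auto
    qed
    show False
    proof (cases "place p" rule: spoint_cases)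
      case (Plus a)
      then have "q' = q \<and> t' = 0" using same[of a] pos x l by (auto simp: ivl_def)
      then have "germ (place p) l = ivl (base q)" using v(5) by (simp add: l_def)
      then have "{a..<a + l} = {fst (base q)..<snd (base q)}" using Plus by (simp add: ivl_def)
      then show False using l base_nonempty[OF q] pos Plus
        by (metis Ico_eq_Ico fst_conv less_add_same_cancel1 order_less_irrefl)
    next
      case (Minus a)
      define y where "y = max (fst (base q)) (a - l)"
      have "y \<in> ivl (base q)" "y \<in> germ (place p) l"
        using Minus pos x l by (auto simp: y_def ivl_def)
      then have "q' = q \<and> t' = 0" by (rule same)
      then have "germ (place p) l = ivl (base q)" using v(5) by (simp add: l_def)
      then have "{a - l..<a} = {fst (base q)..<snd (base q)}" using Minus by (simp add: ivl_def)
      then have "a = snd (base q)" using l base_nonempty[OF q] by (auto simp: Ico_eq_Ico)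
      then show False using pos x Minus by (simp add: ivl_def)
    qed
  qed
qed

lemma tail_floor:
  assumes q: "q \<in> Q" and t: "t < height q" and x: "x \<in> ivl (base q)"
  shows "tail ((itm_map T ^^ t) x) = tail (fst (base q))"
  using t
proof (induction t)
  case 0
  then show ?case using tail_base[OF q x] by simp
next
  case (Suc t)
  let ?y = "(itm_map T ^^ t) x"
  have img: "(itm_map T ^^ t) ` ivl (base q)
      = {(itm_map T ^^ t) (fst (base q))..<snd (base q) - fst (base q) + (itm_map T ^^ t) (fst (base q))}"
    using rigid_image[OF rigid[OF q]] Suc.prems by simp
  define e where "e = snd (base q) - fst (base q) + (itm_map T ^^ t) (fst (base q)) - ?y"
  have "?y \<in> (itm_map T ^^ t) ` ivl (base q)" using x by blast
  then have e: "e > 0" "{?y..<?y + e} \<subseteq> (itm_map T ^^ t) ` ivl (base q)"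
    unfolding img by (auto simp: e_def)
  moreover have "itm_map T ?y \<notin> ivl J"
    using upper_floors[OF q, of "Suc t" x] Suc.prems x by simp
  ultimately have "tail (itm_map T ?y) = tail ?y"
    using floor_attractor[OF q, of t] by (intro tail_step[of e]) auto
  then show ?case using Suc by simp
qed

lemma snd_visit:
  assumes "q \<in> Q" "t \<le> height q"
  shows "snd (siter T t (corner (base q) \<sigma>)) = \<sigma>"
  using siter_corner[OF base_nonempty[OF assms(1)] rigid[OF assms]] by (cases \<sigma>) simp_all

text \<open>A visited signed point determines its side, and its germ lies in one floor only.\<close>

lemma visits_distinct:
  assumes q: "q \<in> Q" "q' \<in> Q" and t: "t < height q" "t' < height q'"
    and eq: "siter T t' (corner (base q') \<sigma>') = siter T t (corner (base q) \<sigma>)"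
  shows "q' = q \<and> t' = t \<and> \<sigma>' = \<sigma>"
proof -
  let ?z = "siter T t (corner (base q) \<sigma>)"
  have \<sigma>: "\<sigma>' = \<sigma>" using eq snd_visit[OF q(1), of t \<sigma>] snd_visit[OF q(2), of t' \<sigma>'] t by simp
  have g: "germ ?z (snd (base q) - fst (base q)) = (itm_map T ^^ t) ` ivl (base q)"
    "germ ?z (snd (base q') - fst (base q')) = (itm_map T ^^ t') ` ivl (base q')"
    using germ_corner[OF base_nonempty[OF q(1)] rigid[OF q(1)], of t \<sigma>]
      germ_corner[OF base_nonempty[OF q(2)] rigid[OF q(2)], of t' \<sigma>'] t eq by simp_all
  define m where "m = min (snd (base q) - fst (base q)) (snd (base q') - fst (base q'))"
  have "m > 0" using base_nonempty[OF q(1)] base_nonempty[OF q(2)] by (simp add: m_def)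
  then obtain y where "y \<in> germ ?z m" using germ_nonempty by blast
  then have "y \<in> (itm_map T ^^ t) ` ivl (base q) \<and> y \<in> (itm_map T ^^ t') ` ivl (base q')"
    using germ_mono[of m "snd (base q) - fst (base q)" ?z]
      germ_mono[of m "snd (base q') - fst (base q')" ?z]
    unfolding g[symmetric] by (auto simp: m_def)
  then obtain x x' where "x \<in> ivl (base q)" "(itm_map T ^^ t) x = y"
    "x' \<in> ivl (base q')" "(itm_map T ^^ t') x' = y"
    by (elim conjE imageE) metis
  then have "q = q' \<and> t = t'" using floors_disjoint[OF q t, of x x'] by simp
  then show ?thesis using \<sigma> by simp
qed

lemma mass_visit:
  assumes q: "q \<in> Q" "t < height q"
  shows "mass (siter T t (corner (base q) \<sigma>)) = W q \<sigma> (Suc t)"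
proof -
  let ?z = "siter T t (corner (base q) \<sigma>)"
  let ?p = "(Inl (q, \<sigma>), t) :: ('q \<times> side + spoint) \<times> nat"
  have pv: "?p \<in> visits" using q by (cases \<sigma>) (auto simp: visits_def)
  have "of_bool (place p = ?z) * weight p = (if p = ?p then W q \<sigma> (Suc t) else 0)"
    if p: "p \<in> visits" for p
  proof (cases "weight p = 0")
    case True
    then show ?thesis by (auto simp: weight_def)
  next
    case False
    then obtain q' \<sigma>' t' where v: "p = (Inl (q', \<sigma>'), t')" "q' \<in> Q" "t' < height q'"
      "place p = siter T t' (corner (base q') \<sigma>')" "weight p = W q' \<sigma>' (Suc t')"
      using floor_visit[OF p False] by metis
    have "p = ?p" if eq: "place p = ?z"
    proof -
      have "siter T t' (corner (base q') \<sigma>') = ?z" using v(4) eq by (simp only:)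
      then have "q' = q \<and> t' = t \<and> \<sigma>' = \<sigma>" by (rule visits_distinct[OF q(1) v(2) q(2) v(3)])
      then show ?thesis using v(1) by simp
    qed
    moreover have "place ?p = ?z" by (simp add: place_def)
    ultimately show ?thesis using v by auto
  qed
  then have "mass ?z = (\<Sum>p\<in>visits. if p = ?p then W q \<sigma> (Suc t) else 0)"
    unfolding mass_def by (intro sum.cong) auto
  then show ?thesis using pv finite_visits by simp
qed

text \<open>The sign is chosen such that the charges at left ends are equal to the level.\<close>

definition level :: "'q \<Rightarrow> real" where
  "level q = - tail (fst (base q))"

text \<open>The visit is the only one at this point, so its charge is all the charge on this side of the
  discontinuity, which is determined by the tail on the floor.\<close>

lemma weight_at_disc:
  assumes q: "q \<in> Q" "t < height q" and d: "siter T t (corner (base q) \<sigma>) \<in> sdiscs T"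
  shows "W q \<sigma> (Suc t) = (case \<sigma> of Plus \<Rightarrow> level q | Minus \<Rightarrow> - level q)"
proof -
  have K: "fst (base q) < snd (base q)" "rigid T (base q) t"
    using base_nonempty rigid q by auto
  note sc = siter_corner[OF K]
  show ?thesis
  proof (cases \<sigma>)
    case Plus
    then have "W q \<sigma> (Suc t) = - tail ((itm_map T ^^ t) (fst (base q)))"
      using mass_visit[OF q, of Plus] mass_disc(1) d sc by (simp add: sdiscs_def)
    also have "\<dots> = level q"
      using tail_floor[OF q, of "fst (base q)"] K by (simp add: level_def ivl_def)
    finally show ?thesis using Plus by simp
  next
    case Minus
    define b where "b = snd (base q) - fst (base q) + (itm_map T ^^ t) (fst (base q))"
    obtain e where e: "e > 0"
        "\<And>x. x \<in> {b - e..<b} \<Longrightarrow> tail x = (\<Sum>p\<in>visits. of_bool (b \<le> fst (place p)) * weight p)"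
      using tail_left[of b] by auto
    define x where "x = max (b - e) ((itm_map T ^^ t) (fst (base q)))"
    have "x \<in> (itm_map T ^^ t) ` ivl (base q)"
      unfolding rigid_image[OF K(2)] using K(1) e(1) by (auto simp: x_def b_def)
    then have "tail x = - level q" using tail_floor[OF q] by (auto simp: level_def)
    moreover have "x \<in> {b - e..<b}" using K(1) e(1) by (auto simp: x_def b_def)
    ultimately have "mass (b, Minus) = - level q"
      using e(2)[of x] mass_disc(2)[of b] d sc Minus by (simp add: sdiscs_def b_def)
    then show ?thesis using mass_visit[OF q, of Minus] sc Minus by (simp add: b_def)
  qed
qed

text \<open>The tail vanishes to the left of the base because it lives on the attractor, and no floor ends
  there. So the charge of the left corner at time 0 is the whole jump of the tail, whether or
  not the corner is a discontinuity.\<close>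

lemma weight_at_left_end:
  assumes q: "q \<in> Q" and isolated: "\<And>e. e > 0 \<Longrightarrow> \<not> {fst (base q) - e..<fst (base q)} \<subseteq> attractor T"
  shows "W q Plus (Suc 0) = level q"
proof -
  let ?x = "fst (base q)"
  have z: "siter T 0 (corner (base q) Plus) = (?x, Plus)"
    using siter_0[OF corner_valid[OF q, of Plus]] by simp
  have "mass (?x, Minus) = 0"
    unfolding mass_def
  proof (rule sum.neutral, rule ballI, rule ccontr)
    fix p assume p: "p \<in> visits" and *: "of_bool (place p = (?x, Minus)) * weight p \<noteq> 0"
    then have "weight p \<noteq> 0" "place p = (?x, Minus)" by auto
    then obtain q' t' where "q' \<in> Q"
      "germ (?x, Minus) (snd (base q') - fst (base q')) = (itm_map T ^^ t') ` ivl (base q')"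
      using floor_visit[OF p] by metis
    then show False
      using isolated[of "snd (base q') - fst (base q')"] base_nonempty[of q']
        floor_attractor[of q' t'] by auto
  qed
  moreover have "(\<Sum>p\<in>visits. of_bool (?x \<le> fst (place p)) * weight p) = 0"
    using tail_left_attractor[of ?x] isolated by blast
  ultimately have "mass (?x, Plus) = level q" using mass_jump[of ?x] by (simp add: level_def)
  then show ?thesis using mass_visit[OF q height_pos[OF q], of Plus] z by simp
qed

end

section \<open>Return towers over components and periodic intervals\<close>

definition tower :: "itm \<Rightarrow> interval \<Rightarrow> interval \<Rightarrow> nat \<Rightarrow> bool" where
  "tower T J K h \<longleftrightarrow> 0 < h \<and> fst K < snd K \<and> ivl K \<subseteq> ivl J \<and> (\<forall>t\<le>h. rigid T K t) \<and>
     (\<forall>t. 0 < t \<and> t < h \<longrightarrow> (itm_map T ^^ t) ` ivl K \<inter> ivl J = {}) \<and>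
     (itm_map T ^^ h) ` ivl K \<subseteq> ivl J"

text \<open>The property of an interval component that makes its pieces return as a whole, and that keeps
  other intervals of the attractor from touching its ends.\<close>

definition absorbing :: "itm \<Rightarrow> interval \<Rightarrow> bool" where
  "absorbing T J \<longleftrightarrow> (\<forall>c d. {c..<d} \<subseteq> attractor T \<longrightarrow> {c..<d} \<inter> ivl J \<noteq> {} \<longrightarrow> {c..<d} \<subseteq> ivl J)"

lemma interval_component_absorbing:
  assumes "interval_component T J"
  shows "absorbing T J"
  unfolding absorbing_def
proof (intro allI impI)
  fix c d assume cd: "{c..<d} \<subseteq> attractor T" "{c..<d} \<inter> ivl J \<noteq> {}"
  have "c < d" using cd(2) by auto
  obtain C where C: "C \<in> components (attractor T)" "C = {fst J..<snd J} \<or> C = {fst J..snd J}"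
    using assms by (auto simp: interval_component_def)
  have "C \<inter> {c..<d} \<noteq> {}" using cd(2) C(2) by (force simp: ivl_def)
  then have "{c..<d} \<subseteq> C"
    using components_maximal[OF C(1) _ cd(1)] \<open>C \<inter> {c..<d} \<noteq> {}\<close>
    by (simp add: convex_connected)
  then have "{c..<d} \<subseteq> {fst J..snd J}" using C(2) by auto
  then have "fst J \<le> c \<and> d \<le> snd J"
    using \<open>c < d\<close> by (simp add: atLeastLessThan_subseteq_atLeastAtMost_iff)
  then show "{c..<d} \<subseteq> ivl J" by (auto simp: ivl_def)
qed

lemma absorbing_isolated:
  assumes J: "absorbing T J" "fst J < snd J" "ivl J \<subseteq> attractor T" and e: "e > 0"
  shows "\<not> {fst J - e..<fst J} \<subseteq> attractor T" "\<not> {snd J..<snd J + e} \<subseteq> attractor T"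
proof -
  show "\<not> {fst J - e..<fst J} \<subseteq> attractor T"
  proof
    assume *: "{fst J - e..<fst J} \<subseteq> attractor T"
    have "{fst J - e..<snd J} = {fst J - e..<fst J} \<union> ivl J" using J(2) e by (auto simp: ivl_def)
    then have "{fst J - e..<snd J} \<subseteq> attractor T" using * J(3) by auto
    moreover have "fst J \<in> {fst J - e..<snd J} \<inter> ivl J" using J(2) e by (auto simp: ivl_def)
    ultimately have "{fst J - e..<snd J} \<subseteq> ivl J" using J(1) unfolding absorbing_def by blast
    then show False using J(2) e by (auto simp: ivl_def)
  qed
  show "\<not> {snd J..<snd J + e} \<subseteq> attractor T"
  proof
    assume *: "{snd J..<snd J + e} \<subseteq> attractor T"
    have "{fst J..<snd J + e} = ivl J \<union> {snd J..<snd J + e}" using J(2) e by (auto simp: ivl_def)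
    then have "{fst J..<snd J + e} \<subseteq> attractor T" using * J(3) by auto
    moreover have "fst J \<in> {fst J..<snd J + e} \<inter> ivl J" using J(2) e by (auto simp: ivl_def)
    ultimately have "{fst J..<snd J + e} \<subseteq> ivl J" using J(1) unfolding absorbing_def by blast
    then show False using J(2) e by (auto simp: ivl_def)
  qed
qed

lemma sp_in_disjoint_germ:
  assumes "e > 0" "germ z e \<inter> ivl J = {}"
  shows "\<not> sp_in z J"
proof
  assume "sp_in z J"
  then obtain d where d: "d > 0" "germ z d \<subseteq> ivl J" using sp_in_iff_germ by blast
  obtain y where "y \<in> germ z (min d e)" using germ_nonempty[of "min d e" z] d(1) assms(1) by auto
  then show False using germ_mono[of "min d e" d z] germ_mono[of "min d e" e z] d(2) assms(2) by auto
qed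

context translation_map
begin

definition right_germ_in :: "real \<Rightarrow> bool" where
  "right_germ_in x \<longleftrightarrow> (\<exists>e>0. {x..<x + e} \<subseteq> attractor T)"

lemma right_germ_in_iter:
  assumes "right_germ_in x"
  shows "right_germ_in ((itm_map T ^^ t) x)"
proof -
  obtain e where e: "e > 0" "{x..<x + e} \<subseteq> attractor T" using assms right_germ_in_def by auto
  then have x: "x \<in> {0..<1}" using attractor_subset by force
  then have v: "sp_in (x, Plus) (0, 1)" by simp
  obtain d where d: "d > 0"
      "\<And>y. y \<in> germ (x, Plus) d \<Longrightarrow> (itm_map T ^^ t) y = y - x + (itm_map T ^^ t) x"
    using iter_germ[OF v, of t] siter_eq_sstep[OF v, of t] siter_Plus[OF x, of t] by auto
  have "{(itm_map T ^^ t) x..<(itm_map T ^^ t) x + min d e} \<subseteq> attractor T"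
  proof
    fix y assume y: "y \<in> {(itm_map T ^^ t) x..<(itm_map T ^^ t) x + min d e}"
    define z where "z = y - (itm_map T ^^ t) x + x"
    have "z \<in> germ (x, Plus) d" "z \<in> attractor T" using y e(2) by (auto simp: z_def)
    then have "(itm_map T ^^ t) z = y" "(itm_map T ^^ t) z \<in> attractor T"
      using d(2)[of z] iter_attractor[of z t] by (simp_all add: z_def)
    then show "y \<in> attractor T" by simp
  qed
  then show ?thesis using d(1) e(1) unfolding right_germ_in_def by (intro exI[of _ "min d e"]) auto
qed

lemma iter_injective:
  assumes "right_germ_in x" "right_germ_in x'" "(itm_map T ^^ t) x = (itm_map T ^^ t) x'"
  shows "x = x'"
  using assms(3)
proof (induction t)
  case (Suc t)
  obtain e where e: "e > 0" "{(itm_map T ^^ t) x..<(itm_map T ^^ t) x + e} \<subseteq> attractor T"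
    using right_germ_in_iter[OF assms(1)] right_germ_in_def by blast
  obtain d where d: "d > 0" "{(itm_map T ^^ t) x'..<(itm_map T ^^ t) x' + d} \<subseteq> attractor T"
    using right_germ_in_iter[OF assms(2)] right_germ_in_def by blast
  have "(itm_map T ^^ t) x = (itm_map T ^^ t) x'"
  proof (rule attractor_injective[of "min d e"])
    show "{(itm_map T ^^ t) x..<(itm_map T ^^ t) x + min d e} \<subseteq> attractor T"
      "{(itm_map T ^^ t) x'..<(itm_map T ^^ t) x' + min d e} \<subseteq> attractor T"
      using d(2) e(2) by force+
  qed (use Suc.prems d e in auto)
  then show ?case by (rule Suc.IH)
qed simp

lemma right_germ_in_ivl: "ivl K \<subseteq> attractor T \<Longrightarrow> x \<in> ivl K \<Longrightarrow> right_germ_in x"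
  unfolding right_germ_in_def by (rule exI[of _ "snd K - x"]) (auto simp: ivl_def)

lemma pull_back:
  assumes "right_germ_in x" "right_germ_in x'" "t \<le> t'" "(itm_map T ^^ t) x = (itm_map T ^^ t') x'"
  shows "x = (itm_map T ^^ (t' - t)) x'"
proof (rule iter_injective[OF assms(1) right_germ_in_iter[OF assms(2)]])
  have "t' = t + (t' - t)" using assms(3) by simp
  then show "(itm_map T ^^ t) x = (itm_map T ^^ t) ((itm_map T ^^ (t' - t)) x')"
    using assms(4) by (metis funpow_add o_apply)
qed

text \<open>Otherwise injectivity would make the images of \<open>K\<close> pairwise disjoint, but only
  finitely many disjoint intervals of one length fit into the unit interval.\<close>

lemma recurrence:
  assumes K: "fst K < snd K" "ivl K \<subseteq> attractor T" and rig: "\<And>t. rigid T K t"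
  shows "\<exists>t>0. (itm_map T ^^ t) ` ivl K \<inter> ivl K \<noteq> {}"
proof (rule ccontr)
  assume no: "\<not> ?thesis"
  define \<delta> where "\<delta> = snd K - fst K"
  define p where "p t = (itm_map T ^^ t) (fst K)" for t
  have \<delta>: "\<delta> > 0" using K(1) by (simp add: \<delta>_def)
  have img: "(itm_map T ^^ t) ` ivl K = {p t..<\<delta> + p t}" for t
    using rigid_image[OF rig, of t] by (simp add: p_def \<delta>_def)
  have apart: "{p s..<\<delta> + p s} \<inter> {p t..<\<delta> + p t} = {}" if "s < t" for s t
  proof (rule ccontr)
    assume "\<not> ?thesis"
    then obtain x x' where x: "x \<in> ivl K" "x' \<in> ivl K" "(itm_map T ^^ s) x = (itm_map T ^^ t) x'"
      unfolding img[symmetric] by blast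
    then have "x = (itm_map T ^^ (t - s)) x'"
      using pull_back[of x x' s t] right_germ_in_ivl[OF K(2)] that by simp
    then have "(itm_map T ^^ (t - s)) ` ivl K \<inter> ivl K \<noteq> {}" using x by blast
    then show False using no that by (meson zero_less_diff)
  qed
  \<comment> \<open>Disjoint intervals of length \<open>\<delta>\<close> have left ends in different boxes of length \<open>\<delta>\<close>.\<close>
  define f where "f t = \<lfloor>p t / \<delta>\<rfloor>" for t
  have "f s \<noteq> f t" if "s < t" for s t
  proof
    assume eq: "f s = f t"
    have "of_int (f t) * \<delta> \<le> p t" "p t < of_int (f t) * \<delta> + \<delta>" for t
      using floor_divide_lower[OF \<delta>, of "p t"] floor_divide_upper[OF \<delta>, of "p t"]
      by (simp_all add: f_def algebra_simps)
    then have "of_int (f t) * \<delta> \<le> p t" "p t < of_int (f t) * \<delta> + \<delta>"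
      "of_int (f t) * \<delta> \<le> p s" "p s < of_int (f t) * \<delta> + \<delta>" using eq by metis+
    then have "max (p s) (p t) \<in> {p s..<\<delta> + p s} \<inter> {p t..<\<delta> + p t}" by auto
    then show False using apart[OF that] by blast
  qed
  then have "inj f" by (metis injI linorder_neqE_nat)
  moreover have "range f \<subseteq> {0..\<lfloor>1 / \<delta>\<rfloor>}"
  proof
    fix k assume "k \<in> range f"
    then obtain t where t: "k = f t" by auto
    have "fst K \<in> attractor T" using K by (auto simp: ivl_def)
    then have "p t \<in> {0..<1}" using iter_attractor[of "fst K" t] attractor_subset by (auto simp: p_def)
    then show "k \<in> {0..\<lfloor>1 / \<delta>\<rfloor>}"
      unfolding t f_def using \<delta> by (auto intro!: floor_mono divide_right_mono)
  qed
  then have "finite (range f)" by (rule finite_subset) simp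
  ultimately show False using finite_imageD[of f UNIV] infinite_UNIV_nat by blast
qed

text \<open>Before the first contact with \<open>J\<close> an interior point of an image of
  \<open>K\<close> on a discontinuity would be a landing before return; so every image lies in
  one cell.\<close>

lemma unbroken_rigid:
  assumes ub: "unbroken T J K" and J: "ivl J \<subseteq> attractor T"
    and away: "\<And>i. 0 < i \<Longrightarrow> i < n \<Longrightarrow> (itm_map T ^^ i) ` ivl K \<inter> ivl J = {}"
  shows "t \<le> n \<Longrightarrow> rigid T K t"
proof (induction t)
  case 0
  show ?case by (simp add: rigid_def)
next
  case (Suc t)
  then have rt: "rigid T K t" by simp
  have K: "fst K < snd K" "ivl K \<subseteq> ivl J" using ub by (auto simp: unbroken_def)
  define c d where "c = (itm_map T ^^ t) (fst K)" and "d = snd K - fst K + c"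
  have img: "(itm_map T ^^ t) ` ivl K = {c..<d}" using rigid_image[OF rt] by (simp add: c_def d_def)
  have sub: "{c..<d} \<subseteq> {0..<1}"
    unfolding img[symmetric] using K(2) J iter_attractor attractor_subset by blast
  have "x \<notin> discs T" if x: "x \<in> {c<..<d}" for x
  proof
    assume xd: "x \<in> discs T"
    define z where "z = x - c + fst K"
    have z: "z \<in> {fst K<..<snd K}" "z \<in> ivl K" using x by (auto simp: z_def d_def ivl_def)
    have Tz: "(itm_map T ^^ t) z = x" using rigidD[OF rt z(2)] by (simp add: z_def c_def)
    have "(itm_map T ^^ i) z \<notin> ivl J" if "i \<in> {1..t}" for i
      using away[of i] that Suc.prems z(2) by auto
    then have "lands_before_return T J z" using Tz xd unfolding lands_before_return_def by blast
    then show False using ub z(1) by (auto simp: unbroken_def)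
  qed
  then obtain s where s: "s \<in> {1..r}" "{c..<d} \<subseteq> ivl (cell T s)"
    using ivl_in_cell[of c d] sub K(1) by (auto simp: d_def)
  have step: "(itm_map T ^^ Suc t) x = (itm_map T ^^ t) x + gam T s" if "x \<in> ivl K" for x
    using itm_map_cell[OF s(1)] s(2) img that by auto
  have f: "fst K \<in> ivl K" using K(1) by (simp add: ivl_def)
  have "(itm_map T ^^ Suc t) x = x - fst K + (itm_map T ^^ Suc t) (fst K)" if x: "x \<in> ivl K" for x
    using step[OF x] step[OF f] rigidD[OF rt x] by linarith
  then show ?case unfolding rigid_def by blast
qed

lemma tower_exists:
  assumes J: "absorbing T J" "ivl J \<subseteq> attractor T" and ub: "unbroken T J K"
  shows "\<exists>h. tower T J K h"
proof -
  have K: "fst K < snd K" "ivl K \<subseteq> ivl J" using ub by (auto simp: unbroken_def)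
  have ex: "\<exists>t>0. (itm_map T ^^ t) ` ivl K \<inter> ivl J \<noteq> {}"
  proof (rule ccontr)
    assume no: "\<not> ?thesis"
    then have "rigid T K t" for t using unbroken_rigid[OF ub J(2), of t t] by blast
    then show False using recurrence[OF K(1)] K(2) J(2) no by blast
  qed
  define h where "h = (LEAST t. 0 < t \<and> (itm_map T ^^ t) ` ivl K \<inter> ivl J \<noteq> {})"
  have h: "0 < h" "(itm_map T ^^ h) ` ivl K \<inter> ivl J \<noteq> {}"
    using LeastI_ex[OF ex] by (auto simp: h_def)
  have away: "(itm_map T ^^ i) ` ivl K \<inter> ivl J = {}" if "0 < i" "i < h" for i
    using not_less_Least[of i "\<lambda>t. 0 < t \<and> (itm_map T ^^ t) ` ivl K \<inter> ivl J \<noteq> {}"] that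
    unfolding h_def by blast
  have rig: "rigid T K t" if "t \<le> h" for t using unbroken_rigid[OF ub J(2) away that] .
  have "(itm_map T ^^ h) ` ivl K \<subseteq> attractor T" using K(2) J(2) iter_attractor by blast
  then have "(itm_map T ^^ h) ` ivl K \<subseteq> ivl J"
    using J(1) h(2) rigid_image[OF rig[OF order_refl]] unfolding absorbing_def by simp
  then show ?thesis unfolding tower_def using h(1) K rig away by blast
qed

lemma idx_cell:
  assumes "x \<in> {0..<1}"
  shows "idx T x \<in> {1..r}" "x \<in> ivl (cell T (idx T x))"
proof -
  have v: "sp_in (x, Plus) (0, 1)" using assms by simp
  have "idx T x = sidx (x, Plus)" by (simp add: idx_def sidx_def nint_eq ivl_iff_sp_in)
  then show "idx T x \<in> {1..r}" "x \<in> ivl (cell T (idx T x))"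
    using sidx[OF v] by (simp_all add: ivl_iff_sp_in)
qed

lemma periodic_rigid:
  assumes "periodic_ivl T J"
  shows "rigid T J t"
proof (induction t)
  case (Suc t)
  have f: "fst J \<in> ivl J" using assms by (auto simp: periodic_ivl_def ivl_def)
  have "(itm_map T ^^ Suc t) x = x - fst J + (itm_map T ^^ Suc t) (fst J)" if x: "x \<in> ivl J" for x
  proof -
    have "itinerary T x = itinerary T (fst J)" using assms x f unfolding periodic_ivl_def by blast
    then have "idx T ((itm_map T ^^ t) x) = idx T ((itm_map T ^^ t) (fst J))"
      by (metis itinerary_def)
    then have "itm_map T ((itm_map T ^^ t) x)
        = (itm_map T ^^ t) x + gam T (idx T ((itm_map T ^^ t) (fst J)))"
      by (simp add: itm_map_def)
    moreover have "itm_map T ((itm_map T ^^ t) (fst J))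
        = (itm_map T ^^ t) (fst J) + gam T (idx T ((itm_map T ^^ t) (fst J)))"
      by (simp add: itm_map_def)
    ultimately show ?thesis using rigidD[OF Suc x] unfolding funpow.simps o_apply by linarith
  qed
  then show ?case by (simp add: rigid_def)
qed (simp add: rigid_def)

lemma disc_not_inside_cell:
  assumes "s \<in> {1..r}" "bet T (s - 1) < x" "x < bet T s"
  shows "x \<notin> discs T"
proof
  assume "x \<in> discs T"
  then obtain s' where s': "s' \<in> {1..r - 1}" "x = bet T s'" by (auto simp: discs_eq)
  then have "sp_in (x, Minus) (cell T s')" using bet_less[of "s' - 1" s'] by (auto simp: cell_def)
  then have "s' = s" using cell_unique[of s' s "(x, Minus)"] s'(1) assms by (auto simp: cell_def)
  then show False using s'(2) assms by simp
qed

text \<open>Points with the same itinerary share a cell at all times, so they are never separated by a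
  discontinuity.\<close>

lemma periodic_unbroken:
  assumes "periodic_ivl T J"
  shows "unbroken T J J"
proof -
  have J: "fst J < snd J" "ivl J \<subseteq> {0..<1}" using assms by (auto simp: periodic_ivl_def)
  have "(itm_map T ^^ t) z \<notin> discs T" if z: "z \<in> {fst J<..<snd J}" for z t
  proof -
    have zJ: "z \<in> ivl J" "fst J \<in> ivl J" using z by (auto simp: ivl_def)
    define s where "s = idx T ((itm_map T ^^ t) (fst J))"
    have cell: "s \<in> {1..r} \<and> (itm_map T ^^ t) x \<in> ivl (cell T s)" if x: "x \<in> ivl J" for x
    proof -
      have "itinerary T x = itinerary T (fst J)" using assms x zJ(2) unfolding periodic_ivl_def by blast
      then have "idx T ((itm_map T ^^ t) x) = s" unfolding s_def by (metis itinerary_def)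
      moreover have "(itm_map T ^^ t) x \<in> {0..<1}" using x J(2) iter_in by blast
      ultimately show ?thesis using idx_cell by metis
    qed
    define c where "c = (itm_map T ^^ t) (fst J)"
    have "(itm_map T ^^ t) z = z - fst J + c"
      unfolding c_def by (rule rigidD[OF periodic_rigid[OF assms] zJ(1)])
    moreover have "s \<in> {1..r}" "z - fst J + c < bet T s" "bet T (s - 1) \<le> c"
      using cell[OF zJ(1)] cell[OF zJ(2)] calculation unfolding c_def[symmetric]
      by (simp_all add: ivl_def cell_def)
    ultimately show ?thesis using z disc_not_inside_cell[of s "z - fst J + c"] by simp
  qed
  then show ?thesis using J(1) by (auto simp: unbroken_def lands_before_return_def)
qed

lemma itinerary_iter: "itinerary T ((itm_map T ^^ t) x) i = itinerary T x (i + t)"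
  by (simp add: itinerary_def funpow_add)

text \<open>When an image of \<open>J\<close> meets \<open>J\<close> again, the union of the two is an
  interval of periodic points with one itinerary. By maximality it is \<open>J\<close>, and a
  translation of \<open>J\<close> into itself is the identity.\<close>

lemma periodic_tower:
  assumes mp: "maximal_periodic_ivl T J"
  shows "\<exists>h. tower T J J h \<and> (\<forall>x\<in>ivl J. (itm_map T ^^ h) x = x)"
proof -
  have per: "periodic_ivl T J" using mp by (simp add: maximal_periodic_ivl_def)
  note rig = periodic_rigid[OF per]
  have J: "fst J < snd J" "ivl J \<subseteq> {0..<1}" using per by (auto simp: periodic_ivl_def)
  have f: "fst J \<in> ivl J" using J by (simp add: ivl_def)
  obtain p where p: "p > 0" "(itm_map T ^^ p) (fst J) = fst J"
    using per f by (auto simp: periodic_ivl_def)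
  have id: "(itm_map T ^^ p) x = x" if "x \<in> ivl J" for x using rigidD[OF rig that, of p] p by simp
  define h where "h = (LEAST t. 0 < t \<and> (itm_map T ^^ t) ` ivl J \<inter> ivl J \<noteq> {})"
  have "(itm_map T ^^ p) (fst J) \<in> (itm_map T ^^ p) ` ivl J" using f by blast
  then have "(itm_map T ^^ p) ` ivl J \<inter> ivl J \<noteq> {}" using f p(2) by auto
  then have h: "0 < h" "(itm_map T ^^ h) ` ivl J \<inter> ivl J \<noteq> {}"
    using LeastI[of "\<lambda>t. 0 < t \<and> (itm_map T ^^ t) ` ivl J \<inter> ivl J \<noteq> {}" p] p(1)
    by (auto simp: h_def)
  have away: "(itm_map T ^^ i) ` ivl J \<inter> ivl J = {}" if "0 < i" "i < h" for i
    using not_less_Least[of i "\<lambda>t. 0 < t \<and> (itm_map T ^^ t) ` ivl J \<inter> ivl J \<noteq> {}"] that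
    unfolding h_def by blast
  define c d where "c = (itm_map T ^^ h) (fst J)" and "d = snd J - fst J + c"
  have img: "(itm_map T ^^ h) ` ivl J = {c..<d}" using rigid_image[OF rig] by (simp add: c_def d_def)
  define K where "K = (min (fst J) c, max (snd J) d)"
  have meet: "{c..<d} \<inter> {fst J..<snd J} \<noteq> {}" using h(2) img by (simp add: ivl_def)
  have KU: "ivl K = ivl J \<union> (itm_map T ^^ h) ` ivl J"
    unfolding img using meet J(1) by (auto simp: K_def ivl_def d_def)
  have "periodic_ivl T K"
    unfolding periodic_ivl_def
  proof (intro conjI ballI)
    show "fst K < snd K" using J(1) by (auto simp: K_def)
    show "ivl K \<subseteq> {0..<1}" unfolding KU using J(2) iter_in by blast
    have idK: "(itm_map T ^^ p) x = x" if x: "x \<in> ivl K" for x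
    proof -
      consider "x \<in> ivl J" | x' where "x' \<in> ivl J" "x = (itm_map T ^^ h) x'" using x KU by auto
      then show ?thesis
      proof cases
        case 2
        have "(itm_map T ^^ p) ((itm_map T ^^ h) x') = (itm_map T ^^ h) ((itm_map T ^^ p) x')"
          by (metis add.commute funpow_add o_apply)
        then show ?thesis using 2 id by simp
      qed (rule id)
    qed
    then show "\<exists>p>0. (itm_map T ^^ p) x = x" if "x \<in> ivl K" for x using p(1) that by blast
    obtain w w' where w: "w \<in> ivl J" "w' \<in> ivl J" "w = (itm_map T ^^ h) w'" using h(2) by auto
    have it: "itinerary T x = itinerary T w" if x: "x \<in> ivl K" for x
    proof -
      have same: "itinerary T u = itinerary T w" if "u \<in> ivl J" for u
        using per that w(1) unfolding periodic_ivl_def by blast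
      consider "x \<in> ivl J" | x' where "x' \<in> ivl J" "x = (itm_map T ^^ h) x'" using x KU by auto
      then show ?thesis
      proof cases
        case 2
        have "itinerary T x' = itinerary T w'" using same[OF 2(1)] same[OF w(2)] by simp
        then show ?thesis using 2(2) w(3) by (auto simp: itinerary_iter fun_eq_iff)
      qed (rule same)
    qed
    then show "itinerary T x = itinerary T y" if "x \<in> ivl K" "y \<in> ivl K" for x y
      using that by simp
  qed
  then have "K = J" using mp KU unfolding maximal_periodic_ivl_def by blast
  then have "fst J \<le> c" "d \<le> snd J" by (auto simp: K_def prod_eq_iff min_def max_def split: if_splits)
  then have c: "c = fst J" by (simp add: d_def)
  have into: "(itm_map T ^^ h) ` ivl J \<subseteq> ivl J" using KU \<open>K = J\<close> by auto
  have "tower T J J h" unfolding tower_def using h(1) J(1) rig away into by blast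
  moreover have "(itm_map T ^^ h) x = x" if "x \<in> ivl J" for x
    using rigidD[OF rig that, of h] c by (simp add: c_def)
  ultimately show ?thesis by blast
qed

lemma partition_piece:
  assumes "return_partition T J N a" "j < N"
  shows "unbroken T J (a j, a (Suc j))"
    "unbroken T J K \<Longrightarrow> ivl (a j, a (Suc j)) \<subseteq> ivl K \<Longrightarrow> K = (a j, a (Suc j))"
proof -
  have "\<forall>j\<in>{1..N}. unbroken T J (a (j - 1), a j) \<and>
      (\<forall>K. unbroken T J K \<and> ivl (a (j - 1), a j) \<subseteq> ivl K \<longrightarrow> K = (a (j - 1), a j))"
    using assms(1) unfolding return_partition_def by blast
  then have "unbroken T J (a (Suc j - 1), a (Suc j)) \<and>
      (\<forall>K. unbroken T J K \<and> ivl (a (Suc j - 1), a (Suc j)) \<subseteq> ivl K \<longrightarrow> K = (a (Suc j - 1), a (Suc j)))"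
    by (rule bspec) (use assms(2) in auto)
  then show "unbroken T J (a j, a (Suc j))"
    "unbroken T J K \<Longrightarrow> ivl (a j, a (Suc j)) \<subseteq> ivl K \<Longrightarrow> K = (a j, a (Suc j))"
    unfolding diff_Suc_1 by blast+
qed

lemma partition_unbroken_single:
  assumes "return_partition T J N a" "unbroken T J J"
  shows "N = 1"
proof -
  have J: "fst J < snd J" using assms(2) by (simp add: unbroken_def)
  have p: "a 0 = fst J" "a N = snd J" "\<forall>j<N. a j < a (Suc j)"
    using assms(1) by (auto simp: return_partition_def)
  then have N: "N \<ge> 1" using J by (cases N) auto
  then have "unbroken T J (a 0, a 1)" using partition_piece(1)[OF assms(1), of 0] by simp
  then have "J = (a 0, a 1)"
    using partition_piece(2)[OF assms(1) _ assms(2), of 0] N by (simp add: unbroken_def)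
  then have "a 1 = a N" using p(2) by (metis snd_conv)
  have "a 1 < a N" if "1 < N"
  proof -
    have "a 1 < a j" if "1 < j" "j \<le> N" for j
      using that
    proof (induction j)
      case (Suc j)
      then show ?case using p(3) by (cases "j = 1") (auto intro: less_trans)
    qed simp
    then show ?thesis using that by simp
  qed
  then show ?thesis using N \<open>a 1 = a N\<close> by (cases "N = 1") auto
qed

lemma partition_increasing:
  assumes "return_partition T J N a" "i < j" "j \<le> N"
  shows "a i < a j"
  using assms(2,3)
proof (induction j)
  case (Suc j)
  then show ?case
    using assms(1) by (cases "i = j") (auto simp: return_partition_def intro: less_trans)
qed simp

text \<open>A common point of two floors is pulled back by injectivity until one of the floors is a base;
  the other one is then a floor that meets \<open>J\<close>, hence a base as well.\<close>

lemma tower_disjoint: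
  assumes t: "tower T J K h" "tower T J K' h'" and J: "ivl J \<subseteq> attractor T"
    and tt: "t < h" "t' < h'" and x: "x \<in> ivl K" "x' \<in> ivl K'"
    and eq: "(itm_map T ^^ t) x = (itm_map T ^^ t') x'"
  shows "t = t' \<and> x = x'"
proof -
  have *: "t = t' \<and> x = x'"
    if "tower T J K h" "tower T J K' h'" "t < h" "t' < h'" "x \<in> ivl K" "x' \<in> ivl K'"
      "(itm_map T ^^ t) x = (itm_map T ^^ t') x'" "t \<le> t'" for K K' h h' t t' x x'
  proof -
    have xJ: "x \<in> ivl J" "x' \<in> ivl J" using that by (auto simp: tower_def)
    then have p: "x = (itm_map T ^^ (t' - t)) x'"
      using pull_back[of x x' t t'] right_germ_in_ivl[OF J] that by simp
    have "t' - t = 0"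
    proof (rule ccontr)
      assume "t' - t \<noteq> 0"
      then have "(itm_map T ^^ (t' - t)) ` ivl K' \<inter> ivl J = {}"
        using that(2,4) by (simp add: tower_def)
      then show False using p xJ(1) that(6) by blast
    qed
    then show ?thesis using p that(8) by simp
  qed
  show ?thesis using *[OF t tt x eq] *[OF t(2,1) tt(2,1) x(2,1) eq[symmetric]] by (cases "t \<le> t'") auto
qed

lemma tower_corner_valid:
  assumes "tower T J K h" "ivl J \<subseteq> attractor T"
  shows "sp_in (corner K \<sigma>) (0, 1)"
proof -
  have "ivl K \<subseteq> {0..<1}" "fst K < snd K" using assms attractor_subset by (auto simp: tower_def)
  then have "0 \<le> fst K" "snd K \<le> 1" by (auto simp: ivl_def)
  then show ?thesis using \<open>fst K < snd K\<close> by (cases \<sigma>) auto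
qed

lemma tower_return:
  assumes "tower T J K h"
  shows "sp_in (siter T h (corner K \<sigma>)) J"
    "0 < t \<Longrightarrow> t < h \<Longrightarrow> \<not> sp_in (siter T t (corner K \<sigma>)) J"
proof -
  have K: "fst K < snd K" and rig: "\<And>t. t \<le> h \<Longrightarrow> rigid T K t" using assms by (auto simp: tower_def)
  show "sp_in (siter T h (corner K \<sigma>)) J"
    unfolding sp_in_iff_germ using germ_corner[OF K rig] K assms
    by (intro exI[of _ "snd K - fst K"]) (auto simp: tower_def)
  assume "0 < t" "t < h"
  then show "\<not> sp_in (siter T t (corner K \<sigma>)) J"
    using germ_corner[OF K rig, of t \<sigma>] K assms
    by (intro sp_in_disjoint_germ[of "snd K - fst K"]) (auto simp: tower_def)
qed

lemma tower_land_times: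
  assumes "tower T J K h"
  shows "land_times T J (corner K \<sigma>) = {t. t < h \<and> siter T t (corner K \<sigma>) \<in> sdiscs T}"
proof -
  have "h > 0" using assms by (simp add: tower_def)
  have "(\<forall>i\<in>{1..t}. \<not> sp_in (siter T i (corner K \<sigma>)) J) \<longleftrightarrow> t < h" for t
  proof
    assume *: "\<forall>i\<in>{1..t}. \<not> sp_in (siter T i (corner K \<sigma>)) J"
    show "t < h"
    proof (rule ccontr)
      assume "\<not> t < h"
      then show False using *[rule_format, of h] tower_return(1)[OF assms] \<open>h > 0\<close> by auto
    qed
  next
    assume "t < h"
    then show "\<forall>i\<in>{1..t}. \<not> sp_in (siter T i (corner K \<sigma>)) J"
      using tower_return(2)[OF assms] by auto
  qed
  then show ?thesis by (auto simp: land_times_def)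
qed

lemma sidx_sides_agree:
  assumes "sp_in (x, Plus) (0, 1)" "sp_in (x, Minus) (0, 1)" "x \<notin> discs T"
  shows "sidx (x, Minus) = sidx (x, Plus)"
proof -
  define s where "s = sidx (x, Plus)"
  have s: "s \<in> {1..r}" "bet T (s - 1) \<le> x" "x < bet T s"
    using sidx[OF assms(1)] by (auto simp: s_def cell_def)
  have "x \<noteq> bet T (s - 1)"
  proof
    assume *: "x = bet T (s - 1)"
    show False
    proof (cases "s = 1")
      case True
      then show False using * assms(2) bet_0 by simp
    next
      case False
      then have "s - 1 \<in> {1..r - 1}" using s(1) by auto
      then show False using * assms(3) unfolding discs_eq by blast
    qed
  qed
  then show ?thesis using s by (intro sidx_eq) (auto simp: s_def[symmetric] cell_def)
qed

text \<open>Away from the discontinuities both sides of a point lie in the same cell.\<close>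

lemma sides_agree:
  assumes v: "sp_in (x, Plus) (0, 1)" "sp_in (x, Minus) (0, 1)"
    and nd: "\<And>t. t < l \<Longrightarrow> (itm_map T ^^ t) x \<notin> discs T"
  shows "t \<le> l \<Longrightarrow> siter T t (x, Minus) = ((itm_map T ^^ t) x, Minus)"
proof (induction t)
  case 0
  then show ?case using siter_0[OF v(2)] by simp
next
  case (Suc t)
  have x: "x \<in> {0..<1}" using v by simp
  let ?y = "(itm_map T ^^ t) x"
  have IH: "siter T t (x, Minus) = (?y, Minus)" using Suc by simp
  have vy: "sp_in (?y, Minus) (0, 1)" using siter_valid[OF v(2), of t] IH by simp
  have vp: "sp_in (?y, Plus) (0, 1)" using iter_in[OF x, of t] by simp
  have "sidx (?y, Minus) = sidx (?y, Plus)"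
    using nd[of t] Suc.prems by (intro sidx_sides_agree[OF vp vy]) auto
  then show ?case
    using siter_Suc[OF v(2), of t] IH itm_map_eq_sstep[of ?y] vp by (simp add: sstep_def)
qed

text \<open>If \<open>a j\<close> did not land before its return, the two pieces next to it could be
  merged, against their maximality. The tower on the left cannot return before the landing time
  either: the image of \<open>a j\<close> would then be the right end of \<open>J\<close>, and
  the floor of the right-hand tower starting there would extend the component.\<close>

lemma division_point_landing:
  assumes J: "absorbing T J" "fst J < snd J" "ivl J \<subseteq> attractor T" and part: "return_partition T J N a"
    and j: "0 < j" "j < N"
    and tw: "tower T J (a (j - 1), a j) h" "tower T J (a j, a (Suc j)) h'"
  obtains l where "l < h" "l < h'" "(itm_map T ^^ l) (a j) \<in> discs T"
    "\<And>t. t < l \<Longrightarrow> (itm_map T ^^ t) (a j) \<notin> discs T"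
    "\<And>t. t \<le> l \<Longrightarrow> siter T t (a j, Plus) = ((itm_map T ^^ t) (a j), Plus)"
    "\<And>t. t \<le> l \<Longrightarrow> siter T t (a j, Minus) = ((itm_map T ^^ t) (a j), Minus)"
proof -
  have inc: "a (j - 1) < a j" "a j < a (Suc j)" using tw by (auto simp: tower_def)
  have ubl: "unbroken T J (a (j - 1), a j)"
      "\<And>K. unbroken T J K \<Longrightarrow> ivl (a (j - 1), a j) \<subseteq> ivl K \<Longrightarrow> K = (a (j - 1), a j)"
    using partition_piece[OF part, of "j - 1"] j by simp_all
  have ubr: "unbroken T J (a j, a (Suc j))" using partition_piece(1)[OF part] j by simp
  let ?K = "(a (j - 1), a (Suc j))"
  have "\<not> unbroken T J ?K"
  proof
    assume "unbroken T J ?K"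
    moreover have "ivl (a (j - 1), a j) \<subseteq> ivl ?K" using inc by (auto simp: ivl_def)
    ultimately have "?K = (a (j - 1), a j)" using ubl(2) by blast
    then show False using inc by simp
  qed
  moreover have "ivl ?K \<subseteq> ivl J"
  proof -
    have "ivl ?K = ivl (a (j - 1), a j) \<union> ivl (a j, a (Suc j))" using inc by (auto simp: ivl_def)
    then show ?thesis using tw by (auto simp: tower_def)
  qed
  ultimately obtain z where z: "z \<in> {a (j - 1)<..<a (Suc j)}" "lands_before_return T J z"
    using inc by (auto simp: unbroken_def)
  have "z = a j"
  proof (rule ccontr)
    assume "z \<noteq> a j"
    then have "z \<in> {a (j - 1)<..<a j} \<or> z \<in> {a j<..<a (Suc j)}" using z(1) by auto
    then show False using ubl(1) ubr z(2) by (auto simp: unbroken_def)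
  qed
  then obtain t0 where t0: "(itm_map T ^^ t0) (a j) \<in> discs T"
      "\<And>i. i \<in> {1..t0} \<Longrightarrow> (itm_map T ^^ i) (a j) \<notin> ivl J"
    using z(2) by (auto simp: lands_before_return_def)
  define l where "l = (LEAST t. (itm_map T ^^ t) (a j) \<in> discs T)"
  have l: "(itm_map T ^^ l) (a j) \<in> discs T" "l \<le> t0"
    using t0(1) by (auto simp: l_def intro: LeastI Least_le)
  have nd: "(itm_map T ^^ t) (a j) \<notin> discs T" if "t < l" for t
    using not_less_Least that unfolding l_def by blast
  have aj: "a j \<in> ivl (a j, a (Suc j))" using inc by (simp add: ivl_def)
  have "l < h'"
  proof (rule ccontr)
    assume "\<not> l < h'"
    then have "h' \<in> {1..t0}" using l(2) tw(2) by (auto simp: tower_def)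
    moreover have "(itm_map T ^^ h') (a j) \<in> ivl J" using tw(2) aj by (auto simp: tower_def)
    ultimately show False using t0(2) by blast
  qed
  have v: "sp_in (a j, Plus) (0, 1)" "sp_in (a j, Minus) (0, 1)"
    using tower_corner_valid[OF tw(2) J(3), of Plus] tower_corner_valid[OF tw(1) J(3), of Minus]
    by simp_all
  have minus: "siter T t (a j, Minus) = ((itm_map T ^^ t) (a j), Minus)" if "t \<le> l" for t
    using sides_agree[OF v nd that] .
  have "l < h"
  proof (rule ccontr)
    assume n: "\<not> l < h"
    then have h: "h \<in> {1..t0}" "h \<le> l" using l(2) tw(1) by (auto simp: tower_def)
    have "sp_in ((itm_map T ^^ h) (a j), Minus) J"
      using tower_return(1)[OF tw(1), of Minus] minus[OF h(2)] by simp
    then have right: "(itm_map T ^^ h) (a j) = snd J" using t0(2)[OF h(1)] by (auto simp: ivl_def)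
    have "rigid T (a j, a (Suc j)) h" using tw(2) \<open>l < h'\<close> h(2) by (auto simp: tower_def)
    then have "(itm_map T ^^ h) ` ivl (a j, a (Suc j)) = {snd J..<snd J + (a (Suc j) - a j)}"
      using rigid_image[of "(a j, a (Suc j))" h] right by (simp add: algebra_simps)
    moreover have "(itm_map T ^^ h) ` ivl (a j, a (Suc j)) \<subseteq> attractor T"
      using tw(2) J(3) iter_attractor by (auto simp: tower_def)
    ultimately show False using absorbing_isolated(2)[OF J, of "a (Suc j) - a j"] inc by simp
  qed
  have x: "a j \<in> {0..<1}" using v by simp
  show ?thesis using that[OF \<open>l < h\<close> \<open>l < h'\<close> l(1) nd siter_Plus[OF x] minus] .
qed

end

section \<open>Landing, connection and return vectors as sums along an orbit\<close>

lemma sum_blocks: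
  fixes p :: "nat \<Rightarrow> nat" and f :: "nat \<Rightarrow> 'v::comm_monoid_add"
  assumes "\<And>k. k < n \<Longrightarrow> p k \<le> p (Suc k)"
  shows "(\<Sum>k<n. \<Sum>t\<in>{p k..<p (Suc k)}. f t) = (\<Sum>t\<in>{p 0..<p n}. f t) \<and> p 0 \<le> p n"
  using assms
proof (induction n)
  case (Suc n)
  then have IH: "(\<Sum>k<n. \<Sum>t\<in>{p k..<p (Suc k)}. f t) = (\<Sum>t\<in>{p 0..<p n}. f t)" "p 0 \<le> p n" by auto
  moreover have "p n \<le> p (Suc n)" using Suc.prems by simp
  ultimately show ?case by (simp add: sum.atLeastLessThan_concat)
qed simp

lemma sum_shift_coefficients:
  fixes A :: "nat \<Rightarrow> real" and S g :: "nat \<Rightarrow> 'v::real_vector"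
  assumes "0 < m"
  shows "A 0 *\<^sub>R (S 0 - g 0) + (\<Sum>k=1..m - 1. A k *\<^sub>R (S k + g (k - 1) - g k))
      + A m *\<^sub>R (S m + g (m - 1))
    = (\<Sum>k<Suc m. A k *\<^sub>R S k) + (\<Sum>k<m. (A (Suc k) - A k) *\<^sub>R g k)"
proof -
  obtain n where m: "m = Suc n" using assms by (cases m) auto
  have "A 0 *\<^sub>R (S 0 - g 0) + (\<Sum>k=1..n. A k *\<^sub>R (S k + g (k - 1) - g k))
      = (\<Sum>k<Suc n. A k *\<^sub>R S k) + (\<Sum>k<n. (A (Suc k) - A k) *\<^sub>R g k) - A n *\<^sub>R g n"
    by (induction n) (simp_all add: algebra_simps)
  then show ?thesis by (simp add: m algebra_simps)
qed

lemma card_below_nth: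
  fixes L :: "nat set"
  assumes "finite L" "k \<le> card L"
    and "\<And>i. i < k \<Longrightarrow> sorted_list_of_set L ! i < x"
    and "\<And>i. k \<le> i \<Longrightarrow> i < card L \<Longrightarrow> x \<le> sorted_list_of_set L ! i"
  shows "card {l \<in> L. l < x} = k"
proof -
  let ?xs = "sorted_list_of_set L"
  have "{l \<in> L. l < x} = (!) ?xs ` {..<k}"
  proof
    show "{l \<in> L. l < x} \<subseteq> (!) ?xs ` {..<k}"
    proof
      fix l assume l: "l \<in> {l \<in> L. l < x}"
      then have "l \<in> set ?xs" using assms(1) by simp
      then obtain i where "i < card L" "l = ?xs ! i" by (auto simp: in_set_conv_nth)
      then show "l \<in> (!) ?xs ` {..<k}" using assms(4)[of i] l by (cases "i < k") auto
    qed
    show "(!) ?xs ` {..<k} \<subseteq> {l \<in> L. l < x}"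
      using assms nth_mem[of _ ?xs] by fastforce
  qed
  moreover have "inj_on ((!) ?xs) {..<k}"
    using assms(2) by (intro inj_on_nth) auto
  ultimately show ?thesis by (simp add: card_image)
qed

lemma sorted_list_less:
  "i < j \<Longrightarrow> j < card L \<Longrightarrow> sorted_list_of_set L ! i < sorted_list_of_set (L :: nat set) ! j"
  by (rule sorted_wrt_nth_less[OF strict_sorted_list_of_set]) simp_all

lemma sorted_list_mono:
  "i \<le> j \<Longrightarrow> j < card L \<Longrightarrow> sorted_list_of_set L ! i \<le> sorted_list_of_set (L :: nat set) ! j"
  using sorted_list_less[of i j L] by (cases "i = j") auto

lemma card_up_to_nth:
  fixes L :: "nat set"
  assumes "finite L" "k < card L"
  shows "card {l \<in> L. l < Suc (sorted_list_of_set L ! k)} = Suc k"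
  using assms sorted_list_mono[of _ k L] sorted_list_less[of k _ L]
  by (intro card_below_nth[OF assms(1)]) (auto simp: less_Suc_eq_le Suc_le_eq)

lemma sum_jumps:
  fixes L :: "nat set" and A :: "nat \<Rightarrow> real" and G :: "nat \<Rightarrow> 'v::real_vector"
  assumes L: "finite L" "L \<subseteq> {..<h}"
  shows "(\<Sum>t<h. (A (card {l \<in> L. l < Suc t}) - A (card {l \<in> L. l < t})) *\<^sub>R G t)
    = (\<Sum>k<card L. (A (Suc k) - A k) *\<^sub>R G (sorted_list_of_set L ! k))"
proof -
  let ?xs = "sorted_list_of_set L"
  have "(\<Sum>t<h. (A (card {l \<in> L. l < Suc t}) - A (card {l \<in> L. l < t})) *\<^sub>R G t)
    = (\<Sum>t\<in>L. (A (card {l \<in> L. l < Suc t}) - A (card {l \<in> L. l < t})) *\<^sub>R G t)"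
  proof (rule sum.mono_neutral_right)
    show "\<forall>t\<in>{..<h} - L. (A (card {l \<in> L. l < Suc t}) - A (card {l \<in> L. l < t})) *\<^sub>R G t = 0"
    proof
      fix t assume t: "t \<in> {..<h} - L"
      then have "{l \<in> L. l < Suc t} = {l \<in> L. l < t}" using less_Suc_eq by auto
      then show "(A (card {l \<in> L. l < Suc t}) - A (card {l \<in> L. l < t})) *\<^sub>R G t = 0" by simp
    qed
  qed (use L in auto)
  also have "\<dots> = (\<Sum>k<card L. (A (card {l \<in> L. l < Suc (?xs ! k)}) - A (card {l \<in> L. l < ?xs ! k}))
      *\<^sub>R G (?xs ! k))"
    by (rule sum.reindex_bij_betw[symmetric]) (use L in \<open>auto intro!: bij_betw_nth\<close>)
  also have "\<dots> = (\<Sum>k<card L. (A (Suc k) - A k) *\<^sub>R G (?xs ! k))"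
  proof (rule sum.cong[OF refl])
    fix k assume "k \<in> {..<card L}"
    then have k: "k < card L" by simp
    have "card {l \<in> L. l < ?xs ! k} = k"
      using k sorted_list_less[of _ k L] sorted_list_mono[of k _ L] by (intro card_below_nth[OF L(1)]) auto
    moreover have "card {l \<in> L. l < Suc (?xs ! k)} = Suc k" by (rule card_up_to_nth[OF L(1) k])
    ultimately show "(A (card {l \<in> L. l < Suc (?xs ! k)}) - A (card {l \<in> L. l < ?xs ! k})) *\<^sub>R G (?xs ! k)
        = (A (Suc k) - A k) *\<^sub>R G (?xs ! k)" by simp
  qed
  finally show ?thesis .
qed

text \<open>The coefficients \<open>A 0\<close>, \..., \<open>A m\<close> belong to the blocks into which
  the landing times cut the time before the return. Collected by time instead of by block,
  \<open>E t\<close> has the coefficient of the block of \<open>t\<close>, and \<open>G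
  t\<close> the jump of the coefficient at \<open>t\<close>.\<close>

lemma sum_over_landmarks:
  fixes L :: "nat set" and A :: "nat \<Rightarrow> real" and E G :: "nat \<Rightarrow> 'v::real_vector"
  assumes L: "finite L" "L \<subseteq> {..<h}" "L \<noteq> {}"
  defines "xs \<equiv> sorted_list_of_set L" and "m \<equiv> card L"
  shows "A 0 *\<^sub>R ((\<Sum>t<xs ! 0. E t) - G (xs ! 0))
      + (\<Sum>k=1..m - 1. A k *\<^sub>R ((\<Sum>t\<in>{xs ! (k - 1)..<xs ! k}. E t) + G (xs ! (k - 1)) - G (xs ! k)))
      + A m *\<^sub>R ((\<Sum>t\<in>{xs ! (m - 1)..<h}. E t) + G (xs ! (m - 1)))
    = (\<Sum>t<h. A (card {l \<in> L. l < Suc t}) *\<^sub>R E t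
        + (A (card {l \<in> L. l < Suc t}) - A (card {l \<in> L. l < t})) *\<^sub>R G t)"
proof -
  have m: "0 < m" using L by (simp add: m_def card_gt_0_iff)
  define p where "p k = (if k = 0 then 0 else if k = Suc m then h else xs ! (k - 1))" for k
  have xsh: "xs ! i < h" if "i < m" for i
    using that L nth_mem[of i xs] by (auto simp: xs_def m_def)
  have mono: "p k \<le> p (Suc k)" if "k < Suc m" for k
    using that xsh[of "k - 1"] sorted_list_mono[of "k - 1" k L] m
    by (auto simp: p_def xs_def m_def)
  have cnt: "card {l \<in> L. l < Suc t} = k" if k: "k < Suc m" and t: "t \<in> {p k..<p (Suc k)}" for k t
  proof (rule card_below_nth[OF L(1)])
    show "k \<le> card L" using k by (simp add: m_def)
    fix i
    show "sorted_list_of_set L ! i < Suc t" if "i < k"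
    proof -
      have "sorted_list_of_set L ! i \<le> sorted_list_of_set L ! (k - 1)"
        using that k by (intro sorted_list_mono) (auto simp: m_def)
      then show ?thesis using that k t by (auto simp: p_def xs_def m_def)
    qed
    show "Suc t \<le> sorted_list_of_set L ! i" if "k \<le> i" "i < card L"
      using sorted_list_mono[of k i L] that k t by (auto simp: p_def xs_def m_def)
  qed
  have "(\<Sum>t<h. A (card {l \<in> L. l < Suc t}) *\<^sub>R E t)
      = (\<Sum>k<Suc m. \<Sum>t\<in>{p k..<p (Suc k)}. A (card {l \<in> L. l < Suc t}) *\<^sub>R E t)"
    using sum_blocks[of "Suc m" p "\<lambda>t. A (card {l \<in> L. l < Suc t}) *\<^sub>R E t"] mono
    by (simp add: p_def lessThan_atLeast0)
  also have "\<dots> = (\<Sum>k<Suc m. A k *\<^sub>R (\<Sum>t\<in>{p k..<p (Suc k)}. E t))"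
    unfolding scaleR_sum_right using cnt by (intro sum.cong) auto
  finally have e: "(\<Sum>t<h. A (card {l \<in> L. l < Suc t}) *\<^sub>R E t)
      = (\<Sum>k<Suc m. A k *\<^sub>R (\<Sum>t\<in>{p k..<p (Suc k)}. E t))" .
  have "A 0 *\<^sub>R ((\<Sum>t\<in>{p 0..<p (Suc 0)}. E t) - G (xs ! 0))
      + (\<Sum>k=1..m - 1. A k *\<^sub>R ((\<Sum>t\<in>{p k..<p (Suc k)}. E t) + G (xs ! (k - 1)) - G (xs ! k)))
      + A m *\<^sub>R ((\<Sum>t\<in>{p m..<p (Suc m)}. E t) + G (xs ! (m - 1)))
    = (\<Sum>t<h. A (card {l \<in> L. l < Suc t}) *\<^sub>R E t
        + (A (card {l \<in> L. l < Suc t}) - A (card {l \<in> L. l < t})) *\<^sub>R G t)"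
    unfolding sum.distrib sum_jumps[OF L(1,2)] e
    unfolding xs_def[symmetric] m_def[symmetric]
    by (rule sum_shift_coefficients[OF m, of A "\<lambda>k. \<Sum>t\<in>{p k..<p (Suc k)}. E t" "\<lambda>k. G (xs ! k)"])
  moreover have "(\<Sum>t\<in>{p 0..<p (Suc 0)}. E t) = (\<Sum>t<xs ! 0. E t)"
    using m by (simp add: p_def lessThan_atLeast0)
  moreover have "(\<Sum>t\<in>{p m..<p (Suc m)}. E t) = (\<Sum>t\<in>{xs ! (m - 1)..<h}. E t)"
    using m by (simp add: p_def)
  moreover have "(\<Sum>k=1..m - 1. A k *\<^sub>R ((\<Sum>t\<in>{p k..<p (Suc k)}. E t) + G (xs ! (k - 1)) - G (xs ! k)))
    = (\<Sum>k=1..m - 1. A k *\<^sub>R ((\<Sum>t\<in>{xs ! (k - 1)..<xs ! k}. E t) + G (xs ! (k - 1)) - G (xs ! k)))"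
    by (intro sum.cong) (auto simp: p_def)
  ultimately show ?thesis by simp
qed

lemma sorted_list_first:
  assumes "finite L" "l \<in> L" "\<And>t. t \<in> L \<Longrightarrow> l \<le> t"
  shows "sorted_list_of_set L ! 0 = (l :: nat)"
proof -
  have "Min L = l" using assms by (intro Min_eqI) auto
  moreover have "L \<noteq> {}" using assms(2) by auto
  ultimately show ?thesis using sorted_list_of_set_nonempty[OF assms(1)] by simp
qed

context translation_map
begin

definition evec_at :: "spoint \<Rightarrow> wvec" where
  "evec_at z = evec (sidx z)"

definition fvec_at :: "spoint \<Rightarrow> wvec" where
  "fvec_at z = fvec (disc_ind T (fst z))"

lemma ksum_ksgn:
  assumes z: "sp_in z (0, 1)"
  shows "ksum T (ksgn T z t) = (\<Sum>i<t. evec_at (siter T i z))"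
proof -
  have "real (ksgn T z t s) *\<^sub>R evec s
      = (\<Sum>i<t. of_bool (sp_in (siter T i z) (cell T s)) *\<^sub>R evec s)" for s
  proof -
    have "{i. i < t \<and> sp_in (siter T i z) (cell T s)}
        = {..<t} \<inter> {i. sp_in (siter T i z) (cell T s)}" by auto
    then have "real (ksgn T z t s) = (\<Sum>i<t. of_bool (sp_in (siter T i z) (cell T s)))"
      by (simp add: ksgn_def)
    then show ?thesis by (simp only: scaleR_sum_left)
  qed
  then have "ksum T (ksgn T z t)
      = (\<Sum>s=1..r. \<Sum>i<t. of_bool (sp_in (siter T i z) (cell T s)) *\<^sub>R evec s)"
    by (simp only: ksum_def nint_eq)
  also have "\<dots> = (\<Sum>i<t. \<Sum>s=1..r. of_bool (sp_in (siter T i z) (cell T s)) *\<^sub>R evec s)"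
    by (rule sum.swap)
  also have "\<dots> = (\<Sum>i<t. evec_at (siter T i z))"
  proof (rule sum.cong[OF refl])
    fix i
    note v = siter_valid[OF z, of i]
    have "(\<Sum>s=1..r. of_bool (sp_in (siter T i z) (cell T s)) *\<^sub>R evec s)
        = (\<Sum>s=1..r. if s = sidx (siter T i z) then evec s else 0)"
    proof (rule sum.cong[OF refl])
      fix s assume "s \<in> {1..r}"
      then have "sp_in (siter T i z) (cell T s) \<longleftrightarrow> s = sidx (siter T i z)"
        using sidx(2)[OF v] sidx_eq by metis
      then show "of_bool (sp_in (siter T i z) (cell T s)) *\<^sub>R evec s
          = (if s = sidx (siter T i z) then evec s else 0)" by simp
    qed
    then show "(\<Sum>s=1..r. of_bool (sp_in (siter T i z) (cell T s)) *\<^sub>R evec s)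
        = evec_at (siter T i z)"
      using sidx(1)[OF v] by (simp add: evec_at_def)
  qed
  finally show ?thesis .
qed

lemma ksum_ksgn_shift:
  assumes "sp_in z (0, 1)"
  shows "ksum T (ksgn T (siter T t z) q) = (\<Sum>i\<in>{t..<t + q}. evec_at (siter T i z))"
proof -
  have "ksum T (ksgn T (siter T t z) q) = (\<Sum>i<q. evec_at (siter T (t + i) z))"
    using ksum_ksgn[OF siter_valid[OF assms]] siter_add[OF assms] by simp
  also have "\<dots> = (\<Sum>i\<in>{t..<t + q}. evec_at (siter T i z))"
    by (rule sum.reindex_bij_witness[of _ "\<lambda>i. i - t" "\<lambda>i. t + i"]) auto
  finally show ?thesis .
qed

lemma kgeo_eq_ksgn:
  assumes "x \<in> {0..<1}"
  shows "kgeo T x t = ksgn T (x, Plus) t"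
  using siter_Plus[OF assms] by (simp add: kgeo_def ksgn_def ivl_iff_sp_in fun_eq_iff)

end

text \<open>One corner of a tower, written with the partition points and the index that occur in the
  landing, connection and return vectors.\<close>

locale tower_side = translation_map T r for T r +
  fixes J K :: interval and h :: nat and a :: "nat \<Rightarrow> real" and \<sigma> :: side and j :: nat
  assumes tw: "tower T J K h" and J_attr: "ivl J \<subseteq> attractor T"
    and start: "(a j, \<sigma>) = corner K \<sigma>"
    and lands: "land_times T J (a j, \<sigma>) \<noteq> {}"
begin

abbreviation "z \<equiv> corner K \<sigma>"
abbreviation "L \<equiv> land_times T J (a j, \<sigma>)"
abbreviation "xs \<equiv> sorted_list_of_set L"
abbreviation "m \<equiv> mnum T J a \<sigma> j"

lemma L_eq: "L = {t. t < h \<and> siter T t z \<in> sdiscs T}"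
  unfolding start by (rule tower_land_times[OF tw])

lemma L_props: "finite L" "L \<subseteq> {..<h}" "0 < m" "m = card L"
proof -
  show s: "L \<subseteq> {..<h}" using L_eq by auto
  then show f: "finite L" using finite_subset by blast
  show "0 < m" "m = card L" using f lands by (simp_all add: mnum_def card_gt_0_iff)
qed

lemma z_valid: "sp_in z (0, 1)"
  by (rule tower_corner_valid[OF tw J_attr])

lemma nth_L: assumes "k < m" shows "xs ! k \<in> L"
  using nth_mem[of k xs] assms L_props by simp

lemma sdisc_at_eq: "sdisc_at T J a \<sigma> j k = siter T (xs ! (k - 1)) z"
  by (simp add: sdisc_at_def start)

lemma Cvec_eq:
  assumes k: "1 \<le> k" "k < m"
  shows "Cvec T J a \<sigma> j k = (\<Sum>t\<in>{xs ! (k - 1)..<xs ! k}. evec_at (siter T t z))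
    + fvec_at (siter T (xs ! (k - 1)) z) - fvec_at (siter T (xs ! k) z)"
proof -
  let ?b = "siter T (xs ! (k - 1)) z" and ?b' = "siter T (xs ! k) z"
  have lt: "xs ! (k - 1) < xs ! k" using sorted_list_less[of "k - 1" k L] k L_props by simp
  have "(LEAST q. 0 < q \<and> siter T q ?b = ?b') = xs ! k - xs ! (k - 1)"
  proof (rule Least_equality)
    show "0 < xs ! k - xs ! (k - 1) \<and> siter T (xs ! k - xs ! (k - 1)) ?b = ?b'"
      using lt by (simp add: siter_add[OF z_valid])
    fix q assume q: "0 < q \<and> siter T q ?b = ?b'"
    show "xs ! k - xs ! (k - 1) \<le> q"
    proof (rule ccontr)
      assume "\<not> ?thesis"
      then have l: "xs ! (k - 1) + q < xs ! k" by simp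
      have "siter T (xs ! (k - 1) + q) z = ?b'" using q by (simp add: siter_add[OF z_valid])
      then have "xs ! (k - 1) + q \<in> L" using nth_L[OF k(2)] l by (auto simp: L_eq)
      then have "xs ! (k - 1) + q \<in> set xs" using L_props(1) by simp
      then obtain i where i: "i < m" "xs ! i = xs ! (k - 1) + q"
        using L_props(4) by (auto simp: in_set_conv_nth)
      have "i \<noteq> k - 1" using i(2) q by auto
      moreover have "k - 1 < card L" using k L_props(4) by simp
      then have "\<not> i < k - 1" using sorted_list_less[of i "k - 1" L] i(2) by auto
      ultimately have "k \<le> i" using k by simp
      then have "xs ! k \<le> xs ! i" using sorted_list_mono[of k i L] i L_props(4) by simp
      then show False using l i(2) by simp
    qed
  qed
  then show ?thesis
    using ksum_ksgn_shift[OF z_valid, of "xs ! (k - 1)" "xs ! k - xs ! (k - 1)"] lt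
    by (simp add: Cvec_def sdisc_at_eq fvec_at_def Let_def)
qed

lemma Rvec_eq:
  "Rvec T J a \<sigma> j = (\<Sum>t\<in>{xs ! (m - 1)..<h}. evec_at (siter T t z)) + fvec_at (siter T (xs ! (m - 1)) z)"
proof -
  let ?b = "siter T (xs ! (m - 1)) z"
  have lt: "xs ! (m - 1) < h" using nth_L[of "m - 1"] L_props(2,3) by auto
  have "(LEAST q. 0 < q \<and> sp_in (siter T q ?b) J) = h - xs ! (m - 1)"
  proof (rule Least_equality)
    show "0 < h - xs ! (m - 1) \<and> sp_in (siter T (h - xs ! (m - 1)) ?b) J"
      using lt tower_return(1)[OF tw, of \<sigma>] by (simp add: siter_add[OF z_valid])
    fix q assume q: "0 < q \<and> sp_in (siter T q ?b) J"
    then have "sp_in (siter T (xs ! (m - 1) + q) z) J" by (simp add: siter_add[OF z_valid])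
    then show "h - xs ! (m - 1) \<le> q"
      using tower_return(2)[OF tw, of "xs ! (m - 1) + q" \<sigma>] q by linarith
  qed
  then show ?thesis
    using ksum_ksgn_shift[OF z_valid, of "xs ! (m - 1)" "h - xs ! (m - 1)"] lt
    by (simp add: Rvec_def sdisc_at_eq fvec_at_def Let_def)
qed

lemma first_landing: "(LEAST t. fst (siter T t z) = fst (siter T (xs ! 0) z)) = xs ! 0"
proof (rule Least_equality)
  fix t assume t: "fst (siter T t z) = fst (siter T (xs ! 0) z)"
  show "xs ! 0 \<le> t"
  proof (rule ccontr)
    assume l: "\<not> xs ! 0 \<le> t"
    have x0: "xs ! 0 \<in> L" using nth_L L_props(3) by simp
    then have "siter T t z \<in> sdiscs T" using t by (auto simp: L_eq sdiscs_def mem_Times_iff)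
    then have "t \<in> L" using x0 l by (auto simp: L_eq)
    then have "t \<in> set xs" using L_props(1) by simp
    then obtain i where "i < m" "xs ! i = t" using L_props(4) by (auto simp: in_set_conv_nth)
    then show False using sorted_list_mono[of 0 i L] l L_props(4) by auto
  qed
qed simp

lemma Lvec_eq:
  assumes N: "if \<sigma> = Plus then j < N else j = N \<and> 0 < N"
  shows "Lvec T J N a j = (\<Sum>t<xs ! 0. evec_at (siter T t z)) - fvec_at (siter T (xs ! 0) z)"
proof -
  have d: "disc_at T J N a j = fst (siter T (xs ! 0) z)"
    using N sdisc_at_eq[of 1] by (cases \<sigma>) (auto simp: disc_at_def)
  have first: "(LEAST t. fst (siter T t (a j, \<sigma>)) = disc_at T J N a j) = xs ! 0"
    using first_landing unfolding d start by simp
  have "(if j = 0 then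
          ksgn T (a j, Plus) (LEAST t. fst (siter T t (a j, Plus)) = disc_at T J N a j)
        else if j = N then
          ksgn T (a j, Minus) (LEAST t. fst (siter T t (a j, Minus)) = disc_at T J N a j)
        else
          kgeo T (a j) (LEAST t. (itm_map T ^^ t) (a j) = disc_at T J N a j))
      = ksgn T z (xs ! 0)"
  proof (cases \<sigma>)
    case Minus
    then show ?thesis using N first start by auto
  next
    case Plus
    have x: "a j \<in> {0..<1}" using z_valid start Plus by auto
    have "(LEAST t. (itm_map T ^^ t) (a j) = disc_at T J N a j) = xs ! 0"
      using first Plus siter_Plus[OF x] by simp
    then show ?thesis using N first start Plus kgeo_eq_ksgn[OF x] by auto
  qed
  then show ?thesis unfolding Lvec_def using ksum_ksgn[OF z_valid] d by (simp add: fvec_at_def)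
qed

lemma side_combination:
  fixes A :: "nat \<Rightarrow> real"
  shows "A 0 *\<^sub>R ((\<Sum>t<xs ! 0. evec_at (siter T t z)) - fvec_at (siter T (xs ! 0) z))
      + (\<Sum>k=1..m - 1. A k *\<^sub>R Cvec T J a \<sigma> j k) + A m *\<^sub>R Rvec T J a \<sigma> j
    = (\<Sum>t<h. A (card {l \<in> L. l < Suc t}) *\<^sub>R evec_at (siter T t z)
        + (A (card {l \<in> L. l < Suc t}) - A (card {l \<in> L. l < t})) *\<^sub>R fvec_at (siter T t z))"
proof -
  have "(\<Sum>k=1..m - 1. A k *\<^sub>R Cvec T J a \<sigma> j k)
      = (\<Sum>k=1..m - 1. A k *\<^sub>R ((\<Sum>t\<in>{xs ! (k - 1)..<xs ! k}. evec_at (siter T t z))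
          + fvec_at (siter T (xs ! (k - 1)) z) - fvec_at (siter T (xs ! k) z)))"
    using L_props(3) by (intro sum.cong) (auto simp: Cvec_eq)
  then show ?thesis
    unfolding Rvec_eq
    using sum_over_landmarks[OF L_props(1,2) lands, of A "\<lambda>t. evec_at (siter T t z)" "\<lambda>t. fvec_at (siter T t z)"]
    by (simp only: L_props(4)[symmetric])
qed

end

section \<open>The towers over all intervals of the family\<close>

lemma lookup_scaleR: "Poly_Mapping.lookup (c *\<^sub>R x) i = c *\<^sub>R Poly_Mapping.lookup x i"
proof -
  have "finite {i. c *\<^sub>R Poly_Mapping.lookup x i \<noteq> 0}"
    by (rule finite_subset[OF _ finite_lookup[of x]]) auto
  then show ?thesis by (simp add: scaleR_poly_mapping_def)
qed

definition ecoef :: "nat \<Rightarrow> wvec \<Rightarrow> real" where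
  "ecoef s v = Poly_Mapping.lookup (fst v) s"

definition fcoef :: "nat \<Rightarrow> wvec \<Rightarrow> real" where
  "fcoef s v = Poly_Mapping.lookup (snd v) s"

lemma linear_ecoef: "linear (ecoef s)" and linear_fcoef: "linear (fcoef s)"
  by (auto intro!: linearI simp: ecoef_def fcoef_def lookup_add lookup_scaleR)

lemma coef_basis [simp]:
  "ecoef s (evec s') = of_bool (s = s')" "ecoef s (fvec s') = 0"
  "fcoef s (evec s') = 0" "fcoef s (fvec s') = of_bool (s = s')"
  by (auto simp: ecoef_def fcoef_def evec_def fvec_def lookup_single when_def)

context translation_map
begin

lemma tower_height_unique:
  assumes "tower T J K h" "tower T J K h'"
  shows "h = h'"
proof -
  have False if t: "tower T J K h" "tower T J K h'" and "h < h'" for h h'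
  proof -
    have "(itm_map T ^^ h) ` ivl K \<subseteq> ivl J" "(itm_map T ^^ h) ` ivl K \<inter> ivl J = {}"
      using t \<open>h < h'\<close> by (auto simp: tower_def)
    moreover have "fst K \<in> ivl K" using t(1) by (simp add: tower_def ivl_def)
    ultimately show False by blast
  qed
  then show ?thesis using assms by (cases h h' rule: linorder_cases) auto
qed

text \<open>Applied to the relation, this functional gives the balance of the coordinates \<open>f\<close>
  against an arbitrary test function on the discontinuities.\<close>

definition linear_on_discs :: "(real \<Rightarrow> real) \<Rightarrow> wvec \<Rightarrow> real" where
  "linear_on_discs \<psi> v = (\<Sum>s=1..r - 1. \<psi> (bet T s) * fcoef s v)"

lemma linear_linear_on_discs: "linear (linear_on_discs \<psi>)"
  by (rule linearI) (simp_all add: linear_on_discs_def linear_add[OF linear_fcoef]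
      linear_scale[OF linear_fcoef] distrib_left sum.distrib sum_distrib_left mult.left_commute)

lemma linear_on_discs_at:
  "linear_on_discs \<psi> (evec_at z) = 0"
  "z \<in> sdiscs T \<Longrightarrow> linear_on_discs \<psi> (fvec_at z) = \<psi> (fst z)"
proof -
  show "linear_on_discs \<psi> (evec_at z) = 0" by (simp add: linear_on_discs_def evec_at_def)
  assume "z \<in> sdiscs T"
  then have "fst z \<in> discs T" by (auto simp: sdiscs_def)
  then have d: "disc_ind T (fst z) \<in> {1..r - 1}" "bet T (disc_ind T (fst z)) = fst z"
    by (rule disc_ind)+
  have "linear_on_discs \<psi> (fvec_at z)
      = (\<Sum>s=1..r - 1. if s = disc_ind T (fst z) then \<psi> (bet T s) else 0)"
    unfolding linear_on_discs_def fvec_at_def by (intro sum.cong) auto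
  then show "linear_on_discs \<psi> (fvec_at z) = \<psi> (fst z)" using d by simp
qed

lemma ecoef_at:
  assumes "sp_in z (0, 1)" "s \<in> {1..r}"
  shows "ecoef s (evec_at z) = of_bool (sp_in z (cell T s))" "ecoef s (fvec_at z) = 0"
proof -
  have "s = sidx z \<longleftrightarrow> sp_in z (cell T s)" using sidx(2)[OF assms(1)] sidx_eq[OF assms(2)] by metis
  then show "ecoef s (evec_at z) = of_bool (sp_in z (cell T s))" "ecoef s (fvec_at z) = 0"
    by (simp_all add: evec_at_def fvec_at_def)
qed

lemma Cdisc_eq:
  assumes "b \<in> sdiscs_notX T"
  shows "Cdisc T b = (\<Sum>t<landing_time T b. evec_at (siter T t b)) + fvec_at b
    - fvec_at (siter T (landing_time T b) b)"
  using ksum_ksgn[OF sdiscs_notX_valid[OF assms]]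
  by (simp add: Cdisc_def fvec_at_def landing_time_def Let_def)

end

text \<open>The tower over \<open>[a j, a (Suc j))\<close> has the index \<open>j\<close>; its right
  corner therefore sits at the partition point with the index \<open>Suc j\<close>.\<close>

fun endpoint :: "side \<Rightarrow> nat \<Rightarrow> nat" where
  "endpoint Plus j = j"
| "endpoint Minus j = Suc j"

locale tower_family = translation_map T r for T r +
  fixes n :: nat and J :: "nat \<Rightarrow> interval" and N :: "nat \<Rightarrow> nat" and a :: "nat \<Rightarrow> nat \<Rightarrow> real"
  assumes J_attractor: "i \<le> n \<Longrightarrow> ivl (J i) \<subseteq> attractor T"
    and orbits_disjoint: "i \<le> n \<Longrightarrow> i' \<le> n \<Longrightarrow> i \<noteq> i' \<Longrightarrow>
      orbit T (ivl (J i)) \<inter> orbit T (ivl (J i')) = {}"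
    and component: "interval_component T (J 0)"
    and maximal_periodic: "i \<in> {1..n} \<Longrightarrow> maximal_periodic_ivl T (J i)"
    and partition: "i \<le> n \<Longrightarrow> return_partition T (J i) (N i) (a i)"
    and left_lands: "land_times T (J 0) (fst (J 0), Plus) \<noteq> {}"
    and right_lands: "land_times T (J 0) (snd (J 0), Minus) \<noteq> {}"
    and periodic_lands: "i \<in> {1..n} \<Longrightarrow>
      (\<exists>t. siter T t (fst (J i), Plus) \<in> sdiscs T) \<and> (\<exists>t. siter T t (snd (J i), Minus) \<in> sdiscs T)"
begin

definition Q :: "(nat \<times> nat) set" where
  "Q = (SIGMA i:{..n}. {..<N i})"

definition base :: "nat \<times> nat \<Rightarrow> interval" where
  "base q = (a (fst q) (snd q), a (fst q) (Suc (snd q)))"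

definition height :: "nat \<times> nat \<Rightarrow> nat" where
  "height q = (SOME h. tower T (J (fst q)) (base q) h)"

definition landings :: "nat \<times> nat \<Rightarrow> side \<Rightarrow> nat set" where
  "landings q \<sigma> = land_times T (J (fst q)) (a (fst q) (endpoint \<sigma> (snd q)), \<sigma>)"

lemma corner_base: "corner (base q) \<sigma> = (a (fst q) (endpoint \<sigma> (snd q)), \<sigma>)"
  by (cases \<sigma>) (simp_all add: base_def)

lemma J0: "absorbing T (J 0)" "fst (J 0) < snd (J 0)" "ivl (J 0) \<subseteq> attractor T"
  using interval_component_absorbing[OF component] component J_attractor[of 0]
  by (auto simp: interval_component_def)

lemma ends: "i \<le> n \<Longrightarrow> a i 0 = fst (J i)" "i \<le> n \<Longrightarrow> a i (N i) = snd (J i)"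
  using partition by (auto simp: return_partition_def)

lemma N0_pos: "0 < N 0"
  using ends[of 0] J0(2) by (cases "N 0") auto

lemma periodic_piece:
  assumes "i \<in> {1..n}"
  shows "N i = 1" "base (i, 0) = J i"
proof -
  have per: "periodic_ivl T (J i)" using maximal_periodic[OF assms] by (simp add: maximal_periodic_ivl_def)
  show N: "N i = 1"
    using assms by (intro partition_unbroken_single[OF partition periodic_unbroken[OF per]]) auto
  then show "base (i, 0) = J i" using ends[of i] assms by (simp add: base_def prod_eq_iff)
qed

lemma Q_cases:
  assumes "q \<in> Q"
  obtains (component) j where "q = (0, j)" "j < N 0"
    | (periodic) i where "q = (i, 0)" "i \<in> {1..n}"
proof -
  obtain i j where q: "q = (i, j)" "i \<le> n" "j < N i" using assms by (auto simp: Q_def)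
  show ?thesis
  proof (cases "i = 0")
    case True
    then show ?thesis using q that(1) by simp
  next
    case False
    then have "i \<in> {1..n}" using q by auto
    then show ?thesis using q that(2) periodic_piece(1)[of i] by simp
  qed
qed

lemma tower_base:
  assumes q: "q \<in> Q"
  shows "tower T (J (fst q)) (base q) (height q)"
proof -
  have "\<exists>h. tower T (J (fst q)) (base q) h"
    using q
  proof (cases rule: Q_cases)
    case (component j)
    then show ?thesis
      using tower_exists[OF J0(1,3) partition_piece(1)[OF partition[of 0]], of j]
      by (simp add: base_def)
  next
    case (periodic i)
    then show ?thesis
      using periodic_tower[OF maximal_periodic[of i]] periodic_piece(2)[of i] by auto
  qed
  then show ?thesis unfolding height_def by (rule someI_ex)
qed

lemma periodic_returns:
  assumes i: "i \<in> {1..n}"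
  shows "siter T (height (i, 0)) (corner (base (i, 0)) \<sigma>) = corner (base (i, 0)) \<sigma>"
proof -
  have "(i, 0) \<in> Q" using i periodic_piece[OF i] by (simp add: Q_def)
  then have tw: "tower T (J i) (J i) (height (i, 0))"
    using tower_base[of "(i, 0)"] periodic_piece[OF i] by simp
  obtain h where h: "tower T (J i) (J i) h" "\<forall>x\<in>ivl (J i). (itm_map T ^^ h) x = x"
    using periodic_tower[OF maximal_periodic[OF i]] by blast
  have hh: "height (i, 0) = h" by (rule tower_height_unique[OF tw h(1)])
  have "fst (J i) < snd (J i)" "rigid T (J i) h" using h(1) by (auto simp: tower_def)
  moreover from this have "(itm_map T ^^ h) (fst (J i)) = fst (J i)" using h(2) by (simp add: ivl_def)
  ultimately show ?thesis
    using siter_corner[of "J i" h] unfolding hh periodic_piece(2)[OF i] by (cases \<sigma>) simp_all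
qed

lemma landings_eq:
  assumes "q \<in> Q"
  shows "landings q \<sigma> = {t. t < height q \<and> siter T t (corner (base q) \<sigma>) \<in> sdiscs T}"
  unfolding landings_def corner_base[symmetric] by (rule tower_land_times[OF tower_base[OF assms]])

lemma division_point:
  assumes j: "0 < j" "j < N 0"
  obtains l where "l \<in> landings (0, j) Plus" "l \<in> landings (0, j - 1) Minus"
    "\<And>t. t \<in> landings (0, j) Plus \<Longrightarrow> l \<le> t" "\<And>t. t \<in> landings (0, j - 1) Minus \<Longrightarrow> l \<le> t"
    "fst (siter T l (corner (base (0, j)) Plus)) = fst (siter T l (corner (base (0, j - 1)) Minus))"
proof -
  have q: "(0, j) \<in> Q" "(0, j - 1) \<in> Q" using j by (auto simp: Q_def)
  have tw: "tower T (J 0) (a 0 (j - 1), a 0 j) (height (0, j - 1))"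
    "tower T (J 0) (a 0 j, a 0 (Suc j)) (height (0, j))"
    using tower_base[OF q(2)] tower_base[OF q(1)] j by (simp_all add: base_def)
  obtain l where l: "l < height (0, j - 1)" "l < height (0, j)" "(itm_map T ^^ l) (a 0 j) \<in> discs T"
    "\<And>t. t < l \<Longrightarrow> (itm_map T ^^ t) (a 0 j) \<notin> discs T"
    "\<And>t. t \<le> l \<Longrightarrow> siter T t (a 0 j, Plus) = ((itm_map T ^^ t) (a 0 j), Plus)"
    "\<And>t. t \<le> l \<Longrightarrow> siter T t (a 0 j, Minus) = ((itm_map T ^^ t) (a 0 j), Minus)"
    using division_point_landing[OF J0 partition[of 0] j tw] by blast
  have c: "corner (base (0, j)) Plus = (a 0 j, Plus)" "corner (base (0, j - 1)) Minus = (a 0 j, Minus)"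
    using j by (simp_all add: base_def)
  have "t \<in> landings (0, j) Plus \<Longrightarrow> l \<le> t" "t \<in> landings (0, j - 1) Minus \<Longrightarrow> l \<le> t" for t
    unfolding landings_eq[OF q(1)] landings_eq[OF q(2)] c
    using l(4)[of t] l(5)[of t] l(6)[of t] by (force simp: sdiscs_def not_less[symmetric])+
  moreover have "l \<in> landings (0, j) Plus" "l \<in> landings (0, j - 1) Minus"
    unfolding landings_eq[OF q(1)] landings_eq[OF q(2)] c
    using l(1-3) l(5)[of l] l(6)[of l] by (simp_all add: sdiscs_def)
  ultimately show ?thesis using that l(5)[of l] l(6)[of l] c by simp
qed

text \<open>The ends of the component land by assumption and its inner division points because they
  separate two pieces. The orbit of an end of a periodic interval is a cycle, so its landing can
  be shifted into the first period.\<close>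

lemma landings_nonempty:
  assumes q: "q \<in> Q"
  shows "landings q \<sigma> \<noteq> {}"
  using q
proof (cases rule: Q_cases)
  case (component j)
  show ?thesis
  proof (cases \<sigma>)
    case Plus
    show ?thesis
    proof (cases "j = 0")
      case True
      then show ?thesis using left_lands ends(1)[of 0] component Plus by (simp add: landings_def)
    next
      case False
      then have "0 < j" by simp
      then obtain l where "l \<in> landings (0, j) Plus"
        using component(2) by (rule division_point) (rule that)
      then show ?thesis using component(1) Plus by blast
    qed
  next
    case Minus
    show ?thesis
    proof (cases "Suc j = N 0")
      case True
      then show ?thesis using right_lands ends(2)[of 0] component Minus by (simp add: landings_def)
    next
      case False
      then have "Suc j < N 0" using component(2) by simp
      then obtain l where "l \<in> landings (0, Suc j - 1) Minus"
        by (rule division_point[OF zero_less_Suc]) (rule that)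
      then show ?thesis using component(1) Minus by auto
    qed
  qed
next
  case (periodic i)
  let ?z = "corner (base q) \<sigma>" and ?h = "height q"
  note tw = tower_base[OF q]
  have z: "sp_in ?z (0, 1)"
    using tower_corner_valid[OF tw] J_attractor periodic by simp
  have "\<exists>t. siter T t ?z \<in> sdiscs T"
    using periodic_lands[OF periodic(2)] periodic_piece(2)[OF periodic(2)] periodic(1)
    by (cases \<sigma>) auto
  then obtain t where "siter T t ?z \<in> sdiscs T" by blast
  moreover have "siter T (t mod ?h) ?z = siter T t ?z"
    using periodic_returns[OF periodic(2), of \<sigma>] periodic(1) z
    by (simp add: siter_eq_sstep funpow_mod_eq)
  moreover have "t mod ?h < ?h" using tw by (simp add: tower_def)
  ultimately have "t mod ?h \<in> landings q \<sigma>" by (simp add: landings_eq[OF q])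
  then show ?thesis by blast
qed

lemma side:
  assumes q: "q \<in> Q"
  shows "tower_side T r (J (fst q)) (base q) (height q) (a (fst q)) \<sigma> (endpoint \<sigma> (snd q))"
proof
  show "tower T (J (fst q)) (base q) (height q)" by (rule tower_base[OF q])
  show "ivl (J (fst q)) \<subseteq> attractor T" using q by (intro J_attractor) (auto simp: Q_def)
  show "(a (fst q) (endpoint \<sigma> (snd q)), \<sigma>) = corner (base q) \<sigma>" by (simp add: corner_base)
  show "land_times T (J (fst q)) (a (fst q) (endpoint \<sigma> (snd q)), \<sigma>) \<noteq> {}"
    using landings_nonempty[OF q] by (simp add: landings_def)
qed

lemma towers_disjoint:
  assumes q: "q \<in> Q" "q' \<in> Q" and t: "t < height q" "t' < height q'"
    and x: "x \<in> ivl (base q)" "x' \<in> ivl (base q')" and eq: "(itm_map T ^^ t) x = (itm_map T ^^ t') x'"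
  shows "q = q' \<and> t = t'"
proof -
  obtain i j i' j' where ij: "q = (i, j)" "i \<le> n" "j < N i" "q' = (i', j')" "i' \<le> n" "j' < N i'"
    using q by (auto simp: Q_def)
  note tw = tower_base[OF q(1)] tower_base[OF q(2)]
  have "x \<in> ivl (J i)" "x' \<in> ivl (J i')" using tw x ij by (auto simp: tower_def)
  then have "(itm_map T ^^ t) x \<in> (itm_map T ^^ t) ` ivl (J i)"
    "(itm_map T ^^ t) x \<in> (itm_map T ^^ t') ` ivl (J i')" using eq by (metis imageI)+
  then have "(itm_map T ^^ t) x \<in> orbit T (ivl (J i))" "(itm_map T ^^ t) x \<in> orbit T (ivl (J i'))"
    unfolding orbit_def by blast+
  then have i: "i = i'" using orbits_disjoint[of i i'] ij by auto
  then have tx: "t = t' \<and> x = x'"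
    using tower_disjoint[OF _ _ J_attractor[OF ij(2)] t x eq] tw ij by simp
  have "\<not> j < j'"
  proof
    assume "j < j'"
    then have "a i (Suc j) \<le> a i j'"
      using partition_increasing[OF partition[OF ij(2)], of "Suc j" j'] ij i
      by (cases "Suc j = j'") auto
    then show False using x tx ij i by (auto simp: base_def ivl_def)
  qed
  moreover have "\<not> j' < j"
  proof
    assume "j' < j"
    then have "a i (Suc j') \<le> a i j"
      using partition_increasing[OF partition[OF ij(2)], of "Suc j'" j] ij i
      by (cases "Suc j' = j") auto
    then show False using x tx ij i by (auto simp: base_def ivl_def)
  qed
  ultimately show ?thesis using tx i ij by simp
qed

end

section \<open>A linear relation as a charge on the towers\<close>

locale vector_relation = tower_family T r n J N a for T r n J N a +
  fixes \<alpha>L \<alpha>Rp \<alpha>Rm :: "nat \<Rightarrow> real" and \<alpha>p \<alpha>m :: "nat \<Rightarrow> nat \<Rightarrow> nat \<Rightarrow> real" and \<alpha>X :: "spoint \<Rightarrow> real"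
  assumes relation: "(\<Sum>i=1..n. \<Sum>k=1..mnum T (J i) (a i) Plus 0.
            \<alpha>p i 0 k *\<^sub>R Cper T (J i) (N i) (a i) Plus 0 k)
       + (\<Sum>i=1..n. \<Sum>k=1..mnum T (J i) (a i) Minus 1.
            \<alpha>m i 1 k *\<^sub>R Cper T (J i) (N i) (a i) Minus 1 k)
       + (\<Sum>j\<in>{0..<N 0}.
            (\<Sum>k=1..mnum T (J 0) (a 0) Plus j - 1. \<alpha>p 0 j k *\<^sub>R Cvec T (J 0) (a 0) Plus j k)
            + \<alpha>Rp j *\<^sub>R Rvec T (J 0) (a 0) Plus j)
       + (\<Sum>j=1..N 0.
            (\<Sum>k=1..mnum T (J 0) (a 0) Minus j - 1. \<alpha>m 0 j k *\<^sub>R Cvec T (J 0) (a 0) Minus j k)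
            + \<alpha>Rm j *\<^sub>R Rvec T (J 0) (a 0) Minus j)
       + (\<Sum>j=0..N 0. \<alpha>L j *\<^sub>R Lvec T (J 0) (N 0) (a 0) j)
       + (\<Sum>b\<in>sdiscs_notX T. \<alpha>X b *\<^sub>R Cdisc T b) = 0"
begin

abbreviation m :: "nat \<times> nat \<Rightarrow> side \<Rightarrow> nat" where
  "m q \<sigma> \<equiv> mnum T (J (fst q)) (a (fst q)) \<sigma> (endpoint \<sigma> (snd q))"

text \<open>The index \<open>k\<close> is the number of landings so far, so 0 stands for the part before
  the first landing, which is described by a first landing vector. Over a periodic interval this
  vector occurs only as a summand of the last connection vector and has the coefficient of the
  latter. At an inner division point of \<open>J 0\<close> the two corners share one first
  landing vector; it is assigned to the tower on the right, and the one on the left gets 0.\<close>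

fun coefficient :: "nat \<times> nat \<Rightarrow> side \<Rightarrow> nat \<Rightarrow> real" where
  "coefficient (i, j) Plus k =
     (if 0 < i then \<alpha>p i 0 (if k = 0 then m (i, j) Plus else k)
      else if k = 0 then \<alpha>L j else if k = m (i, j) Plus then \<alpha>Rp j else \<alpha>p 0 j k)"
| "coefficient (i, j) Minus k =
     (if 0 < i then \<alpha>m i 1 (if k = 0 then m (i, j) Minus else k)
      else if k = 0 then (if Suc j = N 0 then \<alpha>L (Suc j) else 0)
      else if k = m (i, j) Minus then \<alpha>Rm (Suc j) else \<alpha>m 0 (Suc j) k)"

definition W :: "nat \<times> nat \<Rightarrow> side \<Rightarrow> nat \<Rightarrow> real" where
  "W q \<sigma> t = coefficient q \<sigma> (card {l \<in> landings q \<sigma>. l < t})"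

abbreviation visit :: "nat \<times> nat \<Rightarrow> side \<Rightarrow> nat \<Rightarrow> spoint" where
  "visit q \<sigma> t \<equiv> siter T t (corner (base q) \<sigma>)"

abbreviation landing :: "nat \<times> nat \<Rightarrow> side \<Rightarrow> nat \<Rightarrow> nat" where
  "landing q \<sigma> k \<equiv> sorted_list_of_set (landings q \<sigma>) ! k"

definition side_sum :: "nat \<times> nat \<Rightarrow> side \<Rightarrow> wvec" where
  "side_sum q \<sigma> = (\<Sum>t<height q. W q \<sigma> (Suc t) *\<^sub>R evec_at (visit q \<sigma> t)
     + (W q \<sigma> (Suc t) - W q \<sigma> t) *\<^sub>R fvec_at (visit q \<sigma> t))"

lemma m_eq: assumes "q \<in> Q" shows "m q \<sigma> = card (landings q \<sigma>)" "0 < m q \<sigma>"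
  "finite (landings q \<sigma>)" "landings q \<sigma> \<subseteq> {..<height q}"
  using tower_side.L_props[OF side[OF assms]] by (simp_all add: landings_def)

lemma side_sum_eq:
  assumes q: "q \<in> Q"
  shows "side_sum q \<sigma> = coefficient q \<sigma> 0 *\<^sub>R
        ((\<Sum>t<landing q \<sigma> 0. evec_at (visit q \<sigma> t)) - fvec_at (visit q \<sigma> (landing q \<sigma> 0)))
      + (\<Sum>k=1..m q \<sigma> - 1. coefficient q \<sigma> k *\<^sub>R
          Cvec T (J (fst q)) (a (fst q)) \<sigma> (endpoint \<sigma> (snd q)) k)
      + coefficient q \<sigma> (m q \<sigma>) *\<^sub>R Rvec T (J (fst q)) (a (fst q)) \<sigma> (endpoint \<sigma> (snd q))"
  using tower_side.side_combination[OF side[OF q], of "coefficient q \<sigma>"]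
  by (simp only: side_sum_def W_def landings_def)

lemma Lvec_base:
  assumes q: "q \<in> Q" and \<sigma>: "\<sigma> = Plus \<or> Suc (snd q) = N (fst q)"
  shows "(\<Sum>t<landing q \<sigma> 0. evec_at (visit q \<sigma> t)) - fvec_at (visit q \<sigma> (landing q \<sigma> 0))
    = Lvec T (J (fst q)) (N (fst q)) (a (fst q)) (endpoint \<sigma> (snd q))"
proof -
  have "if \<sigma> = Plus then endpoint \<sigma> (snd q) < N (fst q)
      else endpoint \<sigma> (snd q) = N (fst q) \<and> 0 < N (fst q)"
    using q \<sigma> by (cases \<sigma>) (auto simp: Q_def)
  then show ?thesis
    using tower_side.Lvec_eq[OF side[OF q], of \<sigma> "N (fst q)"] by (simp only: landings_def)
qed

lemma side_sum_component:
  assumes j: "j < N 0"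
  shows "side_sum (0, j) Plus = \<alpha>L j *\<^sub>R Lvec T (J 0) (N 0) (a 0) j
      + ((\<Sum>k=1..mnum T (J 0) (a 0) Plus j - 1. \<alpha>p 0 j k *\<^sub>R Cvec T (J 0) (a 0) Plus j k)
        + \<alpha>Rp j *\<^sub>R Rvec T (J 0) (a 0) Plus j)"
    "side_sum (0, j) Minus = (if Suc j = N 0 then \<alpha>L (N 0) *\<^sub>R Lvec T (J 0) (N 0) (a 0) (N 0) else 0)
      + ((\<Sum>k=1..mnum T (J 0) (a 0) Minus (Suc j) - 1.
            \<alpha>m 0 (Suc j) k *\<^sub>R Cvec T (J 0) (a 0) Minus (Suc j) k)
        + \<alpha>Rm (Suc j) *\<^sub>R Rvec T (J 0) (a 0) Minus (Suc j))"
proof -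
  have q: "(0, j) \<in> Q" using j by (simp add: Q_def)
  have "(\<Sum>k=1..m (0, j) Plus - 1. coefficient (0, j) Plus k *\<^sub>R Cvec T (J 0) (a 0) Plus j k)
      = (\<Sum>k=1..mnum T (J 0) (a 0) Plus j - 1. \<alpha>p 0 j k *\<^sub>R Cvec T (J 0) (a 0) Plus j k)"
    by (intro sum.cong) auto
  then show "side_sum (0, j) Plus = \<alpha>L j *\<^sub>R Lvec T (J 0) (N 0) (a 0) j
      + ((\<Sum>k=1..mnum T (J 0) (a 0) Plus j - 1. \<alpha>p 0 j k *\<^sub>R Cvec T (J 0) (a 0) Plus j k)
        + \<alpha>Rp j *\<^sub>R Rvec T (J 0) (a 0) Plus j)"
    using side_sum_eq[OF q, of Plus] Lvec_base[OF q, of Plus] m_eq(2)[OF q, of Plus] by simp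
  have "(\<Sum>k=1..m (0, j) Minus - 1. coefficient (0, j) Minus k *\<^sub>R Cvec T (J 0) (a 0) Minus (Suc j) k)
      = (\<Sum>k=1..mnum T (J 0) (a 0) Minus (Suc j) - 1.
          \<alpha>m 0 (Suc j) k *\<^sub>R Cvec T (J 0) (a 0) Minus (Suc j) k)"
    by (intro sum.cong) auto
  then show "side_sum (0, j) Minus = (if Suc j = N 0 then \<alpha>L (N 0) *\<^sub>R Lvec T (J 0) (N 0) (a 0) (N 0) else 0)
      + ((\<Sum>k=1..mnum T (J 0) (a 0) Minus (Suc j) - 1.
            \<alpha>m 0 (Suc j) k *\<^sub>R Cvec T (J 0) (a 0) Minus (Suc j) k)
        + \<alpha>Rm (Suc j) *\<^sub>R Rvec T (J 0) (a 0) Minus (Suc j))"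
    using side_sum_eq[OF q, of Minus] Lvec_base[OF q, of Minus] m_eq(2)[OF q, of Minus]
    by (cases "Suc j = N 0") simp_all
qed

lemma Cper_sum:
  assumes "0 < M" "M = mnum T K b \<sigma> j"
  shows "(\<Sum>k=1..M. c k *\<^sub>R Cper T K M' b \<sigma> j k)
    = c M *\<^sub>R Lvec T K M' b j + (\<Sum>k=1..M - 1. c k *\<^sub>R Cvec T K b \<sigma> j k) + c M *\<^sub>R Rvec T K b \<sigma> j"
proof -
  obtain M0 where M0: "M = Suc M0" using assms(1) by (cases M) auto
  have "(\<Sum>k=1..M0. c k *\<^sub>R Cper T K M' b \<sigma> j k) = (\<Sum>k=1..M0. c k *\<^sub>R Cvec T K b \<sigma> j k)"
    using assms(2) M0 by (intro sum.cong) (auto simp: Cper_def)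
  moreover have "(\<Sum>k=1..M. c k *\<^sub>R Cper T K M' b \<sigma> j k)
      = (\<Sum>k=1..M0. c k *\<^sub>R Cper T K M' b \<sigma> j k) + c M *\<^sub>R Cper T K M' b \<sigma> j M"
    unfolding M0 by simp
  moreover have "Cper T K M' b \<sigma> j M = Rvec T K b \<sigma> j + Lvec T K M' b j"
    using assms(2) by (simp add: Cper_def)
  moreover have "M - 1 = M0" using M0 by simp
  ultimately show ?thesis by (simp add: scaleR_add_right)
qed

lemma side_sum_periodic:
  assumes i: "i \<in> {1..n}"
  shows "side_sum (i, 0) Plus = (\<Sum>k=1..mnum T (J i) (a i) Plus 0.
            \<alpha>p i 0 k *\<^sub>R Cper T (J i) (N i) (a i) Plus 0 k)"
    "side_sum (i, 0) Minus = (\<Sum>k=1..mnum T (J i) (a i) Minus 1.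
            \<alpha>m i 1 k *\<^sub>R Cper T (J i) (N i) (a i) Minus 1 k)"
proof -
  have q: "(i, 0) \<in> Q" using i periodic_piece[OF i] by (simp add: Q_def)
  have "(\<Sum>k=1..m (i, 0) Plus - 1. coefficient (i, 0) Plus k *\<^sub>R Cvec T (J i) (a i) Plus 0 k)
      = (\<Sum>k=1..m (i, 0) Plus - 1. \<alpha>p i 0 k *\<^sub>R Cvec T (J i) (a i) Plus 0 k)"
    using i by (intro sum.cong) auto
  then show "side_sum (i, 0) Plus = (\<Sum>k=1..mnum T (J i) (a i) Plus 0.
            \<alpha>p i 0 k *\<^sub>R Cper T (J i) (N i) (a i) Plus 0 k)"
    using side_sum_eq[OF q, of Plus] Lvec_base[OF q, of Plus] m_eq(2)[OF q, of Plus] i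
    by (subst Cper_sum[OF _ refl]) auto
  have "(\<Sum>k=1..m (i, 0) Minus - 1. coefficient (i, 0) Minus k *\<^sub>R Cvec T (J i) (a i) Minus 1 k)
      = (\<Sum>k=1..m (i, 0) Minus - 1. \<alpha>m i 1 k *\<^sub>R Cvec T (J i) (a i) Minus 1 k)"
    using i by (intro sum.cong) auto
  then show "side_sum (i, 0) Minus = (\<Sum>k=1..mnum T (J i) (a i) Minus 1.
            \<alpha>m i 1 k *\<^sub>R Cper T (J i) (N i) (a i) Minus 1 k)"
    using side_sum_eq[OF q, of Minus] Lvec_base[OF q, of Minus] m_eq(2)[OF q, of Minus] i
      periodic_piece(1)[OF i]
    by (subst Cper_sum[OF _ refl]) auto
qed

lemma sum_over_sides: "(\<Sum>q\<in>Q. \<Sum>\<sigma>\<in>{Plus, Minus}. g q \<sigma>)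
  = (\<Sum>j<N 0. g (0, j) Plus + g (0, j) Minus) + (\<Sum>i=1..n. g (i, 0) Plus + g (i, 0) Minus)"
  for g :: "nat \<times> nat \<Rightarrow> side \<Rightarrow> 'v::ab_group_add"
proof -
  have "(\<Sum>q\<in>Q. \<Sum>\<sigma>\<in>{Plus, Minus}. g q \<sigma>) = (\<Sum>q\<in>Q. g q Plus + g q Minus)" by simp
  also have "\<dots> = (\<Sum>i\<in>{..n}. \<Sum>j<N i. g (i, j) Plus + g (i, j) Minus)"
    unfolding Q_def by (simp add: sum.Sigma case_prod_beta)
  also have "{..n} = insert 0 {1..n}" by auto
  also have "(\<Sum>i\<in>insert 0 {1..n}. \<Sum>j<N i. g (i, j) Plus + g (i, j) Minus)
      = (\<Sum>j<N 0. g (0, j) Plus + g (0, j) Minus) + (\<Sum>i=1..n. \<Sum>j<N i. g (i, j) Plus + g (i, j) Minus)"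
    by simp
  also have "(\<Sum>i=1..n. \<Sum>j<N i. g (i, j) Plus + g (i, j) Minus)
      = (\<Sum>i=1..n. g (i, 0) Plus + g (i, 0) Minus)"
    using periodic_piece(1) by (intro sum.cong) simp_all
  finally show ?thesis .
qed

lemma total:
  "(\<Sum>q\<in>Q. \<Sum>\<sigma>\<in>{Plus, Minus}. side_sum q \<sigma>) + (\<Sum>b\<in>sdiscs_notX T. \<alpha>X b *\<^sub>R Cdisc T b) = 0"
proof -
  define cp where "cp j = (\<Sum>k=1..mnum T (J 0) (a 0) Plus j - 1. \<alpha>p 0 j k *\<^sub>R Cvec T (J 0) (a 0) Plus j k)
            + \<alpha>Rp j *\<^sub>R Rvec T (J 0) (a 0) Plus j" for j
  define cm where "cm j = (\<Sum>k=1..mnum T (J 0) (a 0) Minus j - 1. \<alpha>m 0 j k *\<^sub>R Cvec T (J 0) (a 0) Minus j k)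
            + \<alpha>Rm j *\<^sub>R Rvec T (J 0) (a 0) Minus j" for j
  define l where "l j = \<alpha>L j *\<^sub>R Lvec T (J 0) (N 0) (a 0) j" for j
  obtain M where M: "N 0 = Suc M" using N0_pos by (cases "N 0") auto
  have "(\<Sum>j<N 0. side_sum (0, j) Plus + side_sum (0, j) Minus)
      = (\<Sum>j<N 0. (l j + cp j) + ((if Suc j = N 0 then l (N 0) else 0) + cm (Suc j)))"
    by (intro sum.cong) (simp_all only: side_sum_component lessThan_iff cp_def cm_def l_def)
  also have "\<dots> = (\<Sum>j<N 0. l j) + (\<Sum>j<N 0. cp j) + (l (N 0) + (\<Sum>j<N 0. cm (Suc j)))"
    unfolding sum.distrib by (simp add: M)
  also have "(\<Sum>j<N 0. cm (Suc j)) = (\<Sum>j=1..N 0. cm j)"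
    by (simp add: sum.atLeast1_atMost_eq)
  also have "(\<Sum>j<N 0. l j) + (\<Sum>j<N 0. cp j) + (l (N 0) + (\<Sum>j=1..N 0. cm j))
      = (\<Sum>j\<in>{0..<N 0}. cp j) + (\<Sum>j=1..N 0. cm j) + (\<Sum>j=0..N 0. l j)"
    by (simp add: atLeast0AtMost lessThan_atLeast0[symmetric] M lessThan_Suc_atMost)
  finally have c: "(\<Sum>j<N 0. side_sum (0, j) Plus + side_sum (0, j) Minus)
      = (\<Sum>j\<in>{0..<N 0}. cp j) + (\<Sum>j=1..N 0. cm j) + (\<Sum>j=0..N 0. l j)" .
  have p: "(\<Sum>i=1..n. side_sum (i, 0) Plus + side_sum (i, 0) Minus)
      = (\<Sum>i=1..n. \<Sum>k=1..mnum T (J i) (a i) Plus 0.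
            \<alpha>p i 0 k *\<^sub>R Cper T (J i) (N i) (a i) Plus 0 k)
       + (\<Sum>i=1..n. \<Sum>k=1..mnum T (J i) (a i) Minus 1.
            \<alpha>m i 1 k *\<^sub>R Cper T (J i) (N i) (a i) Minus 1 k)"
    using side_sum_periodic by (simp add: sum.distrib)
  show ?thesis
    unfolding sum_over_sides c p using relation
    unfolding cp_def[symmetric] cm_def[symmetric] l_def[symmetric] by (simp only: add_ac)
qed

lemma total_linear:
  assumes f: "linear (f :: wvec \<Rightarrow> real)"
  shows "(\<Sum>q\<in>Q. \<Sum>\<sigma>\<in>{Plus, Minus}. \<Sum>t<height q. W q \<sigma> (Suc t) * f (evec_at (visit q \<sigma> t))
       + (W q \<sigma> (Suc t) - W q \<sigma> t) * f (fvec_at (visit q \<sigma> t)))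
    + (\<Sum>b\<in>sdiscs_notX T. \<alpha>X b * ((\<Sum>t<landing_time T b. f (evec_at (siter T t b)))
        + f (fvec_at b) - f (fvec_at (siter T (landing_time T b) b)))) = 0"
proof -
  have "f ((\<Sum>q\<in>Q. \<Sum>\<sigma>\<in>{Plus, Minus}. side_sum q \<sigma>) + (\<Sum>b\<in>sdiscs_notX T. \<alpha>X b *\<^sub>R Cdisc T b)) = 0"
    unfolding total by (rule linear_0[OF f])
  moreover have "f (side_sum q \<sigma>) = (\<Sum>t<height q. W q \<sigma> (Suc t) * f (evec_at (visit q \<sigma> t))
       + (W q \<sigma> (Suc t) - W q \<sigma> t) * f (fvec_at (visit q \<sigma> t)))" for q \<sigma>
    unfolding side_sum_def by (simp add: linear_sum[OF f] linear_add[OF f] linear_scale[OF f])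
  moreover have "f (\<Sum>b\<in>sdiscs_notX T. \<alpha>X b *\<^sub>R Cdisc T b)
    = (\<Sum>b\<in>sdiscs_notX T. \<alpha>X b * ((\<Sum>t<landing_time T b. f (evec_at (siter T t b)))
        + f (fvec_at b) - f (fvec_at (siter T (landing_time T b) b))))"
    unfolding linear_sum[OF f] linear_scale[OF f]
    by (intro sum.cong) (simp_all add: Cdisc_eq linear_sum[OF f] linear_add[OF f] linear_diff[OF f])
  ultimately show ?thesis by (simp add: linear_sum[OF f] linear_add[OF f])
qed

lemma W_unchanged:
  assumes "q \<in> Q" "t < height q" "visit q \<sigma> t \<notin> sdiscs T"
  shows "W q \<sigma> (Suc t) = W q \<sigma> t"
proof -
  have "t \<notin> landings q \<sigma>" using assms by (simp add: landings_eq)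
  then have "{l \<in> landings q \<sigma>. l < Suc t} = {l \<in> landings q \<sigma>. l < t}"
    using less_Suc_eq by auto
  then show ?thesis by (simp add: W_def)
qed

lemma base_corner_valid: assumes "q \<in> Q" shows "sp_in (corner (base q) \<sigma>) (0, 1)"
  using tower_side.z_valid[OF side[OF assms]] .

text \<open>The two balance conditions are the coordinates of the relation, grouped by visits.\<close>

sublocale weighted_towers T r Q base height W "J 0" \<alpha>X
proof
  show "finite Q" by (simp add: Q_def)
  fix q assume q: "q \<in> Q"
  note tw = tower_base[OF q]
  have i: "fst q \<le> n" using q by (auto simp: Q_def)
  show "fst (base q) < snd (base q)" "0 < height q" using tw by (simp_all add: tower_def)
  show "ivl (base q) \<subseteq> attractor T" using tw J_attractor[OF i] by (auto simp: tower_def)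
  show "rigid T (base q) t" if "t \<le> height q" for t using tw that by (simp add: tower_def)
  show "(itm_map T ^^ t) x \<notin> ivl (J 0)" if t: "0 < t" "t < height q" "x \<in> ivl (base q)" for t x
    using q
  proof (cases rule: Q_cases)
    case (component j)
    then have "(itm_map T ^^ t) ` ivl (base q) \<inter> ivl (J 0) = {}" using tw t by (auto simp: tower_def)
    then show ?thesis using t(3) by blast
  next
    case (periodic i)
    have "x \<in> ivl (J i)" using t(3) periodic periodic_piece(2)[OF periodic(2)] by simp
    then have "(itm_map T ^^ t) x \<in> orbit T (ivl (J i))" unfolding orbit_def by blast
    moreover have "orbit T (ivl (J i)) \<inter> orbit T (ivl (J 0)) = {}"
      using orbits_disjoint[of i 0] periodic by auto
    moreover have "ivl (J 0) \<subseteq> orbit T (ivl (J 0))"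
      unfolding orbit_def by (rule subsetI, rule UN_I[of 0]) auto
    ultimately show ?thesis by blast
  qed
  show "(\<forall>\<sigma>. visit q \<sigma> (height q) = corner (base q) \<sigma> \<and> W q \<sigma> (height q) = W q \<sigma> 0)
      \<or> (ivl (base q) \<subseteq> ivl (J 0) \<and> (itm_map T ^^ height q) ` ivl (base q) \<subseteq> ivl (J 0))"
    using q
  proof (cases rule: Q_cases)
    case (component j)
    then show ?thesis using tw by (simp add: tower_def)
  next
    case (periodic i)
    have "W q \<sigma> (height q) = W q \<sigma> 0" for \<sigma>
    proof -
      have "{l \<in> landings q \<sigma>. l < height q} = landings q \<sigma>" using m_eq(4)[OF q, of \<sigma>] by auto
      then have "W q \<sigma> (height q) = coefficient q \<sigma> (m q \<sigma>)"
        by (simp add: W_def m_eq(1)[OF q])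
      then show ?thesis using periodic m_eq(2)[OF q, of \<sigma>] by (cases \<sigma>) (auto simp: W_def)
    qed
    then show ?thesis using periodic_returns[OF periodic(2)] periodic(1) by blast
  qed
next
  show "q = q' \<and> t = t'" if "q \<in> Q" "q' \<in> Q" "t < height q" "t' < height q'"
    "x \<in> ivl (base q)" "x' \<in> ivl (base q')" "(itm_map T ^^ t) x = (itm_map T ^^ t') x'"
    for q q' t t' x x' using towers_disjoint[OF that] .
  show "ivl (J 0) \<subseteq> attractor T" by (rule J0(3))
  show "W q \<sigma> (Suc t) = W q \<sigma> t" if "q \<in> Q" "t < height q" "visit q \<sigma> t \<notin> sdiscs T" for q \<sigma> t
    using W_unchanged[OF that] .
next
  fix s assume s: "s \<in> {1..r}"
  have 1: "W q \<sigma> (Suc t) * ecoef s (evec_at (visit q \<sigma> t))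
        + (W q \<sigma> (Suc t) - W q \<sigma> t) * ecoef s (fvec_at (visit q \<sigma> t))
      = W q \<sigma> (Suc t) * of_bool (sp_in (visit q \<sigma> t) (cell T s))" if "q \<in> Q" for q \<sigma> t
    using ecoef_at[OF siter_valid[OF base_corner_valid[OF that]] s] by simp
  have 2: "\<alpha>X b * ((\<Sum>t<landing_time T b. ecoef s (evec_at (siter T t b)))
        + ecoef s (fvec_at b) - ecoef s (fvec_at (siter T (landing_time T b) b)))
      = (\<Sum>t<landing_time T b. \<alpha>X b * of_bool (sp_in (siter T t b) (cell T s)))"
    if "b \<in> sdiscs_notX T" for b
    using ecoef_at[OF siter_valid[OF sdiscs_notX_valid[OF that]] s]
      ecoef_at[OF sdiscs_notX_valid[OF that] s] by (simp only: sum_distrib_left) simp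
  show "(\<Sum>q\<in>Q. \<Sum>\<sigma>\<in>{Plus, Minus}. \<Sum>t<height q.
          W q \<sigma> (Suc t) * of_bool (sp_in (visit q \<sigma> t) (cell T s)))
      + (\<Sum>b\<in>sdiscs_notX T. \<Sum>t<landing_time T b.
          \<alpha>X b * of_bool (sp_in (siter T t b) (cell T s))) = 0"
    using total_linear[OF linear_ecoef[of s]] by (simp only: 1 2 cong: sum.cong)
next
  fix \<psi> :: "real \<Rightarrow> real"
  have 1: "W q \<sigma> (Suc t) * linear_on_discs \<psi> (evec_at (visit q \<sigma> t))
        + (W q \<sigma> (Suc t) - W q \<sigma> t) * linear_on_discs \<psi> (fvec_at (visit q \<sigma> t))
      = (W q \<sigma> (Suc t) - W q \<sigma> t) * \<psi> (fst (visit q \<sigma> t))" if "q \<in> Q" "t \<in> {..<height q}" for q \<sigma> t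
    using linear_on_discs_at W_unchanged[OF that(1)] that(2)
    by (cases "visit q \<sigma> t \<in> sdiscs T") auto
  have 2: "\<alpha>X b * ((\<Sum>t<landing_time T b. linear_on_discs \<psi> (evec_at (siter T t b)))
        + linear_on_discs \<psi> (fvec_at b) - linear_on_discs \<psi> (fvec_at (siter T (landing_time T b) b)))
      = \<alpha>X b * (\<psi> (fst b) - \<psi> (fst (siter T (landing_time T b) b)))"
    if "b \<in> sdiscs_notX T" for b
    using landing_time(2)[OF that] that by (simp add: linear_on_discs_at sdiscs_notX_def)
  show "(\<Sum>q\<in>Q. \<Sum>\<sigma>\<in>{Plus, Minus}. \<Sum>t<height q.
          (W q \<sigma> (Suc t) - W q \<sigma> t) * \<psi> (fst (visit q \<sigma> t)))
      + (\<Sum>b\<in>sdiscs_notX T. \<alpha>X b * (\<psi> (fst b) - \<psi> (fst (siter T (landing_time T b) b)))) = 0"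
    using total_linear[OF linear_linear_on_discs[of \<psi>]] by (simp only: 1 2 cong: sum.cong)
qed

section \<open>The coefficients of a relation\<close>

lemma landing_in: assumes "q \<in> Q" "k < m q \<sigma>" shows "landing q \<sigma> k \<in> landings q \<sigma>"
  using nth_mem[of k "sorted_list_of_set (landings q \<sigma>)"] m_eq[OF assms(1)] assms(2) by simp

lemma coefficient_level:
  assumes q: "q \<in> Q" and k: "1 \<le> k" "k \<le> m q \<sigma>"
  shows "coefficient q \<sigma> k = (case \<sigma> of Plus \<Rightarrow> level q | Minus \<Rightarrow> - level q)"
proof -
  have k1: "k - 1 < card (landings q \<sigma>)" using k m_eq(1)[OF q, of \<sigma>] by simp
  then have "landing q \<sigma> (k - 1) \<in> landings q \<sigma>"
    using m_eq(1)[OF q, of \<sigma>] by (intro landing_in[OF q]) simp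
  then have "landing q \<sigma> (k - 1) < height q" "visit q \<sigma> (landing q \<sigma> (k - 1)) \<in> sdiscs T"
    unfolding landings_eq[OF q] by blast+
  then have "W q \<sigma> (Suc (landing q \<sigma> (k - 1))) = (case \<sigma> of Plus \<Rightarrow> level q | Minus \<Rightarrow> - level q)"
    by (rule weight_at_disc[OF q])
  then show ?thesis using card_up_to_nth[OF m_eq(3)[OF q] k1] k(1) by (simp add: W_def)
qed

definition first_disc :: "nat \<times> nat \<Rightarrow> side \<Rightarrow> real" where
  "first_disc q \<sigma> = fst (visit q \<sigma> (landing q \<sigma> 0))"

text \<open>From the first landing on the coefficients are constant, so that only the jump at the first
  landing remains.\<close>

lemma jump_sum:
  assumes q: "q \<in> Q"
  shows "(\<Sum>t<height q. (W q \<sigma> (Suc t) - W q \<sigma> t) * g (fst (visit q \<sigma> t)))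
    = ((case \<sigma> of Plus \<Rightarrow> level q | Minus \<Rightarrow> - level q) - coefficient q \<sigma> 0) * g (first_disc q \<sigma>)"
proof -
  obtain M where M: "card (landings q \<sigma>) = Suc M"
    using m_eq(1,2)[OF q, of \<sigma>] by (cases "card (landings q \<sigma>)") auto
  have "(\<Sum>t<height q. (W q \<sigma> (Suc t) - W q \<sigma> t) * g (fst (visit q \<sigma> t)))
      = (\<Sum>k<Suc M. (coefficient q \<sigma> (Suc k) - coefficient q \<sigma> k) * g (fst (visit q \<sigma> (landing q \<sigma> k))))"
    using sum_jumps[OF m_eq(3,4)[OF q], of "coefficient q \<sigma>" \<sigma> "\<lambda>t. g (fst (visit q \<sigma> t))"]
    by (simp only: W_def M real_scaleR_def)
  also have "\<dots> = (coefficient q \<sigma> (Suc 0) - coefficient q \<sigma> 0) * g (first_disc q \<sigma>)"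
  proof -
    have "coefficient q \<sigma> (Suc (Suc k)) = coefficient q \<sigma> (Suc k)" if "k < M" for k
      using coefficient_level[OF q, of "Suc (Suc k)" \<sigma>] coefficient_level[OF q, of "Suc k" \<sigma>]
        m_eq(1)[OF q, of \<sigma>] M that by simp
    then show ?thesis unfolding sum.lessThan_Suc_shift by (simp add: first_disc_def)
  qed
  also have "coefficient q \<sigma> (Suc 0) = (case \<sigma> of Plus \<Rightarrow> level q | Minus \<Rightarrow> - level q)"
    using coefficient_level[OF q, of 1 \<sigma>] m_eq(2)[OF q, of \<sigma>] by simp
  finally show ?thesis .
qed

text \<open>The discontinuity on which the division point \<open>a 0 j\<close> first lands.\<close>

definition division_disc :: "nat \<Rightarrow> real" where
  "division_disc j = (if j < N 0 then first_disc (0, j) Plus else first_disc (0, j - 1) Minus)"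

text \<open>The difference of the two sides in the claimed formula for \<open>\<alpha>L j\<close>.\<close>

definition defect :: "nat \<Rightarrow> real" where
  "defect j = (if j < N 0 then level (0, j) else 0) - (if 0 < j then level (0, j - 1) else 0) - \<alpha>L j"

lemma division_disc_Minus:
  assumes "0 < j" "j \<le> N 0"
  shows "division_disc j = first_disc (0, j - 1) Minus"
proof (cases "j < N 0")
  case True
  then have q: "(0, j) \<in> Q" "(0, j - 1) \<in> Q" by (auto simp: Q_def)
  show ?thesis
  proof (rule division_point[OF assms(1) True])
    fix l assume l: "l \<in> landings (0, j) Plus" "l \<in> landings (0, j - 1) Minus"
      "\<And>t. t \<in> landings (0, j) Plus \<Longrightarrow> l \<le> t" "\<And>t. t \<in> landings (0, j - 1) Minus \<Longrightarrow> l \<le> t"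
      "fst (visit (0, j) Plus l) = fst (visit (0, j - 1) Minus l)"
    have "landing (0, j) Plus 0 = l" by (rule sorted_list_first[OF m_eq(3)[OF q(1)] l(1,3)])
    moreover have "landing (0, j - 1) Minus 0 = l" by (rule sorted_list_first[OF m_eq(3)[OF q(2)] l(2,4)])
    ultimately show ?thesis using l(5) True by (simp add: division_disc_def first_disc_def)
  qed
qed (simp add: division_disc_def)

lemma first_disc_inj:
  assumes "q \<in> Q" "q' \<in> Q" "first_disc q \<sigma> = first_disc q' \<sigma>"
  shows "q = q'"
proof -
  have t: "landing q \<sigma> 0 < height q" "landing q' \<sigma> 0 < height q'"
    using landing_in[OF assms(1), of 0 \<sigma>] landing_in[OF assms(2), of 0 \<sigma>]
      m_eq(2,4)[OF assms(1), of \<sigma>] m_eq(2,4)[OF assms(2), of \<sigma>] by auto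
  have "visit q' \<sigma> (landing q' \<sigma> 0) = visit q \<sigma> (landing q \<sigma> 0)"
    using assms(3) snd_visit[OF assms(1), of "landing q \<sigma> 0" \<sigma>]
      snd_visit[OF assms(2), of "landing q' \<sigma> 0" \<sigma>] t by (simp add: first_disc_def prod_eq_iff)
  then show ?thesis using visits_distinct[OF assms(1,2) t] by blast
qed

text \<open>The towers to the right of the division points \<open>0\<close>, \..., \<open>N 0 - 1\<close>
  meet different signed points, and so do the towers to the left of \<open>1\<close>, \...,
  \<open>N 0\<close>. Only the first and the last division point have no such tower in common.\<close>

lemma division_disc_inj:
  assumes "j \<le> N 0" "j' \<le> N 0" "division_disc j = division_disc j'"
  shows "j = j' \<or> {j, j'} = {0, N 0}"
proof (cases "j < N 0 \<and> j' < N 0")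
  case True
  then have "first_disc (0, j) Plus = first_disc (0, j') Plus" using assms(3) by (simp add: division_disc_def)
  then show ?thesis using first_disc_inj[of "(0, j)" "(0, j')" Plus] True by (simp add: Q_def)
next
  case False
  show ?thesis
  proof (cases "0 < j \<and> 0 < j'")
    case True
    then have "first_disc (0, j - 1) Minus = first_disc (0, j' - 1) Minus"
      using assms division_disc_Minus by simp
    moreover have "(0, j - 1) \<in> Q" "(0, j' - 1) \<in> Q" using True assms(1,2) by (auto simp: Q_def)
    ultimately have "j - 1 = j' - 1" using first_disc_inj by blast
    then show ?thesis using True by auto
  next
    case False
    then show ?thesis using \<open>\<not> (j < N 0 \<and> j' < N 0)\<close> assms(1,2) by auto
  qed
qed

text \<open>This is the coordinate \<open>f\<close> of the relation at the discontinuity \<open>b\<close>.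
  Towers over periodic intervals drop out since their coefficients are constant around the
  cycle.\<close>

lemma defect_balance: "(\<Sum>j\<le>N 0. defect j * of_bool (division_disc j = b)) = 0"
proof -
  let ?I = "\<lambda>j. of_bool (division_disc j = b) :: real"
  define g where "g q \<sigma> = (\<Sum>t<height q. (W q \<sigma> (Suc t) - W q \<sigma> t) * of_bool (fst (visit q \<sigma> t) = b))"
    for q \<sigma>
  have g: "g q \<sigma> = ((case \<sigma> of Plus \<Rightarrow> level q | Minus \<Rightarrow> - level q) - coefficient q \<sigma> 0)
      * of_bool (first_disc q \<sigma> = b)" if "q \<in> Q" for q \<sigma>
    unfolding g_def by (rule jump_sum[OF that])
  have "(\<Sum>q\<in>Q. \<Sum>\<sigma>\<in>{Plus, Minus}. g q \<sigma>)
      + (\<Sum>b'\<in>sdiscs_notX T. \<alpha>X b' * (of_bool (fst b' = b)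
          - of_bool (fst (siter T (landing_time T b') b') = b))) = 0"
    unfolding g_def by (rule f_balance[of "\<lambda>x. of_bool (x = b)"])
  then have "(\<Sum>q\<in>Q. \<Sum>\<sigma>\<in>{Plus, Minus}. g q \<sigma>) = 0"
    using wandering_weight_zero by simp
  then have "(\<Sum>j<N 0. g (0, j) Plus + g (0, j) Minus) + (\<Sum>i=1..n. g (i, 0) Plus + g (i, 0) Minus) = 0"
    unfolding sum_over_sides .
  moreover have "g (i, 0) \<sigma> = 0" if i: "i \<in> {1..n}" for i \<sigma>
  proof -
    have q: "(i, 0) \<in> Q" using i periodic_piece[OF i] by (simp add: Q_def)
    have "coefficient (i, 0) \<sigma> 0 = coefficient (i, 0) \<sigma> (m (i, 0) \<sigma>)"
      using i m_eq(2)[OF q, of \<sigma>] by (cases \<sigma>) auto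
    then show ?thesis
      using g[OF q] coefficient_level[OF q, of "m (i, 0) \<sigma>" \<sigma>] m_eq(2)[OF q, of \<sigma>] by simp
  qed
  ultimately have "(\<Sum>j<N 0. g (0, j) Plus + g (0, j) Minus) = 0" by simp
  also have "(\<Sum>j<N 0. g (0, j) Plus + g (0, j) Minus)
      = (\<Sum>j<N 0. (level (0, j) - \<alpha>L j) * ?I j
          + (- level (0, j) - (if Suc j = N 0 then \<alpha>L (N 0) else 0)) * ?I (Suc j))"
  proof (rule sum.cong[OF refl])
    fix j assume "j \<in> {..<N 0}"
    then have j: "(0, j) \<in> Q" "j < N 0" by (auto simp: Q_def)
    have "division_disc (Suc j) = first_disc (0, j) Minus"
      using division_disc_Minus[of "Suc j"] j(2) by simp
    then show "g (0, j) Plus + g (0, j) Minus = (level (0, j) - \<alpha>L j) * ?I j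
          + (- level (0, j) - (if Suc j = N 0 then \<alpha>L (N 0) else 0)) * ?I (Suc j)"
      using g[OF j(1), of Plus] g[OF j(1), of Minus] j(2) by (auto simp: division_disc_def)
  qed
  finally have "(\<Sum>j<N 0. (level (0, j) - \<alpha>L j) * ?I j
          + (- level (0, j) - (if Suc j = N 0 then \<alpha>L (N 0) else 0)) * ?I (Suc j)) = 0" .
  moreover have "(\<Sum>j<N 0. (level (0, j) - \<alpha>L j) * ?I j
          + (- level (0, j) - (if Suc j = N 0 then \<alpha>L (N 0) else 0)) * ?I (Suc j))
      = (\<Sum>j\<le>N 0. defect j * ?I j)"
  proof -
    obtain M where M: "N 0 = Suc M" using N0_pos by (cases "N 0") auto
    have "(\<Sum>j\<le>N 0. defect j * ?I j) = (\<Sum>j\<le>N 0. (if j < N 0 then level (0, j) else 0) * ?I j)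
        - (\<Sum>j\<le>N 0. (if 0 < j then level (0, j - 1) else 0) * ?I j) - (\<Sum>j\<le>N 0. \<alpha>L j * ?I j)"
      by (simp add: defect_def left_diff_distrib sum_subtractf)
    also have "(\<Sum>j\<le>N 0. (if j < N 0 then level (0, j) else 0) * ?I j) = (\<Sum>j<N 0. level (0, j) * ?I j)"
      by (simp add: M lessThan_Suc_atMost)
    also have "(\<Sum>j\<le>N 0. (if 0 < j then level (0, j - 1) else 0) * ?I j)
        = (\<Sum>j<N 0. level (0, j) * ?I (Suc j))"
      by (simp add: M sum.atMost_Suc_shift lessThan_Suc_atMost del: sum.atMost_Suc)
    also have "(\<Sum>j\<le>N 0. \<alpha>L j * ?I j) = (\<Sum>j<N 0. \<alpha>L j * ?I j) + \<alpha>L (N 0) * ?I (N 0)"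
      by (simp add: M lessThan_Suc_atMost)
    also have "\<alpha>L (N 0) * ?I (N 0) = (\<Sum>j<N 0. (if Suc j = N 0 then \<alpha>L (N 0) else 0) * ?I (Suc j))"
      by (simp add: M)
    finally show ?thesis
      by (simp add: left_diff_distrib sum_subtractf sum.distrib sum_negf)
  qed
  ultimately show ?thesis by simp
qed

lemma defect_zero_if_alone:
  assumes "j \<le> N 0" "\<And>j'. j' \<le> N 0 \<Longrightarrow> j' \<noteq> j \<Longrightarrow> division_disc j' = division_disc j \<Longrightarrow> defect j' = 0"
  shows "defect j = 0"
proof -
  have "defect j' * of_bool (division_disc j' = division_disc j) = (if j' = j then defect j else 0)"
    if "j' \<le> N 0" for j' using assms(2)[OF that] by auto
  then have "(\<Sum>j'\<le>N 0. defect j' * of_bool (division_disc j' = division_disc j)) = defect j"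
    using assms(1) by simp
  then show ?thesis using defect_balance by simp
qed

text \<open>If the left end of \<open>J 0\<close> is not a discontinuity, its charge is \<open>\<alpha>L
  0\<close>, and it is the jump of the tail at an end of a component. Otherwise the left end is
  the discontinuity on which it lands. The right end cannot land on it too, because it would
  arrive from the left, with a floor of a tower attached to the left end of \<open>J 0\<close>.\<close>

lemma defect_0: "defect 0 = 0"
proof -
  have q: "(0, 0) \<in> Q" "(0, N 0 - 1) \<in> Q" using N0_pos by (auto simp: Q_def)
  have b: "fst (base (0, 0)) = fst (J 0)" using ends[of 0] by (simp add: base_def)
  have isolated: "\<not> {fst (J 0) - e..<fst (J 0)} \<subseteq> attractor T" if "e > 0" for e
    by (rule absorbing_isolated(1)[OF J0 that])
  show ?thesis
  proof (cases "0 \<in> landings (0, 0) Plus")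
    case False
    then have "{l \<in> landings (0, 0) Plus. l < Suc 0} = {}" by (auto simp: less_Suc_eq)
    then have "W (0, 0) Plus (Suc 0) = \<alpha>L 0" by (simp add: W_def)
    moreover have "W (0, 0) Plus (Suc 0) = level (0, 0)"
      by (rule weight_at_left_end[OF q(1)]) (use isolated b in simp)
    ultimately show ?thesis using N0_pos by (simp add: defect_def)
  next
    case True
    have "landing (0, 0) Plus 0 = 0" by (rule sorted_list_first[OF m_eq(3)[OF q(1)] True]) simp
    then have "division_disc 0 = fst (J 0)"
      using N0_pos b siter_0[OF corner_valid[OF q(1)], of Plus]
      by (simp add: division_disc_def first_disc_def)
    moreover have "division_disc (N 0) \<noteq> fst (J 0)"
    proof
      assume *: "division_disc (N 0) = fst (J 0)"
      define t where "t = landing (0, N 0 - 1) Minus 0"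
      have t: "t < height (0, N 0 - 1)"
        using landing_in[OF q(2), of 0 Minus] m_eq(2,4)[OF q(2), of Minus] by (auto simp: t_def)
      have "visit (0, N 0 - 1) Minus t = (fst (J 0), Minus)"
        using * snd_visit[OF q(2), of t Minus] t
        by (simp add: division_disc_def first_disc_def t_def prod_eq_iff)
      then show False using corner_germ_attractor[OF q(2), of t Minus] t isolated by auto
    qed
    ultimately have ne: "division_disc (N 0) \<noteq> division_disc 0" by simp
    show ?thesis
    proof (rule defect_zero_if_alone)
      fix j' assume j': "j' \<le> N 0" "j' \<noteq> 0" "division_disc j' = division_disc 0"
      then have "j' = N 0" using division_disc_inj[of j' 0] by (auto simp: doubleton_eq_iff)
      then show "defect j' = 0" using ne j'(3) by simp
    qed simp
  qed
qed

lemma defect_zero: assumes "j \<le> N 0" shows "defect j = 0"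
proof (cases "j = 0")
  case False
  have mid: "defect j = 0" if j: "0 < j" "j < N 0" for j
  proof (rule defect_zero_if_alone)
    fix j' assume j': "j' \<le> N 0" "j' \<noteq> j" "division_disc j' = division_disc j"
    then show "defect j' = 0" using division_disc_inj[of j' j] j by (auto simp: doubleton_eq_iff)
  qed (use j in simp)
  show ?thesis
  proof (cases "j = N 0")
    case True
    show ?thesis
    proof (rule defect_zero_if_alone[OF assms])
      fix j' assume "j' \<le> N 0" "j' \<noteq> j"
      then show "defect j' = 0" using mid[of j'] defect_0 True by (cases "j' = 0") auto
    qed
  qed (use mid False assms in auto)
qed (simp add: defect_0)

lemma periodic_conclusion:
  assumes i: "i \<in> {1..n}"
  shows "k \<in> {1..mnum T (J i) (a i) Plus 0} \<Longrightarrow> \<alpha>p i 0 k = level (i, 0)"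
    "k \<in> {1..mnum T (J i) (a i) Minus 1} \<Longrightarrow> \<alpha>m i 1 k = - level (i, 0)"
proof -
  have q: "(i, 0) \<in> Q" using i periodic_piece[OF i] by (simp add: Q_def)
  show "k \<in> {1..mnum T (J i) (a i) Plus 0} \<Longrightarrow> \<alpha>p i 0 k = level (i, 0)"
    using coefficient_level[OF q, of k Plus] i by simp
  show "k \<in> {1..mnum T (J i) (a i) Minus 1} \<Longrightarrow> \<alpha>m i 1 k = - level (i, 0)"
    using coefficient_level[OF q, of k Minus] i by simp
qed

lemma component_conclusion:
  assumes j: "j < N 0"
  shows "k \<in> {1..mnum T (J 0) (a 0) Plus j - 1} \<Longrightarrow> \<alpha>p 0 j k = level (0, j)"
    "\<alpha>Rp j = level (0, j)"
    "k \<in> {1..mnum T (J 0) (a 0) Minus (Suc j) - 1} \<Longrightarrow> \<alpha>m 0 (Suc j) k = - level (0, j)"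
    "\<alpha>Rm (Suc j) = - level (0, j)"
    "(if mnum T (J 0) (a 0) Plus j = 1 then \<alpha>Rp j else \<alpha>p 0 j 1) = level (0, j)"
    "(if mnum T (J 0) (a 0) Minus (Suc j) = 1 then \<alpha>Rm (Suc j) else \<alpha>m 0 (Suc j) 1) = - level (0, j)"
proof -
  have q: "(0, j) \<in> Q" using j by (simp add: Q_def)
  note p = m_eq(2)[OF q, of Plus] coefficient_level[OF q, of _ Plus]
  note mm = m_eq(2)[OF q, of Minus] coefficient_level[OF q, of _ Minus]
  show 1: "\<alpha>p 0 j k = level (0, j)" if k: "k \<in> {1..mnum T (J 0) (a 0) Plus j - 1}" for k
  proof -
    have "1 \<le> k" "k < mnum T (J 0) (a 0) Plus j" using k by auto
    then show ?thesis using p(2)[of k] by simp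
  qed
  show 2: "\<alpha>Rp j = level (0, j)" using p(1) p(2)[of "m (0, j) Plus"] by simp
  show 3: "\<alpha>m 0 (Suc j) k = - level (0, j)"
    if k: "k \<in> {1..mnum T (J 0) (a 0) Minus (Suc j) - 1}" for k
  proof -
    have "1 \<le> k" "k < mnum T (J 0) (a 0) Minus (Suc j)" using k by auto
    then show ?thesis using mm(2)[of k] by simp
  qed
  show 4: "\<alpha>Rm (Suc j) = - level (0, j)" using mm(1) mm(2)[of "m (0, j) Minus"] by simp
  show "(if mnum T (J 0) (a 0) Plus j = 1 then \<alpha>Rp j else \<alpha>p 0 j 1) = level (0, j)"
    using 1[of 1] 2 p(1) by auto
  show "(if mnum T (J 0) (a 0) Minus (Suc j) = 1 then \<alpha>Rm (Suc j) else \<alpha>m 0 (Suc j) 1) = - level (0, j)"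
    using 3[of 1] 4 mm(1) by auto
qed

end

theorem theorem3p5:
  fixes r n :: nat
    and T :: itm
    and J :: "nat \<Rightarrow> interval"
    and N :: "nat \<Rightarrow> nat"
    and a :: "nat \<Rightarrow> nat \<Rightarrow> real"
    and \<alpha>L \<alpha>Rp \<alpha>Rm :: "nat \<Rightarrow> real"
    and \<alpha>p \<alpha>m :: "nat \<Rightarrow> nat \<Rightarrow> nat \<Rightarrow> real"
    and \<alpha>X :: "spoint \<Rightarrow> real"
  assumes "2 \<le> r" and "T \<in> ITM r"
    and "\<forall>i\<le>n. ivl (J i) \<subseteq> attractor T"
    and "\<forall>i\<le>n. \<forall>i'\<le>n. i \<noteq> i' \<longrightarrow> orbit T (ivl (J i)) \<inter> orbit T (ivl (J i')) = {}"
    and "interval_component T (J 0)"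
    and "\<forall>i\<in>{1..n}. maximal_periodic_ivl T (J i)"
    and "\<forall>i\<le>n. return_partition T (J i) (N i) (a i)"
    and "land_times T (J 0) (fst (J 0), Plus) \<noteq> {}"
    and "land_times T (J 0) (snd (J 0), Minus) \<noteq> {}"
    and "\<forall>i\<in>{1..n}. (\<exists>t. siter T t (fst (J i), Plus) \<in> sdiscs T) \<and>
                     (\<exists>t. siter T t (snd (J i), Minus) \<in> sdiscs T)"
    and "(\<Sum>i=1..n. \<Sum>k=1..mnum T (J i) (a i) Plus 0.
            \<alpha>p i 0 k *\<^sub>R Cper T (J i) (N i) (a i) Plus 0 k)
       + (\<Sum>i=1..n. \<Sum>k=1..mnum T (J i) (a i) Minus 1.
            \<alpha>m i 1 k *\<^sub>R Cper T (J i) (N i) (a i) Minus 1 k)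
       + (\<Sum>j\<in>{0..<N 0}.
            (\<Sum>k=1..mnum T (J 0) (a 0) Plus j - 1. \<alpha>p 0 j k *\<^sub>R Cvec T (J 0) (a 0) Plus j k)
            + \<alpha>Rp j *\<^sub>R Rvec T (J 0) (a 0) Plus j)
       + (\<Sum>j=1..N 0.
            (\<Sum>k=1..mnum T (J 0) (a 0) Minus j - 1. \<alpha>m 0 j k *\<^sub>R Cvec T (J 0) (a 0) Minus j k)
            + \<alpha>Rm j *\<^sub>R Rvec T (J 0) (a 0) Minus j)
       + (\<Sum>j=0..N 0. \<alpha>L j *\<^sub>R Lvec T (J 0) (N 0) (a 0) j)
       + (\<Sum>b\<in>sdiscs_notX T. \<alpha>X b *\<^sub>R Cdisc T b) = 0"
  shows "(\<forall>i\<in>{1..n}.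
            (\<forall>k\<in>{1..mnum T (J i) (a i) Plus 0}. \<alpha>p i 0 k = \<alpha>p i 0 1) \<and>
            (\<forall>k\<in>{1..mnum T (J i) (a i) Minus 1}. \<alpha>p i 0 1 = - \<alpha>m i 1 k))
       \<and> (\<forall>j<N 0.
            (\<forall>k\<in>{1..mnum T (J 0) (a 0) Plus j - 1}. \<alpha>p 0 j k = \<alpha>Rp j) \<and>
            (\<forall>k\<in>{1..mnum T (J 0) (a 0) Minus (j + 1) - 1}. \<alpha>Rp j = - \<alpha>m 0 (j + 1) k) \<and>
            \<alpha>Rp j = - \<alpha>Rm (j + 1))
       \<and> \<alpha>L 0 = (if mnum T (J 0) (a 0) Plus 0 = 1 then \<alpha>Rp 0 else \<alpha>p 0 0 1)
       \<and> \<alpha>L (N 0) = (if mnum T (J 0) (a 0) Minus (N 0) = 1 then \<alpha>Rm (N 0) else \<alpha>m 0 (N 0) 1)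
       \<and> (\<forall>j\<in>{1..N 0 - 1}.
            \<alpha>L j = (if mnum T (J 0) (a 0) Plus j = 1 then \<alpha>Rp j else \<alpha>p 0 j 1)
                  + (if mnum T (J 0) (a 0) Minus j = 1 then \<alpha>Rm j else \<alpha>m 0 j 1))
       \<and> (\<forall>b\<in>sdiscs_notX T. \<alpha>X b = 0)"
proof -
  interpret tower_family T r n J N a
    by unfold_locales (use assms in blast)+
  interpret vector_relation T r n J N a \<alpha>L \<alpha>Rp \<alpha>Rm \<alpha>p \<alpha>m \<alpha>X
    by unfold_locales (rule assms(11))
  note P = component_conclusion
  have first: "\<alpha>p i 0 1 = level (i, 0)" if i: "i \<in> {1..n}" for i
  proof -
    have "(i, 0) \<in> Q" using i periodic_piece[OF i] by (simp add: Q_def)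
    then have "0 < mnum T (J i) (a i) Plus 0" using m_eq(2)[of "(i, 0)" Plus] by simp
    then show ?thesis using periodic_conclusion(1)[OF i, of 1] by simp
  qed
  have L: "\<alpha>L j = (if j < N 0 then level (0, j) else 0) - (if 0 < j then level (0, j - 1) else 0)"
    if "j \<le> N 0" for j using defect_zero[OF that] by (simp add: defect_def)
  have last: "\<alpha>L (N 0) = (if mnum T (J 0) (a 0) Minus (N 0) = 1 then \<alpha>Rm (N 0) else \<alpha>m 0 (N 0) 1)"
  proof -
    have S: "Suc (N 0 - 1) = N 0" using N0_pos by simp
    show ?thesis using P(6)[of "N 0 - 1", unfolded S] L[of "N 0"] N0_pos by simp
  qed
  have inner: "\<alpha>L j = (if mnum T (J 0) (a 0) Plus j = 1 then \<alpha>Rp j else \<alpha>p 0 j 1)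
                  + (if mnum T (J 0) (a 0) Minus j = 1 then \<alpha>Rm j else \<alpha>m 0 j 1)"
    if j: "j \<in> {1..N 0 - 1}" for j
  proof -
    have "j < N 0" "0 < j" "Suc (j - 1) = j" "j - 1 < N 0" using j by auto
    then show ?thesis using P(5)[of j] P(6)[of "j - 1"] L[of j] by (simp only: if_True less_imp_le)
  qed
  show ?thesis
  proof (intro conjI ballI allI impI)
    show "\<alpha>p i 0 k = \<alpha>p i 0 1" if "i \<in> {1..n}" "k \<in> {1..mnum T (J i) (a i) Plus 0}" for i k
      using periodic_conclusion(1)[OF that] first[OF that(1)] by simp
    show "\<alpha>p i 0 1 = - \<alpha>m i 1 k" if "i \<in> {1..n}" "k \<in> {1..mnum T (J i) (a i) Minus 1}" for i k
      using periodic_conclusion(2)[OF that] first[OF that(1)] by simp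
    show "\<alpha>p 0 j k = \<alpha>Rp j" if "j < N 0" "k \<in> {1..mnum T (J 0) (a 0) Plus j - 1}" for j k
      using P(1)[OF that] P(2)[OF that(1)] by simp
    show "\<alpha>Rp j = - \<alpha>m 0 (j + 1) k"
      if "j < N 0" "k \<in> {1..mnum T (J 0) (a 0) Minus (j + 1) - 1}" for j k
      using P(3)[OF that(1), of k] P(2)[OF that(1)] that(2) by simp
    show "\<alpha>Rp j = - \<alpha>Rm (j + 1)" if "j < N 0" for j using P(4)[OF that] P(2)[OF that] by simp
    show "\<alpha>L 0 = (if mnum T (J 0) (a 0) Plus 0 = 1 then \<alpha>Rp 0 else \<alpha>p 0 0 1)"
      using P(5)[OF N0_pos] L[of 0] N0_pos by simp
    show "\<alpha>X b = 0" if "b \<in> sdiscs_notX T" for b using wandering_weight_zero[OF that] .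
  qed (fact last inner)+
qed

end
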